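(* Let $\mathbb F$ be a field, $n\geq m\geq1$, let $\mathsf E_1\subset\cdots\subset\mathsf E_n\subset\cdots$ be the filtration of the chain Barratt-Eccles operad by $E_n$-operads, let $\mathsf D_n=\Lambda^{-n}\mathsf E_n^\vee$, and let $x$ be a variable of degree $-m$. Let $\phi_m:B^c(\mathsf D_m)\to\mathsf C$ be the augmentation morphism, $\omega_m\in\widehat{\mathsf E}_m(x)$ the associated element, and $\partial_m(\xi)=\xi\circ\omega_m$ the associated twisting derivation of $\widehat{\mathsf E}_n(x)$. The adjoint homomorphism of $\partial_m:\widehat{\mathsf E}_n(x)\to\widehat{\mathsf E}_n(x)$ corresponds, under the isomorphisms $$\Sigma^{-n}\widehat{\mathsf E}_n(x)^\vee\simeq\Sigma^{-n}\mathsf E_n^\vee(\mathbb F[m])\simeq\Lambda^{-n}\mathsf E_n^\vee(\mathbb F[m-n])=\mathsf D_n(\bar N^*(S^{n-m})),$$ to the twisting coderivation $\partial_\alpha:\mathsf D_n(\bar N^*(S^{n-m}))\to\mathsf D_n(\bar N^*(S^{n-m}))$ of the complex $C^{\mathsf E_n}_*(\bar N^*(S^{n-m}))=(\mathsf D_n(\bar N^*(S^{n-m})),\partial_\alpha)$ computing $H^{\mathsf E_n}_*(\bar N^*(S^{n-m}))$.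
   Context: Conventions. Dg-modules are $\mathbb Z$-graded with differential $\delta$ of degree $-1$; signs follow the Koszul convention; $\mathbb F[d]$ is the rank one module in degree $d$ and $\Sigma^dC=\mathbb F[d]\otimes C$. Operadic suspension of (co)operads: $\Lambda\mathsf P(r)=\mathbb F[1-r]\otimes\mathsf P(r)^\pm$ (signature twist), so that $\Lambda^{-n}\mathsf P(\Sigma^{-n}C)\simeq\Sigma^{-n}\mathsf P(C)$. For a (co)operad $\mathsf D$, $\mathsf D(C)=\bigoplus_r(\mathsf D(r)\otimes C^{\otimes r})_{\Sigma_r}$. $\mathsf C$ is the non-unital commutative operad, $\mathsf C(r)=\mathbb F$ for $r>0$. $B^c$ is the operadic cobar construction. Barratt-Eccles operad: $\mathsf E(r)$, $r\ge1$, is the normalized chain complex of the simplicial set with $d$-simplices $(w_0,\dots,w_d)\in\Sigma_r^{d+1}$; $\mathsf E_n(r)\subset\mathsf E(r)$ is spanned by the simplices such that, for each pair $i<j$, the relative order of $i,j$ in $w_0,\dots,w_d$ changes at most $n-1$ times. Free complete algebra: $\widehat{\mathsf P}(x)=\prod_{r\geq1}(\mathsf P(r)\otimes\mathbb Fx^{\otimes r})_{\Sigma_r}$, with continuous dual $\widehat{\mathsf P}(x)^\vee=\bigoplus_r((\mathsf P(r)\otimes\mathbb Fx^{\otimes r})_{\Sigma_r})^\vee$. The isomorphism $\widehat{\mathsf E}_n(x)^\vee\simeq\mathsf E_n^\vee(\mathbb F[m])$ sends $c(x^\vee,\dots,x^\vee)$, $c\in\mathsf E_n(r)^\vee$ ($x^\vee$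 the generator of $\mathbb F[m]$), to the functional $p(x,\dots,x)\mapsto\sum_{w\in\Sigma_r}c(w\cdot p)$ for $p\in\mathsf E_n(r)$ (with Koszul signs from the $\Sigma_r$-action on $x^{\otimes r}$), and $0$ on terms of order $\neq r$. The composition $\circ$ is the continuous bilinear extension of $p(x,\dots,x)\circ q(x,\dots,x)=\sum_{i=1}^r\pm p(x,\dots,q(x,\dots,x),\dots,x)$ ($q(x,\dots,x)$ in the $i$-th input of $p\in\mathsf P(r)$), with Koszul sign $(-1)^{(|q(x,\dots,x)|+m)(|p|+(i-1)m)}$. The element $\omega_m$: $\phi_m$ is equivalent to a twisting cochain $\theta_m:\mathsf D_m\to\mathsf C$ (equivariant, of degree $-1$, vanishing in arity $1$), and $\omega_m\in\widehat{\mathsf E}_m(x)$, of degree $-1-m$, has components $\omega_m(r)$ determined by $\theta_m(\xi)=\sum_{w\in\Sigma_r}\xi(w\cdot\omega_m(r))$ for $\xi\in\mathsf D_m(r)$; it satisfies $\delta(\omega_m)+\omega_m\circ\omega_m=0$ and is viewed in $\widehat{\mathsf E}_n(x)$ via $\iota:\mathsf E_m\subset\mathsf E_n$. The augmentation morphism $\phi_m$ is characterized up to homotopy by $\mu\mapsto\mu$, $\lambda\mapsto0$ on homology, where $H_*(B^c(\mathsf D_m))\cong H_*(\mathsf E_m)$ has product class $\mu$ and bracket class $\lambda$. The complex: $\bar N^*(S^{n-m})=\mathbb F[m-n]$, with endomorphism operad $\mathrm{End}_{\mathbb F[m-n]}=\Lambda^{m-n}\mathsf C$. Up to weak equivalence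 of algebras, its structure of algebra over $B^c(\mathsf D_n)\simeq\mathsf E_n$ is given by the composite $B^c(\Lambda^{-n}\mathsf E_n^\vee)\xrightarrow{\iota^*}B^c(\Lambda^{-n}\mathsf E_m^\vee)\simeq\Lambda^{m-n}B^c(\Lambda^{-m}\mathsf E_m^\vee)\xrightarrow{\Lambda^{m-n}\phi_m}\Lambda^{m-n}\mathsf C$, and $C_*^{\mathsf E_n}(\bar N^*(S^{n-m}))$ is formed from this structure: the homomorphism $\alpha:\mathsf D_n(\mathbb F[m-n])\to\mathbb F[m-n]$ is adjoint to the twisting cochain $\mathsf D_n\to\mathrm{End}_{\mathbb F[m-n]}$ of this composite. The coderivation $\partial_\alpha$ is given by $\partial_\alpha(c(a_1,\dots,a_r))=\sum\pm c'(a_*,\dots,\alpha(c''(a_*,\dots,a_* )),\dots,a_* )$, summed over all terms of the infinitesimal (two-factor) coproduct of $c$, including those where $c'$ or $c''$ is the unit $1\in\mathsf D_n(1)$. *)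

theory Defs
  imports "HOL-Combinatorics.Combinatorics" "HOL-Library.Function_Algebras" "HOL-Library.FuncSet"
begin

section \<open>Signs\<close>

definition ksgn :: "int \<Rightarrow> 'f::field" where
  "ksgn e = (if even e then 1 else - 1)"

text \<open>The action of \<open>w\<close> on \<open>v \<otimes> \<dots> \<otimes> v\<close>, for \<open>v\<close> of degree \<open>k\<close>.\<close>

definition sgnpow :: "int \<Rightarrow> (nat \<Rightarrow> nat) \<Rightarrow> 'f::field" where
  "sgnpow k w = (if even k then 1 else of_int (sign w))"

text \<open>A permutation of \<open>{1..r}\<close> is written either as a function or as the word of its values.\<close>

definition perm_of :: "nat list \<Rightarrow> nat \<Rightarrow> nat" where
  "perm_of l = (\<lambda>j. if 1 \<le> j \<and> j \<le> length l then l ! (j - 1) else j)"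

text \<open>The exponent of the Koszul sign of
  \<open>t\<^sub>1 \<otimes> \<dots> \<otimes> t\<^sub>k \<mapsto> t\<^bsub>w(1)\<^esub> \<otimes> \<dots> \<otimes> t\<^bsub>w(k)\<^esub>\<close>, where \<open>d j\<close> is the degree of \<open>t\<^sub>j\<close>.\<close>

definition koszul :: "(nat \<Rightarrow> int) \<Rightarrow> nat list \<Rightarrow> int" where
  "koszul d w = (\<Sum>(p, q)\<in>{(p, q). p < q \<and> q < length w \<and> w ! p > w ! q}. d (w ! p) * d (w ! q))"


section \<open>Operads and cooperads given by structure constants\<close>

text \<open>
  Every dg-(co)operad below has a homogeneous basis which is finite in each arity, and is recorded
  through its structure constants in this basis: \<open>act P w b b'\<close> is the coefficient of \<open>b'\<close> in
  \<open>w \<cdot> b\<close> (left action), \<open>dif P b b'\<close> is the coefficient of \<open>b'\<close> in \<open>\<delta>(b)\<close>, and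
  \<open>pcm P i a b c\<close> is, for an operad, the coefficient of \<open>c\<close> in \<open>a \<circ>\<^sub>i b\<close> and, for a cooperad, the
  coefficient of \<open>a \<otimes> b\<close> in the partial coproduct \<open>\<Delta>\<^sub>i(c)\<close> dual to \<open>\<circ>\<^sub>i\<close>.
\<close>

record ('b, 'f) dgop =
  basis :: "'b set"
  ar :: "'b \<Rightarrow> nat"
  dg :: "'b \<Rightarrow> int"
  act :: "(nat \<Rightarrow> nat) \<Rightarrow> 'b \<Rightarrow> 'b \<Rightarrow> 'f"
  dif :: "'b \<Rightarrow> 'b \<Rightarrow> 'f"
  pcm :: "nat \<Rightarrow> 'b \<Rightarrow> 'b \<Rightarrow> 'b \<Rightarrow> 'f"
  unt :: "'b"

definition bas :: "('b, 'f) dgop \<Rightarrow> nat \<Rightarrow> 'b set" where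
  "bas P r = {b \<in> basis P. ar P b = r}"

text \<open>
  The linear dual in the dual basis (the dual of \<open>b\<close> is denoted by the same symbol \<open>b\<close>). Duals are
  formed without sign: \<open>\<delta>\<close> and the coproduct are the plain transposes of \<open>\<delta>\<close> and \<open>\<circ>\<^sub>i\<close>, under
  \<open>(f \<otimes> g)(a \<otimes> b) = f(a) g(b)\<close>; and \<open>(w \<cdot> c)(p) = c(w\<^sup>-\<^sup>1 \<cdot> p)\<close>.
\<close>

definition dual :: "('b, 'f) dgop \<Rightarrow> ('b, 'f) dgop" where
  "dual P = P\<lparr>dg := \<lambda>b. - dg P b,
              act := \<lambda>w b b'. act P (inv w) b' b,
              dif := \<lambda>b b'. dif P b' b\<rparr>"

text \<open>
  The operadic suspension \<open>\<Lambda>\<^sup>k P(r) = \<bbbF>[k(1-r)] \<otimes> P(r)\<close>, twisted by the \<open>k\<close>-th power of the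
  signature; the basis element \<open>e\<^sub>r \<otimes> b\<close> is denoted by \<open>b\<close>. For \<open>v\<close> the generator of \<open>\<bbbF>[k]\<close>, the
  generator \<open>e\<^sub>r\<close> is the operation \<open>(v\<^sup>\<or>)\<^sup>\<otimes>\<^sup>(\<^sup>r\<^sup>-\<^sup>1\<^sup>) \<otimes> id\<close> of \<open>End(\<bbbF>[k])\<close>, so that
  \<open>e\<^sub>r \<circ>\<^sub>i e\<^sub>s = (-1)\<^bsup>k(r-i)(s-1)\<^esup> e\<^bsub>r+s-1\<^esub>\<close>. The second summand of the sign in \<open>pcm\<close> comes from the
  permutation of \<open>a\<close> and \<open>e\<^sub>s\<close>. The same signs define the suspension of a cooperad.
\<close>

definition susp :: "int \<Rightarrow> ('b, 'f::field) dgop \<Rightarrow> ('b, 'f) dgop" where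
  "susp k P = P\<lparr>
     dg := \<lambda>b. dg P b + k * (1 - int (ar P b)),
     act := \<lambda>w b b'. sgnpow k w * act P w b b',
     dif := \<lambda>b b'. ksgn (k * (1 - int (ar P b))) * dif P b b',
     pcm := \<lambda>i a b c. ksgn (k * (int (ar P a) - int i) * (int (ar P b) - 1)
                             + dg P a * (k * (1 - int (ar P b)))) * pcm P i a b c\<rparr>"

text \<open>
  The sign with \<open>e\<^sub>r(v, \<dots>, v) = \<plusminus> v\<close>, which gives the isomorphism between \<open>\<Lambda>\<^sup>k C\<close> and the
  endomorphism operad of \<open>\<bbbF>[k]\<close>.
\<close>

definition end_sgn :: "int \<Rightarrow> nat \<Rightarrow> 'f::field" where
  "end_sgn k r = ksgn (k * int ((r - 1) choose 2))"

definition Com :: "(nat, 'f::field) dgop" where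
  "Com = \<lparr>basis = {1..}, ar = (\<lambda>r. r), dg = (\<lambda>r. 0),
          act = (\<lambda>w r r'. of_bool (r' = r)), dif = (\<lambda>r r'. 0),
          pcm = (\<lambda>i r s t. of_bool (1 \<le> i \<and> i \<le> r \<and> t = r + s - 1)), unt = 1\<rparr>"

text \<open>A linear map is given by its matrix: \<open>\<phi> b c\<close> is the coefficient of \<open>c\<close> in \<open>\<phi>(b)\<close>.\<close>

definition operad_morphism ::
  "('b, 'f::field) dgop \<Rightarrow> ('c, 'f) dgop \<Rightarrow> ('b \<Rightarrow> 'c \<Rightarrow> 'f) \<Rightarrow> bool" where
  "operad_morphism P Q \<phi> \<longleftrightarrow>
     (\<forall>b\<in>basis P. \<forall>c. \<phi> b c \<noteq> 0 \<longrightarrow> c \<in> basis Q \<and> ar Q c = ar P b \<and> dg Q c = dg P b) \<and>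
     (\<forall>c. \<phi> (unt P) c = of_bool (c = unt Q)) \<and>
     (\<forall>b\<in>basis P. \<forall>w. w permutes {1..ar P b} \<longrightarrow> (\<forall>c\<in>basis Q.
        (\<Sum>b'\<in>bas P (ar P b). act P w b b' * \<phi> b' c)
          = (\<Sum>c'\<in>bas Q (ar P b). \<phi> b c' * act Q w c' c))) \<and>
     (\<forall>b\<in>basis P. \<forall>c\<in>basis Q.
        (\<Sum>b'\<in>bas P (ar P b). dif P b b' * \<phi> b' c)
          = (\<Sum>c'\<in>bas Q (ar P b). \<phi> b c' * dif Q c' c)) \<and>
     (\<forall>a\<in>basis P. \<forall>b\<in>basis P. \<forall>i\<in>{1..ar P a}. \<forall>c\<in>basis Q.
        (\<Sum>e\<in>bas P (ar P a + ar P b - 1). pcm P i a b e * \<phi> e c)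
          = (\<Sum>a'\<in>bas Q (ar P a). \<Sum>b'\<in>bas Q (ar P b). \<phi> a a' * \<phi> b b' * pcm Q i a' b' c))"

text \<open>
  The terms of the infinitesimal coproduct of \<open>c\<close>, with \<open>t = ar c\<close>, are indexed by the nonempty
  sets \<open>S \<subseteq> {1..t}\<close> of inputs of the upper factor. The upper factor is attached to the input
  \<open>i = Min S\<close> of the lower factor, and both factors are ordered increasingly, so that the inputs of
  the two-vertex tree are read in the order \<open>block_word t S\<close>. Thus, for \<open>w\<close> the corresponding
  permutation, \<open>\<Delta>\<^sub>S(c) = \<Delta>\<^sub>i(w\<^sup>-\<^sup>1 \<cdot> c)\<close> is dual to \<open>a \<otimes> b \<mapsto> w \<cdot> (a \<circ>\<^sub>i b)\<close>.
\<close>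

definition block_word :: "nat \<Rightarrow> nat set \<Rightarrow> nat list" where
  "block_word t S =
     [1..<Min S] @ sorted_list_of_set S @ filter (\<lambda>j. Min S < j \<and> j \<notin> S) [1..<t + 1]"

definition cop :: "('b, 'f::field) dgop \<Rightarrow> nat set \<Rightarrow> 'b \<Rightarrow> 'b \<Rightarrow> 'b \<Rightarrow> 'f" where
  "cop D S c a b = (\<Sum>c'\<in>bas D (ar D c).
     act D (inv (perm_of (block_word (ar D c) S))) c c' * pcm D (Min S) a b c')"


section \<open>The cobar construction\<close>

text \<open>
  The free symmetric operad on the desuspension of the part of arity \<open>\<ge> 2\<close> of \<open>D\<close> has a basis of
  shuffle trees: planar trees with vertices decorated by basis elements, leaves numbered from
  \<open>1\<close> to \<open>r\<close>, and such that the smallest leaves of the subtrees above any given vertex increase from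
  left to right. The tree \<open>Vertex b [t\<^sub>1, \<dots>, t\<^sub>k]\<close> is the composite \<open>(s\<^sup>-\<^sup>1b)(t\<^sub>1, \<dots>, t\<^sub>k)\<close>, with the
  vertices ordered in prefix order.
\<close>

datatype 'b dtree = Leaf nat | Vertex 'b "'b dtree list"

primrec leaves :: "'b dtree \<Rightarrow> nat list" where
  "leaves (Leaf j) = [j]"
| "leaves (Vertex b ts) = concat (map leaves ts)"

definition min_leaf :: "'b dtree \<Rightarrow> nat" where
  "min_leaf t = Min (set (leaves t))"

primrec shuffle_tree :: "('b, 'f) dgop \<Rightarrow> 'b dtree \<Rightarrow> bool" where
  "shuffle_tree D (Leaf j) = True"
| "shuffle_tree D (Vertex b ts) =
     (b \<in> basis D \<and> ar D b = length ts \<and> 2 \<le> length ts \<and>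
      sorted_wrt (\<lambda>s t. min_leaf s < min_leaf t) ts \<and> list_all (shuffle_tree D) ts)"

primrec tree_dg :: "('b, 'f) dgop \<Rightarrow> 'b dtree \<Rightarrow> int" where
  "tree_dg D (Leaf j) = 0"
| "tree_dg D (Vertex b ts) = dg D b - 1 + sum_list (map (tree_dg D) ts)"

primrec tree_subst :: "(nat \<Rightarrow> 'b dtree) \<Rightarrow> 'b dtree \<Rightarrow> 'b dtree" where
  "tree_subst g (Leaf j) = g j"
| "tree_subst g (Vertex b ts) = Vertex b (map (tree_subst g) ts)"

definition relabel :: "(nat \<Rightarrow> nat) \<Rightarrow> 'b dtree \<Rightarrow> 'b dtree" where
  "relabel f = tree_subst (\<lambda>j. Leaf (f j))"

definition graft :: "nat \<Rightarrow> 'b dtree \<Rightarrow> 'b dtree \<Rightarrow> 'b dtree" where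
  "graft i s t = tree_subst (\<lambda>j.
     if j < i then Leaf j
     else if j = i then relabel (\<lambda>l. l + i - 1) t
     else Leaf (j + length (leaves t) - 1)) s"

primrec prefix_word :: "'b dtree \<Rightarrow> ('b + nat) list" where
  "prefix_word (Leaf j) = [Inr j]"
| "prefix_word (Vertex b ts) = Inl b # concat (map prefix_word ts)"

text \<open>The total degree of the vertices which follow the leaf \<open>i\<close>.\<close>

definition dg_after :: "('b, 'f) dgop \<Rightarrow> nat \<Rightarrow> 'b dtree \<Rightarrow> int" where
  "dg_after D i t = sum_list (map (case_sum (\<lambda>b. dg D b - 1) (\<lambda>j. 0))
     (dropWhile (\<lambda>x. x \<noteq> Inr i) (prefix_word t)))"

text \<open>
  The expansion of an arbitrary decorated tree in the basis of shuffle trees: the subtrees above a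
  vertex \<open>b\<close> are put in the order \<open>\<pi>\<close>, by
  \<open>b(t\<^sub>1, \<dots>, t\<^sub>k) = \<plusminus> (\<pi>\<^sup>-\<^sup>1 \<cdot> b)(t\<^bsub>\<pi>(1)\<^esub>, \<dots>, t\<^bsub>\<pi>(k)\<^esub>)\<close>.
\<close>

primrec straighten :: "('b, 'f::field) dgop \<Rightarrow> 'b dtree \<Rightarrow> 'b dtree \<Rightarrow> 'f" where
  "straighten D (Leaf j) t' = of_bool (t' = Leaf j)"
| "straighten D (Vertex b ts) t' =
     (case t' of Leaf j \<Rightarrow> 0 | Vertex b' ts' \<Rightarrow>
        if length ts' \<noteq> length ts then 0
        else let \<pi> = sort_key (\<lambda>j. min_leaf (ts ! (j - 1))) [1..<length ts + 1] in
          ksgn (koszul (\<lambda>j. tree_dg D (ts ! (j - 1))) \<pi>) * act D (inv (perm_of \<pi>)) b b'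
          * (\<Prod>j<length ts. (map (straighten D) ts ! (\<pi> ! j - 1)) (ts' ! j)))"

text \<open>
  The term of the differential of \<open>Vertex b ts\<close> associated to a factor \<open>b' \<otimes> b''\<close> of \<open>\<Delta>\<^sub>S(b)\<close>: the
  tree, and its sign \<open>(-1)\<^bsup>|b'|\<^esup>\<close> (from \<open>s\<^sup>-\<^sup>1 \<otimes> s\<^sup>-\<^sup>1\<close>) times the Koszul sign of the permutation of
  \<open>s\<^sup>-\<^sup>1b''\<close> and the \<open>ts\<close>.
\<close>

definition split_tree :: "nat set \<Rightarrow> 'b \<Rightarrow> 'b \<Rightarrow> 'b dtree list \<Rightarrow> 'b dtree" where
  "split_tree S b' b'' ts =
     (let us = map (\<lambda>j. ts ! (j - 1)) (block_word (length ts) S); i = Min S - 1 in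
      Vertex b' (take i us @ Vertex b'' (take (card S) (drop i us)) # drop (i + card S) us))"

definition split_exp :: "('b, 'f) dgop \<Rightarrow> nat set \<Rightarrow> 'b \<Rightarrow> 'b \<Rightarrow> 'b dtree list \<Rightarrow> int" where
  "split_exp D S b' b'' ts =
     dg D b' + koszul (\<lambda>j. tree_dg D (ts ! (j - 1))) (block_word (length ts) S)
     + (dg D b'' - 1) * (\<Sum>j<Min S - 1. tree_dg D (ts ! j))"

text \<open>
  The derivation with
  \<open>\<partial>(s\<^sup>-\<^sup>1b) = - s\<^sup>-\<^sup>1\<delta>(b) - \<Sum> (-1)\<^bsup>|b'|\<^esup> s\<^sup>-\<^sup>1b' \<circ>\<^sub>S s\<^sup>-\<^sup>1b''\<close>, so that a morphism on the cobar
  construction corresponds to a solution of \<open>\<delta>(\<theta>) + \<theta> \<star> \<theta> = 0\<close>.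
\<close>

primrec tree_dif :: "('b, 'f::field) dgop \<Rightarrow> 'b dtree \<Rightarrow> 'b dtree \<Rightarrow> 'f" where
  "tree_dif D (Leaf j) t' = 0"
| "tree_dif D (Vertex b ts) t' =
     - (\<Sum>b'\<in>bas D (length ts). dif D b b' * of_bool (t' = Vertex b' ts))
     - (\<Sum>S\<in>{S. S \<subseteq> {1..length ts} \<and> 2 \<le> card S \<and> card S < length ts}.
          \<Sum>b'\<in>bas D (length ts - card S + 1). \<Sum>b''\<in>bas D (card S).
            ksgn (split_exp D S b' b'' ts) * cop D S b b' b'' * of_bool (t' = split_tree S b' b'' ts))
     + (\<Sum>j<length ts. case t' of Leaf l \<Rightarrow> 0 | Vertex b' ts' \<Rightarrow>
          if b' = b \<and> length ts' = length ts \<and> (\<forall>l<length ts. l \<noteq> j \<longrightarrow> ts' ! l = ts ! l)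
          then ksgn (dg D b - 1 + (\<Sum>l<j. tree_dg D (ts ! l))) * (map (tree_dif D) ts ! j) (ts' ! j)
          else 0)"

definition cobar :: "('b, 'f::field) dgop \<Rightarrow> ('b dtree, 'f) dgop" where
  "cobar D = \<lparr>
     basis = {t. shuffle_tree D t \<and> distinct (leaves t) \<and> set (leaves t) = {1..length (leaves t)}},
     ar = (\<lambda>t. length (leaves t)),
     dg = tree_dg D,
     act = (\<lambda>w t t'. straighten D (relabel w t) t'),
     dif = tree_dif D,
     pcm = (\<lambda>i s t u. of_bool (1 \<le> i \<and> i \<le> length (leaves s) \<and> u = graft i s t)
                       * ksgn (tree_dg D t * dg_after D i s)),
     unt = Leaf 1\<rparr>"

definition corolla :: "('b, 'f) dgop \<Rightarrow> 'b \<Rightarrow> 'b dtree" where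
  "corolla D b = Vertex b (map Leaf [1..<ar D b + 1])"

text \<open>The twisting cochain \<open>\<theta>(b) = \<phi>(s\<^sup>-\<^sup>1b)\<close> of a morphism \<open>\<phi>\<close> on \<open>cobar D\<close>.\<close>

definition twisting_cochain ::
  "('b, 'f::field) dgop \<Rightarrow> ('b dtree \<Rightarrow> 'c \<Rightarrow> 'f) \<Rightarrow> 'b \<Rightarrow> 'c \<Rightarrow> 'f" where
  "twisting_cochain D \<phi> b c = (if 2 \<le> ar D b then \<phi> (corolla D b) c else 0)"

text \<open>
  The isomorphism \<open>B\<^sup>c(\<Lambda>\<^bsup>k+l\<^esup>P) \<simeq> \<Lambda>\<^sup>k B\<^sup>c(\<Lambda>\<^sup>lP)\<close> is diagonal in the bases of trees. At each vertex
  it uses \<open>e\<^sub>r \<mapsto> (-1)\<^bsup>kl r(r-1)/2\<^esup> e\<^sub>r \<otimes> e\<^sub>r\<close> from \<open>\<Lambda>\<^bsup>k+l\<^esup>\<close> to \<open>\<Lambda>\<^sup>k\<Lambda>\<^sup>l\<close> (the sign of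
  \<open>(v \<otimes> v')\<^sup>\<otimes>\<^sup>r \<mapsto> v\<^sup>\<otimes>\<^sup>r \<otimes> v'\<^sup>\<otimes>\<^sup>r\<close>) and the permutation of \<open>s\<^sup>-\<^sup>1\<close> with \<open>e\<^sub>r\<close>; the remaining
  signs are those of the composition products of \<open>\<Lambda>\<^sup>k\<close>, for
  \<open>Vertex b [t\<^sub>1, \<dots>, t\<^sub>K]\<close> composed from left to right, and of the action of the permutation
  which numbers the leaves.
\<close>

primrec cobar_susp_exp :: "int \<Rightarrow> int \<Rightarrow> ('b, 'f::field) dgop \<Rightarrow> 'b dtree \<Rightarrow> int" where
  "cobar_susp_exp k l P (Leaf j) = 0"
| "cobar_susp_exp k l P (Vertex b ts) =
     k * (1 - int (length ts)) + k * l * int (length ts choose 2)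
     + sum_list (map (cobar_susp_exp k l P) ts)
     + (\<Sum>j<length ts.
          k * (int (length ts) - 1 - int j) * (int (length (leaves (ts ! j))) - 1)
          + k * (1 - int (length (leaves (ts ! j))))
              * (dg (susp l P) b - 1 + (\<Sum>i<j. tree_dg (susp l P) (ts ! i))))"

definition cobar_susp_sgn :: "int \<Rightarrow> int \<Rightarrow> ('b, 'f::field) dgop \<Rightarrow> 'b dtree \<Rightarrow> 'f" where
  "cobar_susp_sgn k l P t = ksgn (cobar_susp_exp k l P t) * sgnpow k (perm_of (leaves t))"


section \<open>The Barratt-Eccles operad\<close>

text \<open>
  The word \<open>[w(1), \<dots>, w(r)]\<close> stands for \<open>w\<close>, hence for the operation
  \<open>x\<^bsub>w(1)\<^esub> \<cdots> x\<^bsub>w(r)\<^esub>\<close>; the relative order of \<open>i\<close> and \<open>j\<close> is their order of occurrence.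
\<close>

type_synonym simplex = "nat list list"

definition occurs_before :: "nat \<Rightarrow> nat \<Rightarrow> nat list \<Rightarrow> bool" where
  "occurs_before i j w \<longleftrightarrow> (\<exists>p q. p < q \<and> q < length w \<and> w ! p = i \<and> w ! q = j)"

definition be_simplices :: "nat \<Rightarrow> nat \<Rightarrow> simplex set" where
  "be_simplices n r = {b. b \<noteq> [] \<and> set b \<subseteq> permutations_of_set {1..r} \<and> distinct_adj b \<and>
     (\<forall>i j. 1 \<le> i \<and> i < j \<and> j \<le> r \<longrightarrow>
        card {k. Suc k < length b \<and> occurs_before i j (b ! k) \<noteq> occurs_before i j (b ! Suc k)}
          \<le> n - 1)}"

definition word_comp :: "nat \<Rightarrow> nat list \<Rightarrow> nat list \<Rightarrow> nat list" where
  "word_comp i u v = concat (map (\<lambda>j.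
     if j < i then [j]
     else if j = i then map (\<lambda>l. l + i - 1) v
     else [j + length v - 1]) u)"

text \<open>
  The terms of the Eilenberg-Zilber map are indexed by shuffles \<open>\<sigma>\<close>, where \<open>True\<close> is a step in the
  first simplex and \<open>False\<close> a step in the second one.
\<close>

definition ez_path :: "nat \<Rightarrow> simplex \<Rightarrow> simplex \<Rightarrow> bool list \<Rightarrow> simplex" where
  "ez_path i a b \<sigma> = map (\<lambda>k. word_comp i (a ! count_list (take k \<sigma>) True)
                                         (b ! count_list (take k \<sigma>) False)) [0..<length \<sigma> + 1]"

definition ez_exp :: "bool list \<Rightarrow> int" where
  "ez_exp \<sigma> = int (card {(k, l). k < l \<and> l < length \<sigma> \<and> \<not> \<sigma> ! k \<and> \<sigma> ! l})"

definition BE :: "nat \<Rightarrow> (simplex, 'f::field) dgop" where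
  "BE n = \<lparr>
     basis = (\<Union>r\<in>{1..}. be_simplices n r),
     ar = (\<lambda>b. length (hd b)),
     dg = (\<lambda>b. int (length b) - 1),
     act = (\<lambda>w b b'. of_bool (b' = map (map w) b)),
     dif = (\<lambda>b b'. \<Sum>k<length b.
              ksgn (int k) * of_bool (b' = take k b @ drop (Suc k) b \<and> b' \<noteq> [] \<and> distinct_adj b')),
     pcm = (\<lambda>i a b c.
              if 1 \<le> i \<and> i \<le> length (hd a) then
                \<Sum>\<sigma>\<in>shuffles (replicate (length a - 1) True) (replicate (length b - 1) False).
                  ksgn (ez_exp \<sigma>) * of_bool (c = ez_path i a b \<sigma>)
              else 0),
     unt = [[1]]\<rparr>"

definition DE :: "nat \<Rightarrow> (simplex, 'f::field) dgop" where
  "DE n = susp (- int n) (dual (BE n))"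

text \<open>
  The complex \<open>B\<^sup>c(DE m)(2)\<close> is spanned by corollas. Its degree \<open>0\<close> homology class \<open>\<mu>\<close> is represented
  by the dual of the alternating \<open>(m-1)\<close>-simplex \<open>(id, \<tau>, id, \<dots>)\<close> (up to a sign, which depends on an
  orientation), and its degree \<open>m-1\<close> class \<open>\<lambda>\<close> by the sum of the duals of the vertices \<open>id\<close> and \<open>\<tau>\<close>.
  Since \<open>Com\<close> has no differential, \<open>\<phi>\<close> may be evaluated on these cycles.
\<close>

definition augmentation_morphism :: "nat \<Rightarrow> (simplex dtree \<Rightarrow> nat \<Rightarrow> 'f::field) \<Rightarrow> bool" where
  "augmentation_morphism m \<phi> \<longleftrightarrow>
     operad_morphism (cobar (DE m)) Com \<phi> \<and>
     \<phi> (Vertex (map (\<lambda>k. if even k then [1, 2] else [2, 1]) [0..<m]) [Leaf 1, Leaf 2]) 2 \<in> {1, - 1} \<and>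
     \<phi> (Vertex [[1, 2]] [Leaf 1, Leaf 2]) 2 + \<phi> (Vertex [[2, 1]] [Leaf 1, Leaf 2]) 2 = 0"


section \<open>Free algebras and coalgebras on one generator\<close>

text \<open>
  A function \<open>f\<close> on the basis of \<open>P\<close> stands for \<open>\<Sum> f(b) b(v, \<dots>, v)\<close>, where \<open>v\<close> is a generator of
  degree \<open>k\<close>. Arbitrary functions represent the elements of the product \<open>\<Prod>\<^sub>r P(r) \<otimes> \<bbbF>[k]\<^sup>\<otimes>\<^sup>r\<close>, functions
  of finite support those of the direct sum.
\<close>

definition series :: "('b, 'f::field) dgop \<Rightarrow> ('b \<Rightarrow> 'f) set" where
  "series P = {f. \<forall>b. b \<notin> basis P \<longrightarrow> f b = 0}"

definition fin_series :: "('b, 'f::field) dgop \<Rightarrow> ('b \<Rightarrow> 'f) set" where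
  "fin_series P = {f \<in> series P. finite {b. f b \<noteq> 0}}"

definition comp_ar :: "('b, 'f::field) dgop \<Rightarrow> nat \<Rightarrow> ('b \<Rightarrow> 'f) \<Rightarrow> 'b \<Rightarrow> 'f" where
  "comp_ar P r f = (\<lambda>b. if b \<in> bas P r then f b else 0)"

text \<open>The diagonal action of \<open>w\<close>, in arity \<open>r\<close>, on \<open>P(r) \<otimes> \<bbbF>[k]\<^sup>\<otimes>\<^sup>r\<close>.\<close>

definition tact :: "('b, 'f::field) dgop \<Rightarrow> int \<Rightarrow> (nat \<Rightarrow> nat) \<Rightarrow> ('b \<Rightarrow> 'f) \<Rightarrow> 'b \<Rightarrow> 'f" where
  "tact P k w f = (\<lambda>b'. \<Sum>b\<in>bas P (ar P b'). sgnpow k w * act P w b b' * f b)"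

definition scale :: "'f::field \<Rightarrow> ('b \<Rightarrow> 'f) \<Rightarrow> 'b \<Rightarrow> 'f" where
  "scale a f = (\<lambda>b. a * f b)"

definition coinv_sub :: "('b, 'f::field) dgop \<Rightarrow> int \<Rightarrow> ('b \<Rightarrow> 'f) set" where
  "coinv_sub P k = {f \<in> series P. \<forall>r. comp_ar P r f \<in> module.span scale
     {tact P k w g - g | w g. w permutes {1..r} \<and> g \<in> series P \<and> comp_ar P r g = g}}"

definition coinv_rel ::
  "('b \<Rightarrow> 'f) set \<Rightarrow> ('b, 'f::field) dgop \<Rightarrow> int \<Rightarrow> (('b \<Rightarrow> 'f) \<times> ('b \<Rightarrow> 'f)) set" where
  "coinv_rel A P k = {(f, g). f \<in> A \<and> g \<in> A \<and> f - g \<in> coinv_sub P k}"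

definition ccls :: "('b, 'f::field) dgop \<Rightarrow> int \<Rightarrow> ('b \<Rightarrow> 'f) \<Rightarrow> ('b \<Rightarrow> 'f) set" where
  "ccls P k f = coinv_rel (series P) P k `` {f}"

definition fcls :: "('b, 'f::field) dgop \<Rightarrow> int \<Rightarrow> ('b \<Rightarrow> 'f) \<Rightarrow> ('b \<Rightarrow> 'f) set" where
  "fcls P k f = coinv_rel (fin_series P) P k `` {f}"

text \<open>The complete free algebra \<open>\<Prod>\<^sub>r (P(r) \<otimes> \<bbbF>[k]\<^sup>\<otimes>\<^sup>r)\<^sub>\<Sigma>\<close>.\<close>

definition cfree :: "('b, 'f::field) dgop \<Rightarrow> int \<Rightarrow> ('b \<Rightarrow> 'f) set set" where
  "cfree P k = series P // coinv_rel (series P) P k"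

text \<open>The object \<open>P(\<bbbF>[k]) = \<Oplus>\<^sub>r (P(r) \<otimes> \<bbbF>[k]\<^sup>\<otimes>\<^sup>r)\<^sub>\<Sigma>\<close>.\<close>

definition ffree :: "('b, 'f::field) dgop \<Rightarrow> int \<Rightarrow> ('b \<Rightarrow> 'f) set set" where
  "ffree P k = fin_series P // coinv_rel (fin_series P) P k"

text \<open>
  The linear forms on \<open>cfree P k\<close> which vanish on the terms of large arity, that is, the elements of
  \<open>\<Oplus>\<^sub>r ((P(r) \<otimes> \<bbbF>[k]\<^sup>\<otimes>\<^sup>r)\<^sub>\<Sigma>)\<^sup>\<or>\<close>.
\<close>

definition cdual :: "('b, 'f::field) dgop \<Rightarrow> int \<Rightarrow> (('b \<Rightarrow> 'f) set \<Rightarrow> 'f) set" where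
  "cdual P k = {u \<in> extensional (cfree P k).
     (\<forall>f\<in>series P. \<forall>g\<in>series P. u (ccls P k (f + g)) = u (ccls P k f) + u (ccls P k g)) \<and>
     (\<forall>a. \<forall>f\<in>series P. u (ccls P k (scale a f)) = a * u (ccls P k f)) \<and>
     (\<exists>N. \<forall>f\<in>series P. (\<forall>b. ar P b \<le> N \<longrightarrow> f b = 0) \<longrightarrow> u (ccls P k f) = 0)}"

text \<open>
  The composition of series in a variable \<open>x\<close> of degree \<open>k = -m\<close>. The first summand of
  the sign is \<open>(|b(x, \<dots>, x)| + m)(|a| + (i-1)m)\<close>; the second one is that of
  \<open>a(x, \<dots>, b(x, \<dots>, x), \<dots>, x) = \<plusminus> (a \<circ>\<^sub>i b)(x, \<dots>, x)\<close>, where \<open>b\<close> crosses the \<open>i - 1\<close> first variables.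
\<close>

definition series_comp ::
  "('b, 'f::field) dgop \<Rightarrow> int \<Rightarrow> ('b \<Rightarrow> 'f) \<Rightarrow> ('b \<Rightarrow> 'f) \<Rightarrow> 'b \<Rightarrow> 'f" where
  "series_comp P k f g = (\<lambda>c.
     \<Sum>(a, b)\<in>{(a, b). a \<in> basis P \<and> b \<in> basis P \<and> ar P a + ar P b = ar P c + 1}.
       \<Sum>i=1..ar P a.
         ksgn ((dg P b + int (ar P b) * k - k) * (dg P a + (int i - 1) * k)
               + dg P b * ((int i - 1) * k))
         * f a * g b * pcm P i a b c)"

definition cfree_comp ::
  "('b, 'f::field) dgop \<Rightarrow> int \<Rightarrow> ('b \<Rightarrow> 'f) set \<Rightarrow> ('b \<Rightarrow> 'f) set \<Rightarrow> ('b \<Rightarrow> 'f) set" where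
  "cfree_comp P k X Y = (\<Union>f\<in>X. \<Union>g\<in>Y. ccls P k (series_comp P k f g))"

text \<open>The adjoint is the plain transpose, in accordance with the sign-free duality of \<open>dual\<close>.\<close>

definition adjoint ::
  "('b, 'f::field) dgop \<Rightarrow> int \<Rightarrow> (('b \<Rightarrow> 'f) set \<Rightarrow> ('b \<Rightarrow> 'f) set)
     \<Rightarrow> (('b \<Rightarrow> 'f) set \<Rightarrow> 'f) \<Rightarrow> ('b \<Rightarrow> 'f) set \<Rightarrow> 'f" where
  "adjoint P k T u = restrict (\<lambda>X. u (T X)) (cfree P k)"

text \<open>
  The desuspension \<open>\<Sigma>\<^bsup>-n\<^esup>T\<close> of a map \<open>T\<close> of degree \<open>-1\<close> on linear forms: \<open>\<Sigma>\<^bsup>-n\<^esup>Z\<close> is identified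
  with \<open>Z\<close> as a vector space, by \<open>\<sigma> \<otimes> z \<mapsto> z\<close>, and \<open>T\<close> has to cross \<open>\<sigma>\<close>.
\<close>

definition desusp_map ::
  "nat \<Rightarrow> ('b, 'f::field) dgop \<Rightarrow> int \<Rightarrow> ((('b \<Rightarrow> 'f) set \<Rightarrow> 'f) \<Rightarrow> ('b \<Rightarrow> 'f) set \<Rightarrow> 'f)
     \<Rightarrow> (('b \<Rightarrow> 'f) set \<Rightarrow> 'f) \<Rightarrow> ('b \<Rightarrow> 'f) set \<Rightarrow> 'f" where
  "desusp_map n P k T u = restrict (\<lambda>X. ksgn (int n) * T u X) (cfree P k)"


section \<open>The element \<open>\<omega>\<^sub>m\<close> and the twisting derivation\<close>

text \<open>
  The pairing \<open>\<xi>(p)\<close> of \<open>\<xi> = e\<^sub>r \<otimes> c\<close> in \<open>DE m\<close> with \<open>p\<close> in \<open>BE m\<close> is \<open>c(p)\<close>; it suffices to let \<open>\<xi>\<close>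
  run over the basis. The action on \<open>\<omega>\<^sub>m(r)\<close> is the action on \<open>BE m (r) \<otimes> x\<^sup>\<otimes>\<^sup>r\<close>.
\<close>

definition associated_element ::
  "nat \<Rightarrow> (simplex dtree \<Rightarrow> nat \<Rightarrow> 'f::field) \<Rightarrow> (simplex \<Rightarrow> 'f) set \<Rightarrow> bool" where
  "associated_element m \<phi> \<omega> \<longleftrightarrow>
     \<omega> \<in> cfree (BE m) (- int m) \<and>
     (\<exists>f\<in>\<omega>. \<forall>b. f b \<noteq> 0 \<longrightarrow>
        dg (BE m :: (simplex, 'f) dgop) b - int m * int (ar (BE m :: (simplex, 'f) dgop) b)
          = - 1 - int m) \<and>
     (\<forall>f\<in>\<omega>. \<forall>r. \<forall>\<xi>\<in>bas (DE m :: (simplex, 'f) dgop) r.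
        twisting_cochain (DE m) \<phi> \<xi> r
          = (\<Sum>w | w permutes {1..r}. tact (BE m) (- int m) w f \<xi>))"

definition twisting_derivation ::
  "nat \<Rightarrow> nat \<Rightarrow> (simplex \<Rightarrow> 'f::field) set \<Rightarrow> (simplex \<Rightarrow> 'f) set \<Rightarrow> (simplex \<Rightarrow> 'f) set" where
  "twisting_derivation n m \<omega> X =
     cfree_comp (BE n) (- int m) X (\<Union>f\<in>\<omega>. ccls (BE n) (- int m) f)"


section \<open>The twisting coderivation\<close>

text \<open>
  The composite \<open>B\<^sup>c(\<Lambda>\<^bsup>-n\<^esup>E\<^sub>n\<^sup>\<or>) \<rightarrow> B\<^sup>c(\<Lambda>\<^bsup>-n\<^esup>E\<^sub>m\<^sup>\<or>) \<simeq> \<Lambda>\<^bsup>m-n\<^esup>B\<^sup>c(\<Lambda>\<^bsup>-m\<^esup>E\<^sub>m\<^sup>\<or>) \<rightarrow> \<Lambda>\<^bsup>m-n\<^esup>C\<close>.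
  In the dual bases, the first map is the projection onto the trees decorated by \<open>E\<^sub>m\<close>.
\<close>

definition sphere_morphism ::
  "nat \<Rightarrow> nat \<Rightarrow> (simplex dtree \<Rightarrow> nat \<Rightarrow> 'f::field) \<Rightarrow> simplex dtree \<Rightarrow> nat \<Rightarrow> 'f" where
  "sphere_morphism n m \<phi> t c =
     of_bool (t \<in> basis (cobar (susp (- int n) (dual (BE m)) :: (simplex, 'f) dgop)))
     * cobar_susp_sgn (int m - int n) (- int m) (dual (BE m) :: (simplex, 'f) dgop) t * \<phi> t c"

text \<open>The coefficient of \<open>v\<close> in \<open>\<alpha>(b(v, \<dots>, v))\<close>, where \<open>v\<close> generates \<open>\<bbbF>[m-n]\<close>.\<close>

definition sphere_alpha :: "nat \<Rightarrow> nat \<Rightarrow> (simplex dtree \<Rightarrow> nat \<Rightarrow> 'f::field) \<Rightarrow> simplex \<Rightarrow> 'f" where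
  "sphere_alpha n m \<phi> b =
     (let r = ar (DE n :: (simplex, 'f) dgop) b in
      twisting_cochain (DE n) (sphere_morphism n m \<phi>) b r * end_sgn (int m - int n) r)"

text \<open>
  The coefficient of \<open>a(v, \<dots>, v)\<close> in \<open>\<partial>\<^sub>\<alpha>(c(v, \<dots>, v))\<close>, for \<open>v\<close> of degree \<open>k\<close>. The sets \<open>S = {1..t}\<close>
  and \<open>S = {j}\<close> give the terms with a unit factor. The three signs come from the permutation of the
  inputs \<open>v\<close>, from moving \<open>b\<close> to its \<open>i\<close>-th place (\<open>i = Min S\<close>), and from moving \<open>\<alpha>\<close>, of degree \<open>-1\<close>,
  to that place.
\<close>

definition coderivation_coeff ::
  "('b, 'f::field) dgop \<Rightarrow> int \<Rightarrow> ('b \<Rightarrow> 'f) \<Rightarrow> 'b \<Rightarrow> 'b \<Rightarrow> 'f" where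
  "coderivation_coeff D k \<alpha> c a = (if a \<in> basis D then
     \<Sum>S\<in>{S. S \<subseteq> {1..ar D c} \<and> S \<noteq> {} \<and> ar D a + card S = ar D c + 1}. \<Sum>b\<in>bas D (card S).
       sgnpow k (perm_of (block_word (ar D c) S))
       * ksgn (dg D b * ((int (Min S) - 1) * k))
       * ksgn (dg D a + (int (Min S) - 1) * k)
       * cop D S c a b * \<alpha> b
     else 0)"

definition twisting_coderivation ::
  "('b, 'f::field) dgop \<Rightarrow> int \<Rightarrow> ('b \<Rightarrow> 'f) \<Rightarrow> ('b \<Rightarrow> 'f) set \<Rightarrow> ('b \<Rightarrow> 'f) set" where
  "twisting_coderivation D k \<alpha> Y =
     (\<Union>f\<in>Y. fcls D k (\<lambda>a. \<Sum>c | f c \<noteq> 0. f c * coderivation_coeff D k \<alpha> c a))"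


section \<open>The isomorphisms\<close>

text \<open>
  The map \<open>P\<^sup>\<or>(\<bbbF>[m]) \<rightarrow> cdual P (-m)\<close> which sends \<open>c(x\<^sup>\<or>, \<dots>, x\<^sup>\<or>)\<close> to
  \<open>p(x, \<dots>, x) \<mapsto> \<Sum>\<^sub>w c(w \<cdot> p)\<close>, with the action on \<open>p \<otimes> x\<^sup>\<otimes>\<^sup>r\<close>.
\<close>

definition norm_pairing :: "('b, 'f::field) dgop \<Rightarrow> int \<Rightarrow> ('b \<Rightarrow> 'f) \<Rightarrow> ('b \<Rightarrow> 'f) \<Rightarrow> 'f" where
  "norm_pairing P k c p =
     (\<Sum>b | c b \<noteq> 0. c b * (\<Sum>w | w permutes {1..ar P b}. tact P k w p b))"

definition norm_iso ::
  "('b, 'f::field) dgop \<Rightarrow> int \<Rightarrow> ('b \<Rightarrow> 'f) set \<Rightarrow> ('b \<Rightarrow> 'f) set \<Rightarrow> 'f" where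
  "norm_iso P k Y = restrict (\<lambda>X. the_elem (\<Union>c\<in>Y. norm_pairing P k c ` X)) (cfree P k)"

text \<open>
  The map \<open>\<Lambda>\<^bsup>-n\<^esup>P\<^sup>\<or>(\<Sigma>\<^bsup>-n\<^esup>\<bbbF>[m]) \<rightarrow> \<Sigma>\<^bsup>-n\<^esup>P\<^sup>\<or>(\<bbbF>[m])\<close>. For \<open>\<sigma>\<close> of degree \<open>-n\<close> and
  \<open>y\<close> of degree \<open>m\<close>, it is \<open>(e\<^sub>r \<otimes> c)(\<sigma>y, \<dots>, \<sigma>y) \<mapsto> \<plusminus> e\<^sub>r(\<sigma>, \<dots>, \<sigma>) c(y, \<dots>, y)\<close>: \<open>c\<close>
  crosses \<open>r\<close> factors \<open>\<sigma>\<close>, the factors \<open>\<sigma>\<close> and \<open>y\<close> are separated, and \<open>e\<^sub>r\<close> is evaluated.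
\<close>

definition susp_iso ::
  "nat \<Rightarrow> nat \<Rightarrow> ('b, 'f::field) dgop \<Rightarrow> ('b \<Rightarrow> 'f) set \<Rightarrow> ('b \<Rightarrow> 'f) set" where
  "susp_iso n m P Y = (\<Union>f\<in>Y. fcls (dual P) (int m) (\<lambda>b.
     ksgn (dg (dual P) b * (int n * int (ar P b)) + int n * int m * int (ar P b choose 2))
     * end_sgn (- int n) (ar P b) * f b))"

end

theory Submission
  imports Defs
begin

text \<open>
  The symmetric groups act freely on the basis of the Barratt-Eccles operad, so that a class of
  coinvariants is determined by its symmetrization \<open>N\<close>, and the norm isomorphism becomes the pairing
  \<open>\<Sum> c(b) (N p)(b) = \<Sum> (N c)(b) p(b)\<close>. It remains to evaluate \<open>N(p \<circ> \<omega>)\<close> on a basis element \<open>c\<close>.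
  Permuting the inputs of a composite \<open>a \<circ>\<^sub>j b\<close> in all possible ways amounts to choosing a set \<open>S\<close> of
  inputs for \<open>b\<close> and permuting the inputs of \<open>a\<close> and of \<open>b\<close> separately; hence \<open>N(p \<circ> \<omega>)(c)\<close> is the
  value of \<open>N p \<otimes> N \<omega>\<close> on the infinitesimal coproduct of \<open>c\<close>. Finally \<open>N \<omega>\<close> is the twisting cochain
  \<open>\<theta>\<^sub>m\<close>, extended by zero from \<open>E\<^sub>m\<close> to \<open>E\<^sub>n\<close>. The signs agree because \<open>\<theta>\<^sub>m\<close> vanishes except on the
  simplices of degree \<open>m(r - 1) - 1\<close> in arity \<open>r\<close>.
\<close>

section \<open>Words and orders of occurrence\<close>

text \<open>The coderivation and the derivation are given on representatives, and that they respect
  classes is not checked on the generators of the relations. Instead \<open>pairing_cod\<close> is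
  proved first, for arbitrary representatives. One of its sides sees the finite series
  \<open>c\<close> only through its class; the other sees \<open>p\<close> only through its class
  and does not contain the chosen representative of \<omega>. As the pairing is nondegenerate on
  classes, both operations descend, and the same identity is then read on classes. Nondegeneracy has
  to hold in every characteristic, so r! cannot be inverted. Freeness replaces the division: each
  orbit contains exactly one simplex whose first vertex is the identity, and a function supported on
  these representatives has a norm with at most one term at each simplex. The signs are kept in two
  groups. Signatures of permutations are handled by \<open>sgnpow\<close> and multiply along the
  block decomposition. All others depend only on dimensions, arities and the place of composition,
  and end in one congruence modulo 2, \<open>sign_parity\<close>.\<close>

lemma occurs_before_Nil [simp]: "\<not> occurs_before p q []"
  by (simp add: occurs_before_def)

lemma occurs_before_Cons:
  "occurs_before p q (x # xs) \<longleftrightarrow> (p = x \<and> q \<in> set xs) \<or> occurs_before p q xs"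
proof
  assume "occurs_before p q (x # xs)"
  then obtain k l where kl: "k < l" "l < length (x # xs)" "(x # xs) ! k = p" "(x # xs) ! l = q"
    unfolding occurs_before_def by blast
  then obtain l' where l': "l = Suc l'" by (cases l) auto
  show "(p = x \<and> q \<in> set xs) \<or> occurs_before p q xs"
  proof (cases k)
    case 0
    then show ?thesis using kl l' by auto
  next
    case (Suc k')
    then show ?thesis using kl l' unfolding occurs_before_def by auto
  qed
next
  assume "(p = x \<and> q \<in> set xs) \<or> occurs_before p q xs"
  then show "occurs_before p q (x # xs)"
  proof
    assume h: "p = x \<and> q \<in> set xs"
    then obtain l where "l < length xs" "xs ! l = q" by (auto simp: in_set_conv_nth)
    then show ?thesis using h unfolding occurs_before_def
      by (intro exI[of _ 0] exI[of _ "Suc l"]) auto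
  next
    assume "occurs_before p q xs"
    then obtain k l where "k < l" "l < length xs" "xs ! k = p" "xs ! l = q"
      unfolding occurs_before_def by blast
    then show ?thesis unfolding occurs_before_def
      by (intro exI[of _ "Suc k"] exI[of _ "Suc l"]) auto
  qed
qed

lemma occurs_before_append:
  "occurs_before p q (xs @ ys) \<longleftrightarrow>
     occurs_before p q xs \<or> occurs_before p q ys \<or> (p \<in> set xs \<and> q \<in> set ys)"
  by (induction xs) (auto simp: occurs_before_Cons)

lemma occurs_before_in_set: "occurs_before p q xs \<Longrightarrow> p \<in> set xs \<and> q \<in> set xs"
  by (induction xs) (auto simp: occurs_before_Cons)

text \<open>The letters \<open>p\<close> and \<open>q\<close> may be absent from the word, so
  injectivity is also required at them; later they are the preimages of arbitrary letters under a
  permutation.\<close>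

lemma occurs_before_map:
  "inj_on f (set xs \<union> {p, q}) \<Longrightarrow> occurs_before (f p) (f q) (map f xs) \<longleftrightarrow> occurs_before p q xs"
proof (induction xs)
  case (Cons x xs)
  have "inj_on f (set xs \<union> {p, q})"
    by (rule inj_on_subset[OF Cons.prems]) auto
  with Cons.IH have IH: "occurs_before (f p) (f q) (map f xs) \<longleftrightarrow> occurs_before p q xs" .
  have "f p = f x \<longleftrightarrow> p = x" using inj_on_eq_iff[OF Cons.prems] by simp
  moreover have "f q \<in> f ` set xs \<longleftrightarrow> q \<in> set xs"
    using inj_on_image_mem_iff[OF Cons.prems, of q "set xs"] by auto
  ultimately show ?case using IH by (simp add: occurs_before_Cons)
qed simp

lemma occurs_before_swap:
  assumes "distinct xs" "p \<in> set xs" "q \<in> set xs" "p \<noteq> q"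
  shows "occurs_before q p xs \<longleftrightarrow> \<not> occurs_before p q xs"
  using assms by (induction xs) (auto simp: occurs_before_Cons dest: occurs_before_in_set)

text \<open>The first letter is the one that no other letter precedes, and removing it gives an
  induction. Pairs with \<open>p < q\<close> suffice because exchanging the letters negates the
  relation. This is how a step between distinct vertices of a simplex is seen to change the order of
  some pair.\<close>

lemma word_eqI_occurs_before:
  assumes "distinct xs" "distinct ys" "set xs = set ys"
    and "\<And>p q. p \<in> set xs \<Longrightarrow> q \<in> set xs \<Longrightarrow> p < q \<Longrightarrow> occurs_before p q xs = occurs_before p q ys"
  shows "xs = (ys :: nat list)"
proof -
  have "occurs_before p q xs = occurs_before p q ys" if "p \<in> set xs" "q \<in> set xs" "p \<noteq> q" for p q
  proof (cases "p < q")
    case False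
    then have "q < p" using that by simp
    then show ?thesis
      using assms(4)[of q p] that assms(1-3) occurs_before_swap[of xs q p] occurs_before_swap[of ys q p]
      by auto
  qed (use assms(4) that in auto)
  then show ?thesis using assms(1-3)
  proof (induction xs arbitrary: ys)
    case (Cons x xs)
    then obtain y ys' where ys: "ys = y # ys'" by (cases ys) auto
    have xy: "x = y"
    proof (rule ccontr)
      assume "x \<noteq> y"
      then have "y \<in> set xs" using Cons.prems ys by auto
      then have "occurs_before x y (x # xs)" by (simp add: occurs_before_Cons)
      then have "occurs_before x y ys" using Cons.prems(1)[of x y] \<open>x \<noteq> y\<close> \<open>y \<in> set xs\<close> by simp
      then show False using \<open>x \<noteq> y\<close> Cons.prems(3) ys
        by (auto simp: occurs_before_Cons dest: occurs_before_in_set)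
    qed
    have "set xs = set ys'" using Cons.prems ys xy insert_ident[of x "set xs" "set ys'"] by simp
    moreover have "occurs_before p q xs = occurs_before p q ys'"
      if "p \<in> set xs" "q \<in> set xs" "p \<noteq> q" for p q
      using Cons.prems(1)[of p q] that Cons.prems(2) ys xy by (auto simp: occurs_before_Cons)
    ultimately have "xs = ys'" using Cons.IH[of ys'] Cons.prems ys by auto
    then show ?case using xy ys by simp
  qed simp
qed

section \<open>Insertion of a word at a letter of another word\<close>

definition block :: "nat \<Rightarrow> nat list \<Rightarrow> nat \<Rightarrow> nat list" where
  "block i v x =
     (if x < i then [x] else if x = i then map (\<lambda>l. l + i - 1) v else [x + length v - 1])"

text \<open>The map induced on inputs by composition at \<open>i\<close>: it contracts the
  \<open>s\<close> inputs of the inserted operation to the input that they replace. Its fibres are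
  the blocks of a composite word.\<close>

definition collapse :: "nat \<Rightarrow> nat \<Rightarrow> nat \<Rightarrow> nat" where
  "collapse i s l = (if l < i then l else if l < i + s then i else l + 1 - s)"

lemma word_comp_Nil [simp]: "word_comp i [] v = []"
  by (simp add: word_comp_def)

lemma word_comp_Cons: "word_comp i (x # u) v = block i v x @ word_comp i u v"
  by (simp add: word_comp_def block_def)

lemma set_block:
  assumes "set v = {1..length v}" "1 \<le> length v" "1 \<le> i" "1 \<le> x"
  shows "set (block i v x) = {l. 1 \<le> l \<and> collapse i (length v) l = x}"
proof -
  have "l \<in> (\<lambda>l. l + i - 1) ` {1..length v} \<longleftrightarrow> i \<le> l \<and> l < i + length v" for l
  proof
    assume "i \<le> l \<and> l < i + length v"
    then show "l \<in> (\<lambda>l. l + i - 1) ` {1..length v}" using assms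
      by (intro image_eqI[of _ _ "l + 1 - i"]) auto
  qed (use assms in auto)
  then show ?thesis using assms by (auto simp: block_def collapse_def split: if_splits)
qed

lemma set_word_comp:
  assumes "set v = {1..length v}" "1 \<le> length v" "1 \<le> i" "\<forall>x\<in>set u. 1 \<le> x"
  shows "set (word_comp i u v) = {l. 1 \<le> l \<and> collapse i (length v) l \<in> set u}"
  using assms(4)
proof (induction u)
  case (Cons x u)
  then show ?case using set_block[OF assms(1-3), of x] by (auto simp: word_comp_Cons)
qed simp

lemma distinct_word_comp:
  assumes "set v = {1..length v}" "1 \<le> length v" "1 \<le> i" "\<forall>x\<in>set u. 1 \<le> x"
    and "distinct u" "distinct v"
  shows "distinct (word_comp i u v)"
  using assms(4,5)
proof (induction u)
  case (Cons x u)
  have "distinct (block i v x)"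
    using assms(1-3,6) by (auto simp: block_def distinct_map inj_on_def)
  then show ?case using Cons set_block[OF assms(1-3), of x] set_word_comp[OF assms(1-3), of u]
    by (auto simp: word_comp_Cons)
qed simp

lemma permutations_of_set_length: "v \<in> permutations_of_set {1..s} \<Longrightarrow> length v = s"
  using length_finite_permutations_of_set by fastforce

lemma word_comp_in_permutations:
  assumes "u \<in> permutations_of_set {1..r}" "v \<in> permutations_of_set {1..s}"
    and "1 \<le> s" "1 \<le> i" "i \<le> r"
  shows "word_comp i u v \<in> permutations_of_set {1..r + s - 1}"
proof
  have v: "set v = {1..length v}" "distinct v" "length v = s"
    using permutations_of_setD[OF assms(2)] permutations_of_set_length[OF assms(2)] by auto
  have u: "set u = {1..r}" "distinct u" using permutations_of_setD[OF assms(1)] by auto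
  have u1: "\<forall>x\<in>set u. 1 \<le> x" by (simp add: u)
  show "set (word_comp i u v) = {1..r + s - 1}"
  proof -
    have "set (word_comp i u v) = {l. 1 \<le> l \<and> collapse i s l \<in> {1..r}}"
      using set_word_comp[OF v(1) _ assms(4) u1] assms(3) by (simp only: v(3) u(1))
    also have "\<dots> = {1..r + s - 1}"
      using assms(3-5) by (auto simp: collapse_def split: if_splits)
    finally show ?thesis .
  qed
  show "distinct (word_comp i u v)"
    using distinct_word_comp[OF v(1) _ assms(4) u1 u(2) v(2)] v(3) assms(3) by simp
qed

text \<open>The blocks of different letters are disjoint fibres of \<open>collapse\<close> and
  nonempty, so the first block reveals the first letter; equal lengths of \<open>v\<close> and
  \<open>v'\<close> then allow it to be split off. The word \<open>v\<close> is visible only if the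
  letter \<open>i\<close> occurs. This keeps composites of nondegenerate simplices
  nondegenerate.\<close>

lemma word_comp_inject:
  assumes "set v = {1..length v}" "set v' = {1..length v'}" "length v' = length v" "1 \<le> length v"
    and "1 \<le> i" "\<forall>x\<in>set u. 1 \<le> x" "\<forall>x\<in>set u'. 1 \<le> x"
    and "word_comp i u v = word_comp i u' v'" "length u = length u'"
  shows "u = u' \<and> (i \<in> set u \<longrightarrow> v = v')"
  using assms(6-)
proof (induction u arbitrary: u')
  case (Cons x u)
  then obtain y w where u': "u' = y # w" by (cases u') auto
  have bx: "set (block i v x) = {l. 1 \<le> l \<and> collapse i (length v) l = x}"
    using set_block[of v i x] assms Cons.prems by auto
  have by': "set (block i v' y) = {l. 1 \<le> l \<and> collapse i (length v) l = y}"
    using set_block[of v' i y] assms Cons.prems u' by auto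
  have ne: "block i v x \<noteq> []" "block i v' y \<noteq> []" using assms by (auto simp: block_def)
  have eq: "block i v x @ word_comp i u v = block i v' y @ word_comp i w v'"
    using Cons.prems u' by (simp add: word_comp_Cons)
  then have "hd (block i v x) = hd (block i v' y)" using ne by (metis hd_append2)
  moreover have "hd (block i v x) \<in> set (block i v x)" "hd (block i v' y) \<in> set (block i v' y)"
    using ne by simp_all
  ultimately have xy: "x = y" using bx by' by auto
  have "length (block i v x) = length (block i v' y)" using xy assms(3) by (simp add: block_def)
  then have *: "block i v x = block i v' y" "word_comp i u v = word_comp i w v'"
    using eq by auto
  have IH: "u = w \<and> (i \<in> set u \<longrightarrow> v = v')"
    using Cons.IH[of w] Cons.prems u' * by auto
  moreover have "v = v'" if "x = i"
  proof (rule map_inj_on)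
    show "map (\<lambda>l. l + i - 1) v = map (\<lambda>l. l + i - 1) v'" using * that xy by (simp add: block_def)
    show "inj_on (\<lambda>l. l + i - 1) (set v \<union> set v')" using assms(5) by (auto simp: inj_on_def)
  qed
  ultimately show ?case using xy u' by auto
qed simp

text \<open>Blocks are contiguous, so the order of two inputs in different fibres is decided by the
  outer word, and that of two inputs in the same fibre by the inner word. Each pair of inputs of a
  composite thus depends on one factor only, which is why the bound \<open>n - 1\<close> on changes
  survives composition.\<close>

lemma occurs_before_word_comp_outside:
  assumes "set v = {1..length v}" "1 \<le> length v" "1 \<le> i" "\<forall>x\<in>set u. 1 \<le> x"
    and "1 \<le> p" "1 \<le> q" "collapse i (length v) p \<noteq> collapse i (length v) q"
  shows "occurs_before p q (word_comp i u v) \<longleftrightarrow>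
           occurs_before (collapse i (length v) p) (collapse i (length v) q) u"
  using assms(4)
proof (induction u)
  case (Cons x u)
  have b: "set (block i v x) = {l. 1 \<le> l \<and> collapse i (length v) l = x}"
    using set_block[OF assms(1-3)] Cons.prems by simp
  then have "\<not> occurs_before p q (block i v x)"
    using assms(7) by (auto dest: occurs_before_in_set)
  moreover have "q \<in> set (word_comp i u v) \<longleftrightarrow> collapse i (length v) q \<in> set u"
    using set_word_comp[OF assms(1-3), of u] Cons.prems assms(6) by auto
  ultimately show ?case
    using Cons b assms(5) by (auto simp: word_comp_Cons occurs_before_append occurs_before_Cons)
qed simp

lemma occurs_before_word_comp_inside:
  assumes "set v = {1..length v}" "1 \<le> i" "\<forall>x\<in>set u. 1 \<le> x" "distinct u" "i \<in> set u"
    and "1 \<le> p" "p \<le> length v" "1 \<le> q" "q \<le> length v" "p \<noteq> q"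
  shows "occurs_before (p + i - 1) (q + i - 1) (word_comp i u v) \<longleftrightarrow> occurs_before p q v"
  using assms(3-5)
proof (induction u)
  case (Cons x u)
  have b: "set (block i v x) = {l. 1 \<le> l \<and> collapse i (length v) l = x}"
    using set_block[OF assms(1) _ assms(2)] assms(6,7) Cons.prems by simp
  have s: "set (word_comp i u v) = {l. 1 \<le> l \<and> collapse i (length v) l \<in> set u}"
    using set_word_comp[OF assms(1) _ assms(2)] assms(6,7) Cons.prems by simp
  have c: "collapse i (length v) (p + i - 1) = i" "collapse i (length v) (q + i - 1) = i"
    using assms by (auto simp: collapse_def)
  show ?case
  proof (cases "x = i")
    case True
    then have "i \<notin> set u" using Cons.prems by simp
    then have n: "p + i - 1 \<notin> set (word_comp i u v)" "q + i - 1 \<notin> set (word_comp i u v)"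
      using s c by auto
    then have "\<not> occurs_before (p + i - 1) (q + i - 1) (word_comp i u v)"
      by (auto dest: occurs_before_in_set)
    moreover have "occurs_before (p + i - 1) (q + i - 1) (map (\<lambda>l. l + i - 1) v) \<longleftrightarrow> occurs_before p q v"
      by (rule occurs_before_map) (use assms in \<open>auto simp: inj_on_def\<close>)
    ultimately show ?thesis using True n by (simp add: word_comp_Cons occurs_before_append block_def)
  next
    case False
    then have n: "p + i - 1 \<notin> set (block i v x)" "q + i - 1 \<notin> set (block i v x)"
      using b c by auto
    then have "\<not> occurs_before (p + i - 1) (q + i - 1) (block i v x)"
      by (auto dest: occurs_before_in_set)
    then show ?thesis using False n Cons by (simp add: word_comp_Cons occurs_before_append)
  qed
qed simp

section \<open>The simplices of the Barratt-Eccles operad\<close>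

definition changes :: "nat \<Rightarrow> nat \<Rightarrow> simplex \<Rightarrow> nat set" where
  "changes p q b =
     {k. Suc k < length b \<and> occurs_before p q (b ! k) \<noteq> occurs_before p q (b ! Suc k)}"

lemma finite_changes [simp]: "finite (changes p q b)"
  by (rule finite_subset[of _ "{..<length b}"]) (auto simp: changes_def)

lemma be_simplices_alt:
  "be_simplices n r = {b. b \<noteq> [] \<and> set b \<subseteq> permutations_of_set {1..r} \<and> distinct_adj b \<and>
     (\<forall>p q. 1 \<le> p \<and> p < q \<and> q \<le> r \<longrightarrow> card (changes p q b) \<le> n - 1)}"
  by (simp add: be_simplices_def changes_def)

lemma be_simplices_mono:
  assumes "m \<le> n" shows "be_simplices m r \<subseteq> be_simplices n r"
proof -
  have "card (changes p q b) \<le> m - 1 \<longrightarrow> card (changes p q b) \<le> n - 1" for p q b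
    using assms by linarith
  then show ?thesis unfolding be_simplices_alt by blast
qed

text \<open>Consecutive vertices are distinct, so every step changes the order of at least one pair,
  and each pair allows at most \<open>n - 1\<close> changes; \<open>r * r\<close> is a crude bound
  for the number of pairs. This bound makes the basis finite in each arity.\<close>

lemma length_be_simplices:
  assumes "b \<in> be_simplices n r"
  shows "length b \<le> r * r * (n - 1) + 1"
proof -
  have b: "set b \<subseteq> permutations_of_set {1..r}" "distinct_adj b"
    "\<And>p q. 1 \<le> p \<Longrightarrow> p < q \<Longrightarrow> q \<le> r \<Longrightarrow> card (changes p q b) \<le> n - 1"
    using assms by (auto simp: be_simplices_alt)
  define I where "I = {(p, q). 1 \<le> p \<and> p < q \<and> q \<le> r}"
  have I: "I \<subseteq> {1..r} \<times> {1..r}" by (auto simp: I_def)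
  then have finI: "finite I" by (rule finite_subset) simp
  have "{k. Suc k < length b} \<subseteq> (\<Union>(p, q)\<in>I. changes p q b)"
  proof
    fix k assume "k \<in> {k. Suc k < length b}"
    then have k: "Suc k < length b" by simp
    then have ne: "b ! k \<noteq> b ! Suc k"
      using b(2) by (simp add: distinct_adj_conv_nth)
    have "b ! k \<in> permutations_of_set {1..r}" "b ! Suc k \<in> permutations_of_set {1..r}"
      using b(1) k by (auto simp: subset_iff)
    then have "set (b ! k) = {1..r}" "set (b ! Suc k) = {1..r}" "distinct (b ! k)" "distinct (b ! Suc k)"
      by (auto simp: permutations_of_set_def)
    then obtain p q where "p \<in> {1..r}" "q \<in> {1..r}" "p < q"
      "occurs_before p q (b ! k) \<noteq> occurs_before p q (b ! Suc k)"
      using word_eqI_occurs_before[of "b ! k" "b ! Suc k"] ne by auto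
    then show "k \<in> (\<Union>(p, q)\<in>I. changes p q b)" using k by (auto simp: changes_def I_def)
  qed
  then have "card {k. Suc k < length b} \<le> card (\<Union>(p, q)\<in>I. changes p q b)"
    by (intro card_mono) (use finI in auto)
  also have "\<dots> \<le> (\<Sum>(p, q)\<in>I. card (changes p q b))"
    using card_UN_le[OF finI, of "\<lambda>(p, q). changes p q b"] by (simp add: case_prod_unfold)
  also have "\<dots> \<le> (\<Sum>(p, q)\<in>I. n - 1)" by (rule sum_mono) (use b(3) in \<open>auto simp: I_def\<close>)
  also have "\<dots> = card I * (n - 1)" by (simp add: case_prod_unfold)
  also have "\<dots> \<le> r * r * (n - 1)"
    using card_mono[OF _ I] by (intro mult_right_mono) simp_all
  finally have "card {k. Suc k < length b} \<le> r * r * (n - 1)" .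
  moreover have "{k. Suc k < length b} = {..<length b - 1}" by auto
  ultimately show ?thesis by simp
qed

lemma finite_be_simplices: "finite (be_simplices n r)"
proof (rule finite_subset)
  show "be_simplices n r \<subseteq>
      {b. set b \<subseteq> permutations_of_set {1..r} \<and> length b \<le> r * r * (n - 1) + 1}"
    using length_be_simplices by (auto simp: be_simplices_alt)
  show "finite {b. set b \<subseteq> permutations_of_set {1..r} \<and> length b \<le> r * r * (n - 1) + 1}"
    by (rule finite_lists_length_le) simp
qed

lemma be_simplices_word:
  "b \<in> be_simplices n r \<Longrightarrow> k < length b \<Longrightarrow> b ! k \<in> permutations_of_set {1..r}"
  by (auto simp: be_simplices_alt)

lemma length_hd_be_simplices: "b \<in> be_simplices n r \<Longrightarrow> length (hd b) = r"
  by (rule permutations_of_set_length) (auto simp: be_simplices_alt)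

lemma permutes_map_map:
  assumes "w permutes {1..r}" "b \<in> be_simplices n r"
  shows "map (map w) b \<in> be_simplices n r"
proof -
  have inj: "inj w" using assms(1) by (rule permutes_inj)
  have b: "b \<noteq> []" "set b \<subseteq> permutations_of_set {1..r}" "distinct_adj b"
    "\<And>p q. 1 \<le> p \<Longrightarrow> p < q \<Longrightarrow> q \<le> r \<Longrightarrow> card (changes p q b) \<le> n - 1"
    using assms by (auto simp: be_simplices_alt)
  have perm: "map w x \<in> permutations_of_set {1..r}" if "x \<in> permutations_of_set {1..r}" for x
    using that permutations_of_set_image_permutes[OF assms(1)] by auto
  have ob: "occurs_before p q (map w x) = occurs_before (inv w p) (inv w q) x" for p q x
    using occurs_before_map[OF inj_on_subset[OF inj subset_UNIV], where xs = x and p = "inv w p"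
        and q = "inv w q"]
    by (simp only: permutes_inverses(1)[OF assms(1)])
  \<comment> \<open>A permutation can reverse the natural order of a pair, whereas the definition
    bounds the changes only of pairs written increasingly.\<close>
  have swap: "changes p q b = changes q p b" if "p \<in> {1..r}" "q \<in> {1..r}" "p \<noteq> q" for p q
  proof -
    have "occurs_before q p (b ! k) \<longleftrightarrow> \<not> occurs_before p q (b ! k)" if "k < length b" for k
      using be_simplices_word[OF assms(2) that] \<open>p \<in> _\<close> \<open>q \<in> _\<close> \<open>p \<noteq> q\<close>
      by (intro occurs_before_swap) (auto simp: permutations_of_set_def)
    then show ?thesis unfolding changes_def by auto
  qed
  have "card (changes p q (map (map w) b)) \<le> n - 1" if "1 \<le> p" "p < q" "q \<le> r" for p q
  proof -
    have eq: "changes p q (map (map w) b) = changes (inv w p) (inv w q) b"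
      by (auto simp: changes_def ob)
    have "inv w permutes {1..r}" using assms(1) by (rule permutes_inv)
    then have i: "inv w p \<in> {1..r}" "inv w q \<in> {1..r}" "inv w p \<noteq> inv w q"
      using that permutes_in_image[of "inv w" "{1..r}"] permutes_inj[of "inv w"] by (auto dest: injD)
    show ?thesis
    proof (cases "inv w p < inv w q")
      case True
      then show ?thesis using b(4)[of "inv w p" "inv w q"] i eq by simp
    next
      case False
      then show ?thesis using b(4)[of "inv w q" "inv w p"] i eq swap[OF i] by simp
    qed
  qed
  moreover have "distinct_adj (map (map w) b)"
    using b(3) inj by (intro distinct_adj_mapI) (auto simp: inj_on_def dest: map_injective)
  ultimately show ?thesis using b perm by (auto simp: be_simplices_alt)
qed

section \<open>Eilenberg-Zilber paths and the stability of the filtration under composition\<close>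

lemma count_list_take_le: "count_list (take k xs) x \<le> count_list xs x"
  by (metis append_take_drop_id count_list_append le_add1)

lemma count_list_shuffles:
  assumes "\<sigma> \<in> shuffles (replicate A True) (replicate B False)"
  shows "count_list \<sigma> True = A" "count_list \<sigma> False = B" "length \<sigma> = A + B"
proof -
  have m: "mset \<sigma> = mset (replicate A True) + mset (replicate B False)"
    by (rule mset_shuffles[OF assms])
  then show "count_list \<sigma> True = A" "count_list \<sigma> False = B"
    by (metis count_mset count_union count_replicate_mset mset_replicate add.right_neutral
        add.left_neutral)+
  show "length \<sigma> = A + B" using m by (metis mset_replicate size_mset size_replicate_mset size_union)
qed

lemma length_ez_path [simp]: "length (ez_path i a b \<sigma>) = length \<sigma> + 1"
  by (simp add: ez_path_def)

lemma nth_ez_path: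
  "k \<le> length \<sigma> \<Longrightarrow> ez_path i a b \<sigma> ! k = word_comp i (a ! count_list (take k \<sigma>) True)
                                                    (b ! count_list (take k \<sigma>) False)"
  by (simp add: ez_path_def nth_map_upt del: upt_Suc)

text \<open>Here \<open>x\<close> is the position reached in \<open>a\<close> at each vertex of
  \<open>b\<close>. A change in \<open>b\<close> forces \<open>x\<close> to advance, and a monotone
  path that advances at \<open>k\<close> never returns to the value \<open>x k\<close>; so
  \<open>x\<close> injects the changes of \<open>b\<close> into those of \<open>a\<close>.\<close>

lemma card_changes_le:
  assumes step: "\<And>k. Suc k < length b \<Longrightarrow> x (Suc k) = x k \<or> x (Suc k) = Suc (x k)"
    and bound: "\<And>k. k < length b \<Longrightarrow> x k < length a"
    and order: "\<And>k. k < length b \<Longrightarrow> occurs_before p q (b ! k) = occurs_before p' q' (a ! x k)"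
  shows "card (changes p q b) \<le> card (changes p' q' a)"
proof (rule card_inj_on_le)
  have inc: "x (Suc k) = Suc (x k)" if "k \<in> changes p q b" for k
    using that step[of k] order[of k] order[of "Suc k"] by (auto simp: changes_def)
  show "x ` changes p q b \<subseteq> changes p' q' a"
  proof
    fix z assume "z \<in> x ` changes p q b"
    then obtain k where k: "k \<in> changes p q b" "z = x k" by blast
    then show "z \<in> changes p' q' a"
      using inc[OF k(1)] bound[of "Suc k"] order[of k] order[of "Suc k"] by (auto simp: changes_def)
  qed
  have mono: "x k \<le> x l" if "k \<le> l" "l < length b" for k l
    using that
  proof (induction rule: dec_induct)
    case (step l)
    then show ?case using assms(1)[of l] by auto
  qed simp
  have less: "x k < x l" if "k < l" "k \<in> changes p q b" "l \<in> changes p q b" for k l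
    using mono[of "Suc k" l] inc[of k] that by (auto simp: changes_def)
  show "inj_on x (changes p q b)"
  proof (rule inj_onI)
    fix k l assume "k \<in> changes p q b" "l \<in> changes p q b" "x k = x l"
    then show "k = l" using less[of k l] less[of l k] by (cases k l rule: linorder_cases) auto
  qed
qed simp

text \<open>Each step of a shuffle moves exactly one factor to a different vertex, so
  \<open>word_comp_inject\<close> gives nondegeneracy. For the filtration, a pair separated by
  \<open>collapse\<close> follows the path in \<open>a\<close>, and a pair inside the inserted block
  follows the path in \<open>b\<close>.\<close>

lemma ez_path_in_be_simplices:
  assumes "a \<in> be_simplices n r" "b \<in> be_simplices n s" "1 \<le> s" "1 \<le> i" "i \<le> r"
    and "\<sigma> \<in> shuffles (replicate (length a - 1) True) (replicate (length b - 1) False)"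
  shows "ez_path i a b \<sigma> \<in> be_simplices n (r + s - 1)"
proof -
  define x y where "x k = count_list (take k \<sigma>) True" and "y k = count_list (take k \<sigma>) False" for k
  have ne: "a \<noteq> []" "b \<noteq> []" using assms by (auto simp: be_simplices_alt)
  have xl: "x k < length a" and yl: "y k < length b" for k
  proof -
    have "x k \<le> length a - 1" "y k \<le> length b - 1" unfolding x_def y_def
      using count_list_take_le[of k \<sigma> True] count_list_take_le[of k \<sigma> False]
        count_list_shuffles[OF assms(6)] by simp_all
    moreover have "0 < length a" "0 < length b" using ne by simp_all
    ultimately show "x k < length a" "y k < length b" by linarith+
  qed
  have xs: "x (Suc k) = (if \<sigma> ! k then Suc (x k) else x k)"
    and ys: "y (Suc k) = (if \<sigma> ! k then y k else Suc (y k))" if "k < length \<sigma>" for k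
    using that by (auto simp: x_def y_def take_Suc_conv_app_nth)
  have nth: "ez_path i a b \<sigma> ! k = word_comp i (a ! x k) (b ! y k)" if "k \<le> length \<sigma>" for k
    using nth_ez_path[OF that] by (simp add: x_def y_def)
  have au: "a ! x k \<in> permutations_of_set {1..r}" "b ! y k \<in> permutations_of_set {1..s}" for k
    using be_simplices_word assms xl yl by blast+
  have sb: "set (b ! y k) = {1..length (b ! y k)}" "length (b ! y k) = s" "distinct (b ! y k)" for k
    using permutations_of_setD[OF au(2)] permutations_of_set_length[OF au(2)] by auto
  have sa: "\<forall>l\<in>set (a ! x k). 1 \<le> l" "i \<in> set (a ! x k)" "length (a ! x k) = r" "distinct (a ! x k)"
      for k
    using permutations_of_setD[OF au(1)] permutations_of_set_length[OF au(1)] assms by auto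
  have "set (ez_path i a b \<sigma>) \<subseteq> permutations_of_set {1..r + s - 1}"
  proof
    fix z assume "z \<in> set (ez_path i a b \<sigma>)"
    then obtain k where "k < length \<sigma> + 1" "z = ez_path i a b \<sigma> ! k"
      unfolding in_set_conv_nth length_ez_path by metis
    then show "z \<in> permutations_of_set {1..r + s - 1}"
      using word_comp_in_permutations[OF au assms(3-5)] nth[of k] by simp
  qed
  moreover have "distinct_adj (ez_path i a b \<sigma>)"
    unfolding distinct_adj_conv_nth
  proof (intro allI impI)
    fix k assume "Suc k < length (ez_path i a b \<sigma>)"
    then have k: "k < length \<sigma>" by simp
    show "ez_path i a b \<sigma> ! k \<noteq> ez_path i a b \<sigma> ! Suc k"
    proof
      assume "ez_path i a b \<sigma> ! k = ez_path i a b \<sigma> ! Suc k"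
      then have "word_comp i (a ! x k) (b ! y k) = word_comp i (a ! x (Suc k)) (b ! y (Suc k))"
        using k nth by simp
      then have eq: "a ! x k = a ! x (Suc k)" "b ! y k = b ! y (Suc k)"
        using word_comp_inject[of "b ! y k" "b ! y (Suc k)" i "a ! x k" "a ! x (Suc k)"]
          sa[of k] sa[of "Suc k"] sb[of k] sb[of "Suc k"] assms by auto
      have da: "distinct_adj a" "distinct_adj b" using assms by (auto simp: be_simplices_alt)
      show False
      proof (cases "\<sigma> ! k")
        case True
        then show False using eq(1) xs[OF k] xl[of "Suc k"] da(1)
          by (auto simp: distinct_adj_conv_nth)
      next
        case False
        then show False using eq(2) ys[OF k] yl[of "Suc k"] da(2)
          by (auto simp: distinct_adj_conv_nth)
      qed
    qed
  qed
  moreover have "card (changes p q (ez_path i a b \<sigma>)) \<le> n - 1"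
      if pq: "1 \<le> p" "p < q" "q \<le> r + s - 1" for p q
  proof (cases "collapse i s p = collapse i s q")
    case False
    define p' q' where "p' = collapse i s p" and "q' = collapse i s q"
    have pq': "1 \<le> p'" "p' < q'" "q' \<le> r" using pq False assms
      by (auto simp: p'_def q'_def collapse_def split: if_splits)
    have ob: "occurs_before p q (ez_path i a b \<sigma> ! k) = occurs_before p' q' (a ! x k)"
        if "k \<le> length \<sigma>" for k
      using occurs_before_word_comp_outside[OF sb(1) _ assms(4) sa(1), of k p q k] False pq sb(2)[of
          k] assms(3) nth[OF that]
      by (simp add: p'_def q'_def)
    have "card (changes p q (ez_path i a b \<sigma>)) \<le> card (changes p' q' a)"
    proof (rule card_changes_le[where x = x])
      show "x (Suc k) = x k \<or> x (Suc k) = Suc (x k)" if "Suc k < length (ez_path i a b \<sigma>)" for k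
        using xs[of k] that by simp
    qed (use xl ob in auto)
    also have "\<dots> \<le> n - 1" using assms(1) pq' by (auto simp: be_simplices_alt)
    finally show ?thesis .
  next
    case True
    define p' q' where "p' = p + 1 - i" and "q' = q + 1 - i"
    have pq': "1 \<le> p'" "p' < q'" "q' \<le> s" "p = p' + i - 1" "q = q' + i - 1" using pq True assms
      by (auto simp: p'_def q'_def collapse_def split: if_splits)
    have ob: "occurs_before p q (ez_path i a b \<sigma> ! k) = occurs_before p' q' (b ! y k)"
        if "k \<le> length \<sigma>" for k
      using occurs_before_word_comp_inside[OF sb(1) assms(4) sa(1) sa(4) sa(2), of p' k q' k] pq'
          sb(2)[of k] assms(3) nth[OF that]
      by simp
    have "card (changes p q (ez_path i a b \<sigma>)) \<le> card (changes p' q' b)"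
    proof (rule card_changes_le[where x = y])
      show "y (Suc k) = y k \<or> y (Suc k) = Suc (y k)" if "Suc k < length (ez_path i a b \<sigma>)" for k
        using ys[of k] that by simp
    qed (use yl ob in auto)
    also have "\<dots> \<le> n - 1" using assms(2) pq' by (auto simp: be_simplices_alt)
    finally show ?thesis .
  qed
  moreover have "ez_path i a b \<sigma> \<noteq> []" by (simp add: ez_path_def)
  ultimately show ?thesis by (auto simp: be_simplices_alt)
qed

section \<open>Block permutations\<close>

text \<open>A cycle of length \<open>b - a + 1\<close>: the factor gained by \<open>spread\<close>
  when the inserted block becomes one letter longer.\<close>

definition cyc :: "nat \<Rightarrow> nat \<Rightarrow> nat \<Rightarrow> nat" where
  "cyc a b l = (if a \<le> l \<and> l < b then Suc l else if l = b then a else l)"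

lemma cyc_permutes_sign:
  assumes "a \<le> b"
  shows "cyc a b permutes {a..b} \<and> sign (cyc a b) = (- 1) ^ (b - a)"
  using assms
proof (induction rule: dec_induct)
  case base
  have "cyc a a = id" by (auto simp: cyc_def fun_eq_iff)
  then show ?case by (simp only: permutes_id sign_id diff_self_eq_0 power_0)
next
  case (step b)
  have eq: "cyc a (Suc b) = cyc a b \<circ> transpose b (Suc b)"
    using step(1) by (auto simp: cyc_def fun_eq_iff transpose_def)
  have p: "cyc a b permutes {a..Suc b}" using step(3) by (rule permutes_subset[OF conjunct1]) auto
  have q: "transpose b (Suc b) permutes {a..Suc b}" using step(1) by (intro permutes_swap_id) auto
  have "sign (cyc a (Suc b)) = sign (cyc a b) * sign (transpose b (Suc b))"
    unfolding eq using p q by (intro sign_compose) (auto intro: permutation_permutes[THEN iffD2])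
  then have "sign (cyc a (Suc b)) = (- 1) ^ (Suc b - a)"
    using step by (simp add: sign_swap_id Suc_diff_le)
  then show ?case using permutes_compose[OF q p] eq by metis
qed

text \<open>\<open>spread r s i\<close> inserts the letters \<open>r + 1, \<dots>, r + s - 1\<close> right after the letter \<open>i\<close>.\<close>

definition spread :: "nat \<Rightarrow> nat \<Rightarrow> nat \<Rightarrow> nat \<Rightarrow> nat" where
  "spread r s i l =
     (if l \<le> i then l else if l \<le> r then l + s - 1 else if l < r + s then l + i - r else l)"

text \<open>Each further letter of the block has to pass the \<open>r - i\<close> letters that
  follow \<open>i\<close>, and there are \<open>s - 1\<close> letters to be inserted.\<close>

lemma spread_permutes_sign:
  assumes "1 \<le> s" "1 \<le> i" "i \<le> r"
  shows "spread r s i permutes {1..r + s - 1} \<and> sign (spread r s i) = (- 1) ^ ((s - 1) * (r - i))"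
  using assms(1)
proof (induction rule: dec_induct)
  case base
  have "spread r 1 i = id" using assms by (auto simp: spread_def fun_eq_iff)
  then show ?case by (simp only: permutes_id sign_id diff_self_eq_0 power_0 mult_0)
next
  case (step s)
  have eq: "spread r (Suc s) i = cyc (i + s) (r + s) \<circ> spread r s i"
    using step(1) assms by (auto simp: cyc_def spread_def fun_eq_iff)
  have c: "cyc (i + s) (r + s) permutes {i + s..r + s}" "sign (cyc (i + s) (r + s)) = (- 1) ^ (r - i)"
    using cyc_permutes_sign[of "i + s" "r + s"] assms by auto
  have p: "spread r s i permutes {1..r + s}" using step(3) by (rule permutes_subset[OF conjunct1]) auto
  have q: "cyc (i + s) (r + s) permutes {1..r + s}" using c(1) by (rule permutes_subset)
      (use assms in auto)
  have "sign (spread r (Suc s) i) = sign (cyc (i + s) (r + s)) * sign (spread r s i)"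
    unfolding eq using p q by (intro sign_compose) (auto intro: permutation_permutes[THEN iffD2])
  also have "\<dots> = (- 1) ^ (r - i + (s - 1) * (r - i))"
    using step(3) c(2) by (simp add: power_add)
  also have "r - i + (s - 1) * (r - i) = (Suc s - 1) * (r - i)"
    using step(1) by (cases s) auto
  finally show ?case using permutes_compose[OF p q] eq by (metis add_Suc_right diff_Suc_1 One_nat_def)
qed

lemmas spread_permutes = spread_permutes_sign[THEN conjunct1]
lemmas sign_spread = spread_permutes_sign[THEN conjunct2]

text \<open>The permutation of the inputs of \<open>a \<circ>\<^sub>i b\<close> induced by permutations \<open>u\<close> and \<open>v\<close> of the inputs of
  \<open>a\<close> and \<open>b\<close>.\<close>

definition block_perm :: "nat \<Rightarrow> nat \<Rightarrow> nat \<Rightarrow> (nat \<Rightarrow> nat) \<Rightarrow> (nat \<Rightarrow> nat) \<Rightarrow> nat \<Rightarrow> nat" where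
  "block_perm r s i u v =
     spread r s (u i) \<circ> u \<circ> inv (spread r s i) \<circ> map_permutation {1..s} (\<lambda>l. l + i - 1) v"

context
  fixes r s i :: nat and u v :: "nat \<Rightarrow> nat"
  assumes s: "1 \<le> s" and i: "1 \<le> i" "i \<le> r"
    and u: "u permutes {1..r}" and v: "v permutes {1..s}"
begin

lemma block_perm_left_range: "1 \<le> l \<Longrightarrow> l \<le> r \<Longrightarrow> 1 \<le> u l \<and> u l \<le> r"
  using permutes_in_image[OF u, of l] by simp

lemma block_perm_right_range: "1 \<le> l \<Longrightarrow> l \<le> s \<Longrightarrow> 1 \<le> v l \<and> v l \<le> s"
  using permutes_in_image[OF v, of l] by simp

lemma block_perm_factors:
  "spread r s (u i) permutes {1..r + s - 1}" "u permutes {1..r + s - 1}"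
  "inv (spread r s i) permutes {1..r + s - 1}"
  "map_permutation {1..s} (\<lambda>l. l + i - 1) v permutes {1..r + s - 1}"
proof -
  show "spread r s (u i) permutes {1..r + s - 1}"
    using block_perm_left_range[of i] i by (intro spread_permutes[OF s]) auto
  show "inv (spread r s i) permutes {1..r + s - 1}"
    by (intro permutes_inv spread_permutes s i)
  show "u permutes {1..r + s - 1}" using u by (rule permutes_subset) (use s in auto)
  have "bij_betw (\<lambda>l. l + i - 1) {1..s} ((\<lambda>l. l + i - 1) ` {1..s})"
    using i by (auto simp: bij_betw_def inj_on_def)
  then have "map_permutation {1..s} (\<lambda>l. l + i - 1) v permutes ((\<lambda>l. l + i - 1) ` {1..s})"
    by (rule map_permutation_permutes) (rule v)
  then show "map_permutation {1..s} (\<lambda>l. l + i - 1) v permutes {1..r + s - 1}"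
    by (rule permutes_subset) (use i s in auto)
qed

lemma block_perm_permutes: "block_perm r s i u v permutes {1..r + s - 1}"
  unfolding block_perm_def by (intro permutes_compose block_perm_factors)

text \<open>The letters beyond \<open>r\<close> stand for the inputs of the block other than its
  first one and are fixed by \<open>u\<close>, so that every factor of \<open>block_perm\<close> has
  a known sign. The two spreads sit at the places \<open>i\<close> and \<open>u i\<close>, hence
  their signs need not cancel.\<close>

lemma sign_block_perm:
  "sign (block_perm r s i u v)
     = sign u * sign v * (- 1) ^ ((s - 1) * (r - i) + (s - 1) * (r - u i))"
proof -
  have perm: "permutation p" if "p permutes {1..r + s - 1}" for p
    using that by (auto intro: permutation_permutes[THEN iffD2])
  have "sign (map_permutation {1..s} (\<lambda>l. l + i - 1) v) = sign v"
    using v i by (intro sign_map_permutation) (auto simp: inj_on_def)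
  moreover have "sign (inv (spread r s i)) = sign (spread r s i)"
    using s i by (intro sign_inverse perm spread_permutes)
  moreover have "sign (block_perm r s i u v) = sign (spread r s (u i)) * sign u *
      sign (inv (spread r s i)) * sign (map_permutation {1..s} (\<lambda>l. l + i - 1) v)"
    unfolding block_perm_def
    using block_perm_factors[THEN perm] by (simp only: sign_compose permutation_compose)
  ultimately show ?thesis
    using sign_spread[OF s i] sign_spread[OF s, of "u i" r] block_perm_left_range[of i] i
    by (simp add: power_add)
qed

lemma map_permutation_outside:
  assumes "l < i \<or> i + s \<le> l"
  shows "map_permutation {1..s} (\<lambda>l. l + i - 1) v l = l"
  unfolding map_permutation_def restrict_id_def using assms by auto

lemma inv_spread: "inv (spread r s i) (spread r s i l) = l"
  using permutes_inverses(2)[OF spread_permutes[OF s i]] .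

lemma block_perm_outside:
  assumes "1 \<le> l" "l \<le> r" "l \<noteq> i"
  shows "block_perm r s i u v (if l < i then l else l + s - 1)
           = (if u l < u i then u l else u l + s - 1)"
proof -
  have e: "(if l < i then l else l + s - 1) = spread r s i l" using assms by (auto simp: spread_def)
  have "u l \<noteq> u i" using assms(3) permutes_inj[OF u] by (auto dest: injD)
  have m: "map_permutation {1..s} (\<lambda>l. l + i - 1) v (spread r s i l) = spread r s i l"
    using assms by (intro map_permutation_outside) (auto simp: spread_def)
  have "block_perm r s i u v (spread r s i l) = spread r s (u i) (u l)"
    unfolding block_perm_def o_apply m inv_spread ..
  also have "\<dots> = (if u l < u i then u l else u l + s - 1)"
    using block_perm_left_range[of l] assms \<open>u l \<noteq> u i\<close> by (simp add: spread_def)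
  finally show ?thesis unfolding e .
qed

lemma block_perm_inside:
  assumes "1 \<le> l" "l \<le> s"
  shows "block_perm r s i u v (l + i - 1) = v l + u i - 1"
proof -
  have 1: "map_permutation {1..s} (\<lambda>l. l + i - 1) v (l + i - 1) = v l + i - 1"
  proof -
    have "inj_on (\<lambda>l. l + i - 1) {1..s}" using i by (auto simp: inj_on_def)
    from map_permutation_apply[OF this, of l v] show ?thesis using assms by simp
  qed
  \<comment> \<open>The first input of a block is carried by the letter \<open>i\<close> itself, the
    others by letters beyond \<open>r\<close>, where \<open>u\<close> is the identity.\<close>
  show ?thesis
  proof (cases "v l = 1")
    case True
    have "spread r s i i = i" by (simp add: spread_def)
    then have "inv (spread r s i) i = i" using inv_spread[of i] by simp
    then show ?thesis using True 1 i by (simp add: block_perm_def spread_def)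
  next
    case False
    then have vl: "2 \<le> v l" "v l \<le> s" using block_perm_right_range[OF assms] by auto
    have "spread r s i (r + v l - 1) = v l + i - 1" using vl i by (auto simp: spread_def)
    then have "inv (spread r s i) (v l + i - 1) = r + v l - 1" using inv_spread by metis
    moreover have "u (r + v l - 1) = r + v l - 1"
    proof (rule permutes_not_in[OF u])
      have "\<not> r + v l - 1 \<le> r" using vl by linarith
      then show "r + v l - 1 \<notin> {1..r}" by simp
    qed
    moreover have "spread r s (u i) (r + v l - 1) = v l + u i - 1"
      using vl block_perm_left_range[of i] i by (auto simp: spread_def)
    ultimately show ?thesis using 1 by (simp add: block_perm_def)
  qed
qed

lemma word_comp_block_perm:
  assumes "set x \<subseteq> {1..r}" "set y \<subseteq> {1..s}" "length y = s"
  shows "word_comp (u i) (map u x) (map v y) = map (block_perm r s i u v) (word_comp i x y)"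
  using assms(1)
proof (induction x)
  case (Cons l x)
  have "block (u i) (map v y) (u l) = map (block_perm r s i u v) (block i y l)"
  proof (cases "l = i")
    case True
    have "map (\<lambda>l. v l + u i - 1) y = map (\<lambda>l. block_perm r s i u v (l + i - 1)) y"
      using assms(2) block_perm_inside by (intro map_cong) (auto simp: subset_iff)
    then show ?thesis using True by (simp add: block_def o_def)
  next
    case False
    then have "u l \<noteq> u i" using permutes_inj[OF u] by (auto dest: injD)
    then show ?thesis using block_perm_outside[of l] False Cons.prems assms(3)
      by (auto simp: block_def split: if_splits)
  qed
  then show ?case using Cons by (simp add: word_comp_Cons)
qed simp

lemma ez_path_block_perm:
  assumes "a \<in> be_simplices n r" "b \<in> be_simplices n s"
    and "\<sigma> \<in> shuffles (replicate (length a - 1) True) (replicate (length b - 1) False)"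
  shows "ez_path (u i) (map (map u) a) (map (map v) b) \<sigma>
           = map (map (block_perm r s i u v)) (ez_path i a b \<sigma>)"
proof (rule nth_equalityI)
  fix k assume "k < length (ez_path (u i) (map (map u) a) (map (map v) b) \<sigma>)"
  then have k: "k \<le> length \<sigma>" by simp
  define x y where "x = count_list (take k \<sigma>) True" and "y = count_list (take k \<sigma>) False"
  have "x \<le> length a - 1" "y \<le> length b - 1"
    using count_list_take_le[of k \<sigma> True] count_list_take_le[of k \<sigma> False]
      count_list_shuffles[OF assms(3)] by (simp_all add: x_def y_def)
  moreover have "0 < length a" "0 < length b" using assms by (auto simp: be_simplices_alt)
  ultimately have xy: "x < length a" "y < length b" by linarith+
  have "a ! x \<in> permutations_of_set {1..r}" "b ! y \<in> permutations_of_set {1..s}"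
    using be_simplices_word assms(1,2) xy by auto
  then have "set (a ! x) \<subseteq> {1..r}" "set (b ! y) \<subseteq> {1..s}" "length (b ! y) = s"
    using permutations_of_set_length by (auto simp: permutations_of_set_def)
  note word_comp_block_perm[OF this]
  then show "ez_path (u i) (map (map u) a) (map (map v) b) \<sigma> ! k
      = map (map (block_perm r s i u v)) (ez_path i a b \<sigma>) ! k"
    using k xy by (simp add: nth_ez_path x_def y_def)
qed simp

lemma inj_map_map: "inj f \<Longrightarrow> map (map f) b = map (map f) c \<longleftrightarrow> b = c"
  by (metis inj_map_eq_map inj_mapI)

text \<open>Relabelling changes neither the set of shuffles nor their signs, and each path is
  relabelled vertex by vertex, so the two Eilenberg-Zilber sums agree term by term. This is the
  equivariance of partial composition.\<close>

lemma pcm_block_perm: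
  assumes "a \<in> be_simplices n r" "b \<in> be_simplices n s"
  shows "pcm (BE n) (u i) (map (map u) a) (map (map v) b) (map (map (block_perm r s i u v)) c)
           = (pcm (BE n) i a b c :: 'f::field)"
proof -
  have ne: "a \<noteq> []" using assms by (auto simp: be_simplices_alt)
  have l: "length (hd a) = r" using assms length_hd_be_simplices by blast
  have inj: "inj (block_perm r s i u v)" using block_perm_permutes by (rule permutes_inj)
  have eq: "map (map (block_perm r s i u v)) c = ez_path (u i) (map (map u) a) (map (map v) b) \<sigma>
      \<longleftrightarrow> c = ez_path i a b \<sigma>"
    if "\<sigma> \<in> shuffles (replicate (length a - 1) True) (replicate (length b - 1) False)" for \<sigma>
    using ez_path_block_perm[OF assms that] inj_map_map[OF inj] by simp
  have "(\<Sum>\<sigma>\<in>shuffles (replicate (length a - 1) True) (replicate (length b - 1) False).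
      ksgn (ez_exp \<sigma>) * of_bool (map (map (block_perm r s i u v)) c
        = ez_path (u i) (map (map u) a) (map (map v) b) \<sigma>) :: 'f)
    = (\<Sum>\<sigma>\<in>shuffles (replicate (length a - 1) True) (replicate (length b - 1) False).
      ksgn (ez_exp \<sigma>) * of_bool (c = ez_path i a b \<sigma>))"
    by (intro sum.cong refl arg_cong2[where f = times] arg_cong[where f = of_bool] eq)
  then show ?thesis
    using i block_perm_left_range[of i] l ne by (simp add: BE_def hd_map)
qed

end

text \<open>The values on the block determine \<open>v\<close>. The factors surrounding
  \<open>u\<close> are then the same bijections on both sides and can be cancelled.\<close>

lemma block_perm_inject:
  assumes "1 \<le> s" "1 \<le> i" "i \<le> r" "u permutes {1..r}" "v permutes {1..s}"
    and "u' permutes {1..r}" "v' permutes {1..s}"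
    and eq: "block_perm r s i u v = block_perm r s i u' v'" "u i = u' i"
  shows "u = u' \<and> v = v'"
proof -
  have "v l = v' l" for l
  proof (cases "l \<in> {1..s}")
    case True
    then show ?thesis
      using block_perm_inside[OF assms(1-5), of l] block_perm_inside[OF assms(1-3,6,7), of l] eq
        permutes_in_image[OF assms(5), of l] permutes_in_image[OF assms(7), of l] by auto
  next
    case False
    then show ?thesis using assms(5,7) by (simp add: permutes_not_in)
  qed
  then have v: "v = v'" by auto
  define p where "p = spread r s (u i)"
  define q where "q = inv (spread r s i) \<circ> map_permutation {1..s} (\<lambda>l. l + i - 1) v"
  have p: "inj p" unfolding p_def
    using block_perm_factors(1)[OF assms(1-5)] by (rule permutes_inj)
  have q: "surj q" unfolding q_def
    using permutes_compose[OF block_perm_factors(4,3)[OF assms(1-5)]] by (rule permutes_surj)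
  have pq: "p (u (q l)) = p (u' (q l))" for l
    using eq(1) unfolding block_perm_def eq(2)[symmetric] v[symmetric]
    by (simp add: p_def q_def fun_eq_iff)
  have "u l = u' l" for l
  proof -
    obtain l' where "l = q l'" using q by (auto simp: surj_def)
    then show ?thesis using pq[of l'] p by (auto dest: injD)
  qed
  then show ?thesis using v by auto
qed

section \<open>The permutation attached to a set of inputs\<close>

lemma perm_of_permutes:
  assumes "l \<in> permutations_of_set {1..t}"
  shows "perm_of l permutes {1..t}"
proof (rule bij_imp_permutes)
  have len: "length l = t" using permutations_of_set_length[OF assms] .
  have d: "distinct l" "set l = {1..t}" using assms by (auto simp: permutations_of_set_def)
  have "inj_on (perm_of l) {1..t}"
    using d len by (auto simp: inj_on_def perm_of_def nth_eq_iff_index_eq)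
  moreover have "perm_of l ` {1..t} \<subseteq> {1..t}"
    using d(2) len nth_mem[of _ l] by (auto simp: perm_of_def simp del: d(2))
  ultimately show "bij_betw (perm_of l) {1..t} {1..t}"
    by (simp add: bij_betw_def endo_inj_surj)
qed (use permutations_of_set_length[OF assms] in \<open>auto simp: perm_of_def\<close>)

text \<open>All elements of \<open>S\<close> lie between \<open>Min S\<close> and \<open>t\<close>.
  Equivalently, \<open>Min S\<close> is at most \<open>t + 1 - card S\<close>, so it is a legitimate
  input of the lower factor.\<close>

lemma Min_add_card_le:
  assumes "S \<subseteq> {1..t}" "S \<noteq> {}"
  shows "1 \<le> Min S \<and> Min S + card S \<le> t + 1"
proof -
  have fin: "finite S" using assms(1) finite_subset by blast
  then have "Min S \<in> S" using assms(2) by simp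
  then have "1 \<le> Min S" "Min S \<le> t" using assms(1) by auto
  moreover have "S \<subseteq> {Min S..t}" using fin assms(1) by auto
  then have "card S \<le> t + 1 - Min S" using card_mono[of "{Min S..t}" S] by simp
  ultimately show ?thesis by simp
qed

lemma block_word_in_permutations:
  assumes "S \<subseteq> {1..t}" "S \<noteq> {}"
  shows "block_word t S \<in> permutations_of_set {1..t}"
proof
  have fin: "finite S" using assms(1) finite_subset by blast
  have M: "Min S \<in> S" "\<And>l. l \<in> S \<Longrightarrow> Min S \<le> l" using fin assms(2) by auto
  have "1 \<le> Min S" "Min S \<le> t" using M assms(1) by auto
  have "Min S < l" if "l \<notin> S" "\<not> l < Min S" for l using that M(1)
      by (cases l "Min S" rule: linorder_cases) auto
  moreover have "set (block_word t S) = {1..<Min S} \<union> S \<union> {l \<in> {1..<t + 1}. Min S < l \<and> l \<notin> S}"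
    using fin by (auto simp: block_word_def)
  moreover have "l \<le> t" if "l < Min S" for l using that \<open>Min S \<le> t\<close> by simp
  ultimately show "set (block_word t S) = {1..t}"
    using assms(1) by auto
  show "distinct (block_word t S)"
    using fin by (auto simp: block_word_def dest: M(2))
qed

lemma perm_of_block_word:
  assumes "S \<subseteq> {1..t}" "S \<noteq> {}" "1 \<le> l" "l \<le> card S"
  shows "perm_of (block_word t S) (l + Min S - 1) = sorted_list_of_set S ! (l - 1)"
proof -
  have fin: "finite S" using assms(1) finite_subset by blast
  have M: "1 \<le> Min S" "Min S + card S \<le> t + 1" using Min_add_card_le[OF assms(1,2)] by auto
  have len: "length (block_word t S) = t"
    using permutations_of_set_length[OF block_word_in_permutations[OF assms(1,2)]] .
  have "block_word t S ! (Min S - 1 + (l - 1)) = sorted_list_of_set S ! (l - 1)"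
    using assms(3,4) by (auto simp: block_word_def nth_append fin)
  moreover have "Min S - 1 + (l - 1) = l + Min S - 1 - 1" using assms(3) M by simp
  moreover have "1 \<le> l + Min S - 1 \<and> l + Min S - 1 \<le> length (block_word t S)"
    using assms(3,4) M len by linarith
  ultimately show ?thesis by (simp only: perm_of_def if_True simp_thms)
qed

lemma perm_of_block_word_image:
  assumes "S \<subseteq> {1..t}" "S \<noteq> {}"
  shows "perm_of (block_word t S) ` (\<lambda>l. l + Min S - 1) ` {1..card S} = S"
proof -
  have fin: "finite S" using assms(1) finite_subset by blast
  have "perm_of (block_word t S) ` (\<lambda>l. l + Min S - 1) ` {1..card S}
      = (\<lambda>l. sorted_list_of_set S ! (l - 1)) ` {1..card S}"
    unfolding image_image by (rule image_cong) (use perm_of_block_word[OF assms] in auto)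
  also have "\<dots> = (\<lambda>l. sorted_list_of_set S ! (l - 1)) ` (Suc ` {..<card S})"
    by (simp add: image_Suc_lessThan)
  also have "\<dots> = set (sorted_list_of_set S)"
    unfolding image_image using fin by (auto simp: set_conv_nth)
  also have "\<dots> = S" using fin by simp
  finally show ?thesis .
qed

text \<open>A set \<open>S\<close> of inputs together with permutations of the inputs of the two factors is the same as
  a permutation of all the inputs together with a place of composition. Injectivity is checked by
  recovering \<open>S\<close> as the preimage of the block; surjectivity then follows from
  \<open>(t choose s) r! s! = t! r\<close>.\<close>

lemma bij_betw_block_perm:
  assumes "1 \<le> r" "1 \<le> s"
  defines "t \<equiv> r + s - 1"
  shows "bij_betw (\<lambda>(S, u, v). (block_perm r s (Min S) u v \<circ> inv (perm_of (block_word t S)), u (Min S)))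
    ({S. S \<subseteq> {1..t} \<and> card S = s} \<times> {u. u permutes {1..r}} \<times> {v. v permutes {1..s}})
    ({w. w permutes {1..t}} \<times> {1..r})"
    (is "bij_betw ?f ?A ?B")
proof -
  have S: "S \<noteq> {}" "1 \<le> Min S" "Min S \<le> r" "perm_of (block_word t S) permutes {1..t}"
    if "S \<subseteq> {1..t}" "card S = s" for S
  proof -
    show "S \<noteq> {}" using that assms by auto
    then show "1 \<le> Min S" "Min S \<le> r" "perm_of (block_word t S) permutes {1..t}"
      using Min_add_card_le[of S t] that assms
        perm_of_permutes[OF block_word_in_permutations[OF that(1)]] by simp_all
  qed
  have "?f ` ?A \<subseteq> ?B"
  proof (clarsimp, intro conjI)
    fix S u v assume h: "S \<subseteq> {Suc 0..t}" "s = card S" "u permutes {Suc 0..r}" "v permutes {Suc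
        0..card S}"
    then have h': "S \<subseteq> {1..t}" "card S = s" "u permutes {1..r}" "v permutes {1..s}" by auto
    note S = S[OF h'(1,2)]
    have "block_perm r s (Min S) u v permutes {1..t}"
      unfolding t_def using assms(2) S h' by (intro block_perm_permutes) auto
    then show "block_perm r (card S) (Min S) u v \<circ> inv (perm_of (block_word t S)) permutes {Suc 0..t}"
      using permutes_compose[OF permutes_inv[OF S(4)]] h'(2) by simp
    show "Suc 0 \<le> u (Min S)" "u (Min S) \<le> r"
      using permutes_in_image[OF h'(3), of "Min S"] S by auto
  qed
  moreover have "inj_on ?f ?A"
  proof (rule inj_onI)
    fix z z' assume z: "z \<in> ?A" "z' \<in> ?A" "?f z = ?f z'"
    obtain S u v where zz: "z = (S, u, v)" by (cases z)
    obtain S' u' v' where zz': "z' = (S', u', v')" by (cases z')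
    have h: "S \<subseteq> {1..t}" "card S = s" "u permutes {1..r}" "v permutes {1..s}"
      "S' \<subseteq> {1..t}" "card S' = s" "u' permutes {1..r}" "v' permutes {1..s}"
      using z zz zz' by auto
    have eq: "block_perm r s (Min S) u v \<circ> inv (perm_of (block_word t S))
        = block_perm r s (Min S') u' v' \<circ> inv (perm_of (block_word t S'))"
      "u (Min S) = u' (Min S')" using z(3) zz zz' by auto
    \<comment> \<open>The interval on the right depends only on \<open>u (Min S)\<close>, which is
      the second component of the image; this is what identifies \<open>S\<close> as a
      preimage.\<close>
    have img: "(block_perm r s (Min S) u v \<circ> inv (perm_of (block_word t S))) ` S
        = (\<lambda>l. l + u (Min S) - 1) ` {1..s}"
      if h: "S \<subseteq> {1..t}" "card S = s" "u permutes {1..r}" "v permutes {1..s}" for S u v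
    proof -
      note S = S[OF h(1,2)]
      have "inv (perm_of (block_word t S)) ` S
          = (inv (perm_of (block_word t S)) \<circ> perm_of (block_word t S)) ` (\<lambda>l. l + Min S - 1) ` {1..s}"
        using perm_of_block_word_image[OF h(1) S(1)] h(2) by (simp only: image_comp[symmetric])
      also have "\<dots> = (\<lambda>l. l + Min S - 1) ` {1..s}"
        using permutes_inv_o(2)[OF S(4)] by simp
      finally have "(block_perm r s (Min S) u v \<circ> inv (perm_of (block_word t S))) ` S
          = block_perm r s (Min S) u v ` (\<lambda>l. l + Min S - 1) ` {1..s}"
        by (simp only: image_comp[symmetric])
      also have "\<dots> = (\<lambda>l. v l + u (Min S) - 1) ` {1..s}"
        unfolding image_image by (rule image_cong)
          (use block_perm_inside[OF assms(2) S(2,3) h(3,4)] in auto)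
      also have "\<dots> = (\<lambda>l. l + u (Min S) - 1) ` (v ` {1..s})" by (simp add: image_image)
      also have "v ` {1..s} = {1..s}" using h(4) by (rule permutes_image)
      finally show ?thesis .
    qed
    have inj: "inj (block_perm r s (Min S) u v \<circ> inv (perm_of (block_word t S)))"
      if h: "S \<subseteq> {1..t}" "card S = s" "u permutes {1..r}" "v permutes {1..s}" for S u v
      using permutes_inj[OF permutes_inv[OF S(4)[OF h(1,2)]]]
        permutes_inj[OF block_perm_permutes[OF assms(2) S(2,3)[OF h(1,2)] h(3,4)]]
      by (simp add: inj_compose)
    have "(block_perm r s (Min S) u v \<circ> inv (perm_of (block_word t S))) ` S
        = (block_perm r s (Min S) u v \<circ> inv (perm_of (block_word t S))) ` S'"
      using img[OF h(1-4)] img[OF h(5-8)] eq by simp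
    then have SS: "S = S'" using inj_image_eq_iff[OF inj[OF h(1-4)]] by blast
    have "block_perm r s (Min S) u v = block_perm r s (Min S) u' v'"
    proof
      fix l
      have "inv (perm_of (block_word t S)) (perm_of (block_word t S) l) = l"
        using permutes_inverses(2)[OF S(4)[OF h(1,2)]] .
      then show "block_perm r s (Min S) u v l = block_perm r s (Min S) u' v' l"
        using fun_cong[OF eq(1), of "perm_of (block_word t S) l"] SS by simp
    qed
    then have "u = u' \<and> v = v'"
      using block_perm_inject[OF assms(2) S(2,3)[OF h(1,2)] h(3,4,7,8)] eq(2) SS by simp
    then show "z = z'" using zz zz' SS by simp
  qed
  moreover have fin: "finite ?B" by (simp add: finite_permutations)
  moreover have "card ?A = card ?B"
  proof -
    have ts: "s \<le> t" "t - s = r - 1" using assms by auto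
    have "card ?A = (t choose s) * (fact r * fact s)"
      by (simp add: card_cartesian_product n_subsets card_permutations)
    also have "(fact r :: nat) = r * fact (r - 1)" using assms(1) by (simp add: fact_reduce)
    also have "(t choose s) * (r * fact (r - 1) * fact s) = r * (fact s * fact (t - s) * (t choose s))"
      by (simp add: ts)
    also have "\<dots> = r * fact t" using binomial_fact_lemma[OF ts(1)] by simp
    also have "\<dots> = card ?B" by (simp add: card_cartesian_product card_permutations)
    finally show ?thesis .
  qed
  ultimately show ?thesis
    by (simp add: bij_betw_def card_image card_subset_eq)
qed

section \<open>Signs\<close>

lemma ksgn_add: "ksgn (a + b) = (ksgn a * ksgn b :: 'f::field)"
  by (auto simp: ksgn_def)

lemma ksgn_square: "ksgn a * (ksgn a * x) = (x :: 'f::field)"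
  by (auto simp: ksgn_def)

lemma ksgn_cong: "even (a - b) \<Longrightarrow> ksgn a = (ksgn b :: 'f::field)"
  by (auto simp: ksgn_def)

lemma sgnpow_add: "sgnpow (j + k) w = (sgnpow j w * sgnpow k w :: 'f::field)"
  by (cases w rule: sign_cases) (auto simp: sgnpow_def)

lemma sgnpow_minus [simp]: "sgnpow (- k) w = (sgnpow k w :: 'f::field)"
  by (simp add: sgnpow_def)

lemma sgnpow_square: "sgnpow k w * (sgnpow k w * x) = (x :: 'f::field)"
  by (cases w rule: sign_cases) (auto simp: sgnpow_def)

lemma sgnpow_compose:
  "u permutes A \<Longrightarrow> v permutes A \<Longrightarrow> finite A \<Longrightarrow>
     sgnpow k (u \<circ> v) = (sgnpow k u * sgnpow k v :: 'f::field)"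
  by (simp add: sgnpow_def sign_compose[OF permutes_imp_permutation[of A]
      permutes_imp_permutation[of A]])

lemma sgnpow_inv:
  "u permutes A \<Longrightarrow> finite A \<Longrightarrow> sgnpow k (inv u) = (sgnpow k u :: 'f::field)"
  by (simp add: sgnpow_def sign_inverse[OF permutes_imp_permutation[of A]])

section \<open>Symmetrization\<close>

text \<open>The norm of the symmetric group acting on functions on simplices, twisted by the
  \<open>j\<close>-th power of the signature. Evaluating at the translate by \<open>w\<close>
  instead of its inverse changes neither the sum nor the signs.\<close>

definition symmetrize :: "int \<Rightarrow> (simplex \<Rightarrow> 'f::field) \<Rightarrow> simplex \<Rightarrow> 'f" where
  "symmetrize j f b = (\<Sum>w | w permutes {1..length (hd b)}. sgnpow j w * f (map (map w) b))"

lemma symmetrize_add: "symmetrize j (f + g) = symmetrize j f + symmetrize j g"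
  by (simp add: symmetrize_def fun_eq_iff distrib_left sum.distrib)

lemma symmetrize_diff: "symmetrize j (f - g) = symmetrize j f - symmetrize j g"
  by (simp add: symmetrize_def fun_eq_iff right_diff_distrib sum_subtractf)

lemma symmetrize_scale: "symmetrize j (scale a f) = scale a (symmetrize j f)"
  by (simp add: symmetrize_def scale_def fun_eq_iff sum_distrib_left mult_ac)

lemma map_map_inv:
  assumes "w permutes A"
  shows "map (map (inv w)) (map (map w) b) = b" "map (map w) (map (map (inv w)) b) = b"
  using assms by (simp_all add: o_def permutes_inverses)

lemma be_simplices_map_map_iff:
  assumes "w permutes {1..r}"
  shows "map (map w) b \<in> be_simplices n r \<longleftrightarrow> b \<in> be_simplices n r"
  using permutes_map_map[OF assms, of b n]
    permutes_map_map[OF permutes_inv[OF assms], of "map (map w) b" n]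
  by (auto simp only: map_map_inv[OF assms])

lemma symmetrize_map_map:
  assumes "w permutes {1..length (hd b)}" "b \<noteq> []"
  shows "symmetrize j f (map (map w) b) = sgnpow j w * symmetrize j f b"
proof -
  have "symmetrize j f (map (map w) b)
      = (\<Sum>v | v permutes {1..length (hd b)}. sgnpow j v * f (map (map (v \<circ> w)) b))"
    by (simp add: symmetrize_def hd_map assms(2))
  also have "\<dots> = (\<Sum>v | v permutes {1..length (hd b)}. sgnpow j w * (sgnpow j (v \<circ> w) * f (map (map
      (v \<circ> w)) b)))"
    by (rule sum.cong) (use assms in \<open>auto simp: sgnpow_compose mult_ac sgnpow_square\<close>)
  also have "\<dots> = (\<Sum>v | v permutes {1..length (hd b)}. sgnpow j w * (sgnpow j v * f (map (map v) b)))"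
    by (rule sum_permutations_compose_right[OF assms(1), symmetric])
  also have "\<dots> = sgnpow j w * symmetrize j f b" by (simp add: symmetrize_def sum_distrib_left)
  finally show ?thesis .
qed

lemma basis_BE: "basis (BE n :: (simplex, 'f::field) dgop) = (\<Union>r\<in>{1..}. be_simplices n r)"
  by (simp add: BE_def)

lemma ar_BE: "ar (BE n :: (simplex, 'f::field) dgop) = (\<lambda>b. length (hd b))"
  by (simp add: BE_def)

lemma in_basis_BE:
  "b \<in> basis (BE n :: (simplex, 'f::field) dgop)
     \<longleftrightarrow> 1 \<le> length (hd b) \<and> b \<in> be_simplices n (length (hd b))"
  by (auto simp: basis_BE length_hd_be_simplices)

text \<open>A finite set that, unlike the support of a series, is stable under the symmetric groups;
  sums over it can be reindexed by a permutation.\<close>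

definition be_upto :: "nat \<Rightarrow> nat \<Rightarrow> simplex set" where
  "be_upto n N = (\<Union>r\<in>{1..N}. be_simplices n r)"

lemma finite_be_upto [simp]: "finite (be_upto n N)"
  by (simp add: be_upto_def finite_be_simplices)

text \<open>The norm is self-adjoint: substitute the translate of \<open>b\<close> by the inverse of
  \<open>w\<close>, then exchange \<open>w\<close> with its inverse. Consequently the pairing sees
  each argument only through its norm.\<close>

lemma sum_symmetrize_swap:
  "(\<Sum>b\<in>be_upto n N. c b * symmetrize j p b) = (\<Sum>b\<in>be_upto n N. symmetrize j c b * (p b :: 'f::field))"
proof -
  have disj: "\<forall>r\<in>{1..N}. \<forall>s\<in>{1..N}. r \<noteq> s \<longrightarrow> be_simplices n r \<inter> be_simplices n s = {}"
    using length_hd_be_simplices by blast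
  have "(\<Sum>b\<in>be_simplices n r. c b * symmetrize j p b) = (\<Sum>b\<in>be_simplices n r. symmetrize j c b * p b)"
    for r
  proof -
    have "(\<Sum>b\<in>be_simplices n r. c b * symmetrize j p b)
        = (\<Sum>b\<in>be_simplices n r. \<Sum>w | w permutes {1..r}. sgnpow j w * (c b * p (map (map w) b)))"
      by (rule sum.cong) (auto simp: symmetrize_def length_hd_be_simplices sum_distrib_left mult_ac)
    also have "\<dots> = (\<Sum>w | w permutes {1..r}. \<Sum>b\<in>be_simplices n r. sgnpow j w * (c b * p (map (map w) b)))"
      by (rule sum.swap)
    also have "\<dots> = (\<Sum>w | w permutes {1..r}. \<Sum>b\<in>be_simplices n r. sgnpow j (inv w) * (c (map (map
        (inv w)) b) * p b))"
    proof (rule sum.cong[OF refl])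
      fix w assume "w \<in> {w. w permutes {1..r}}"
      then have w: "w permutes {1..r}" by simp
      show "(\<Sum>b\<in>be_simplices n r. sgnpow j w * (c b * p (map (map w) b)))
          = (\<Sum>b\<in>be_simplices n r. sgnpow j (inv w) * (c (map (map (inv w)) b) * p b))"
        by (rule sum.reindex_bij_witness[of _ "map (map (inv w))" "map (map w)"])
          (use w map_map_inv[OF w] permutes_map_map[OF w] permutes_map_map[OF permutes_inv[OF w]]
           in \<open>auto simp: sgnpow_inv simp del: map_map\<close>)
    qed
    also have "\<dots> = (\<Sum>w | w permutes {1..r}. \<Sum>b\<in>be_simplices n r. sgnpow j w * (c (map (map w) b) * p b))"
      by (rule sum_permutations_inverse[symmetric])
    also have "\<dots> = (\<Sum>b\<in>be_simplices n r. \<Sum>w | w permutes {1..r}. sgnpow j w * (c (map (map w) b) * p b))"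
      by (rule sum.swap)
    also have "\<dots> = (\<Sum>b\<in>be_simplices n r. symmetrize j c b * p b)"
      by (rule sum.cong) (auto simp: symmetrize_def length_hd_be_simplices sum_distrib_right mult.assoc)
    finally show ?thesis .
  qed
  then show ?thesis
    using disj by (simp add: be_upto_def sum.UNION_disjoint finite_be_simplices)
qed

text \<open>Applied to the first vertex of a simplex, this is the freeness of the action, with the
  simplices starting at the identity as representatives of the orbits.\<close>

lemma map_inv_eq_upt_iff:
  assumes "l \<in> permutations_of_set {1..r}" "w permutes {1..r}"
  shows "map (inv w) l = [1..<r + 1] \<longleftrightarrow> w = perm_of l"
proof -
  have len: "length l = r" using permutations_of_set_length[OF assms(1)] .
  have p: "map (perm_of l) [1..<r + 1] = l"
    using len by (intro nth_equalityI) (auto simp: perm_of_def nth_append simp del: upt_Suc)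
  have "map (inv w) l = [1..<r + 1] \<longleftrightarrow> l = map w [1..<r + 1]"
  proof
    assume h: "map (inv w) l = [1..<r + 1]"
    have "l = map w (map (inv w) l)" using assms(2) by (simp add: o_def permutes_inverses)
    then show "l = map w [1..<r + 1]" unfolding h .
  next
    assume "l = map w [1..<r + 1]"
    then show "map (inv w) l = [1..<r + 1]"
      using assms(2) by (simp add: o_def permutes_inverses)
  qed
  also have "\<dots> \<longleftrightarrow> (\<forall>x\<in>{1..r}. w x = perm_of l x)"
  proof -
    have "l = map w [1..<r + 1] \<longleftrightarrow> map (perm_of l) [1..<r + 1] = map w [1..<r + 1]"
      by (simp only: p)
    also have "\<dots> \<longleftrightarrow> (\<forall>x\<in>set [1..<r + 1]. perm_of l x = w x)" by (simp only: map_eq_conv)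
    also have "set [1..<r + 1] = {1..r}" by auto
    finally show ?thesis by metis
  qed
  also have "\<dots> \<longleftrightarrow> w = perm_of l"
  proof
    assume *: "\<forall>x\<in>{1..r}. w x = perm_of l x"
    show "w = perm_of l"
    proof
      fix x show "w x = perm_of l x"
      proof (cases "x \<in> {1..r}")
        case False
        then show ?thesis
          using permutes_not_in[OF assms(2)] permutes_not_in[OF perm_of_permutes[OF assms(1)]] by simp
      qed (use * in auto)
    qed
  qed simp
  finally show ?thesis .
qed

lemma sum_fun_apply: "(\<Sum>i\<in>A. F i) x = (\<Sum>i\<in>A. F i (x :: 'a) :: 'b::comm_monoid_add)"
  by (induction A rule: infinite_finite_induct) simp_all

lemma module_scale: "module (scale :: 'f::field \<Rightarrow> ('b \<Rightarrow> 'f) \<Rightarrow> 'b \<Rightarrow> 'f)"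
  by unfold_locales (auto simp: scale_def fun_eq_iff distrib_left distrib_right mult_ac)

section \<open>Coinvariants\<close>

definition norm_equal :: "nat \<Rightarrow> int \<Rightarrow> (simplex \<Rightarrow> 'f::field) \<Rightarrow> (simplex \<Rightarrow> 'f) \<Rightarrow> bool" where
  "norm_equal n j f g \<longleftrightarrow>
     (\<forall>b\<in>basis (BE n :: (simplex, 'f) dgop). symmetrize j f b = symmetrize j g b)"

text \<open>The three (co)operads \<open>BE n\<close>, \<open>dual (BE n)\<close> and \<open>DE n\<close> have the same basis, on which the
  symmetric groups act freely up to signs; with the sign of the action on the variables, the same
  sign remains in the three cases.\<close>

locale signed_be =
  fixes P :: "(simplex, 'f::field) dgop" and n :: nat and k j :: int
  assumes basis_eq: "basis P = basis (BE n :: (simplex, 'f) dgop)"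
    and ar_eq: "ar P = (\<lambda>b. length (hd b))"
    and act_eq: "\<And>w b b'. w permutes {1..length (hd b)} \<Longrightarrow> b \<in> basis P \<Longrightarrow>
      sgnpow k w * act P w b b' = sgnpow j w * of_bool (b' = map (map w) b)"
begin

lemma bas_eq: "bas P r = (if 1 \<le> r then be_simplices n r else {})"
  by (auto simp: bas_def basis_eq ar_eq basis_BE length_hd_be_simplices)

lemma in_basis: "b \<in> basis P \<longleftrightarrow> 1 \<le> length (hd b) \<and> b \<in> be_simplices n (length (hd b))"
  by (simp add: basis_eq in_basis_BE)

lemma in_basis_ne: "b \<in> basis P \<Longrightarrow> b \<noteq> []"
  by (auto simp: in_basis be_simplices_alt)

lemma basis_map_map:
  assumes "w permutes {1..length (hd b)}" "b \<noteq> []"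
  shows "map (map w) b \<in> basis P \<longleftrightarrow> b \<in> basis P"
  using be_simplices_map_map_iff[OF assms(1)] assms(2) by (simp add: in_basis hd_map)

lemma symmetrize_outside:
  assumes "f \<in> series P" "b \<notin> basis P" "b \<noteq> []"
  shows "symmetrize j' f b = 0"
  unfolding symmetrize_def
  by (rule sum.neutral) (use assms basis_map_map in \<open>auto simp: series_def\<close>)

lemma tact_eq:
  assumes "w permutes {1..length (hd b)}" "b \<in> basis P" "g \<in> series P"
  shows "tact P k w g b = sgnpow j w * g (map (map (inv w)) b)"
proof -
  let ?r = "length (hd b)"
  have r: "1 \<le> ?r" "b \<in> be_simplices n ?r" using assms(2) by (auto simp: in_basis)
  have "tact P k w g b = (\<Sum>b'\<in>bas P ?r. sgnpow k w * act P w b' b * g b')"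
    by (simp add: tact_def ar_eq)
  also have "\<dots> = (\<Sum>b'\<in>bas P ?r. if b' = map (map (inv w)) b then sgnpow j w * g b' else 0)"
  proof (rule sum.cong[OF refl])
    fix b' assume b': "b' \<in> bas P ?r"
    have "sgnpow k w * act P w b' b = sgnpow j w * of_bool (b = map (map w) b')"
      using b' assms(1) by (intro act_eq) (auto simp: bas_def ar_eq)
    moreover have "b = map (map w) b' \<longleftrightarrow> b' = map (map (inv w)) b"
      using map_map_inv[OF assms(1)] by metis
    ultimately show "sgnpow k w * act P w b' b * g b'
        = (if b' = map (map (inv w)) b then sgnpow j w * g b' else 0)" by simp
  qed
  also have "\<dots> = sgnpow j w * g (map (map (inv w)) b)"
    using permutes_map_map[OF permutes_inv[OF assms(1)] r(2)] r(1)
    by (simp add: bas_eq finite_be_simplices)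
  finally show ?thesis .
qed

lemma tact_outside:
  assumes "comp_ar P r g = g" "b \<notin> bas P r" "w permutes {1..r}"
  shows "tact P k w g b = 0"
proof (cases "length (hd b) = r")
  case True
  have "sgnpow k w * act P w b' b = 0" if "b' \<in> bas P r" for b'
  proof -
    have b': "b' \<in> basis P" "length (hd b') = r" using that by (auto simp: bas_def ar_eq)
    have "b \<noteq> map (map w) b'"
      using assms(2) basis_map_map[of w b'] assms(3) b' in_basis_ne[OF b'(1)] True
      by (auto simp: bas_def ar_eq)
    then show ?thesis using act_eq[of w b' b] b' assms(3) by simp
  qed
  then show ?thesis using True by (auto simp: tact_def ar_eq intro!: sum.neutral)
next
  case False
  have "g b' = 0" if "b' \<in> bas P (length (hd b))" for b'
    using that False fun_cong[OF assms(1), of b'] by (auto simp: comp_ar_def bas_def)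
  then show ?thesis by (simp add: tact_def ar_eq)
qed

lemma sum_tact:
  assumes "b \<in> basis P" "g \<in> series P"
  shows "(\<Sum>w | w permutes {1..length (hd b)}. tact P k w g b) = symmetrize j g b"
proof -
  have "(\<Sum>w | w permutes {1..length (hd b)}. tact P k w g b)
      = (\<Sum>w | w permutes {1..length (hd b)}. sgnpow j (inv w) * g (map (map (inv w)) b))"
    by (rule sum.cong) (use assms in \<open>auto simp: tact_eq sgnpow_inv\<close>)
  then show ?thesis unfolding symmetrize_def by (simp only: sum_permutations_inverse[of "\<lambda>w. sgnpow
      j w * g (map (map w) b)"])
qed

lemma symmetrize_tact:
  assumes "w permutes {1..r}" "g \<in> series P" "comp_ar P r g = g" "b \<in> basis P"
  shows "symmetrize j (tact P k w g) b = symmetrize j g b"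
proof (cases "length (hd b) = r")
  case True
  have ne: "b \<noteq> []" using assms(4) by (rule in_basis_ne)
  have "symmetrize j (tact P k w g) b
      = (\<Sum>v | v permutes {1..r}. sgnpow j (inv w \<circ> v) * g (map (map (inv w \<circ> v)) b))"
    unfolding symmetrize_def True
  proof (rule sum.cong[OF refl])
    fix v assume "v \<in> {v. v permutes {1..r}}"
    then have v: "v permutes {1..r}" by simp
    have "tact P k w g (map (map v) b) = sgnpow j w * g (map (map (inv w)) (map (map v) b))"
      using assms v True ne basis_map_map[of v b] by (intro tact_eq) (auto simp: hd_map)
    then show "sgnpow j v * tact P k w g (map (map v) b)
        = sgnpow j (inv w \<circ> v) * g (map (map (inv w \<circ> v)) b)"
      using v assms(1) by (simp add: sgnpow_compose[OF permutes_inv[OF assms(1)]] sgnpow_inv[OF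
          assms(1)] mult_ac)
  qed
  also have "\<dots> = symmetrize j g b"
    unfolding symmetrize_def True
    by (rule setum_permutations_compose_left[OF permutes_inv[OF assms(1)], symmetric])
  finally show ?thesis .
next
  case False
  have ne: "b \<noteq> []" using assms(4) by (rule in_basis_ne)
  have "map (map v) b \<notin> bas P r" for v using False ne by (simp add: bas_def ar_eq hd_map)
  moreover from this have "g (map (map v) b) = 0" for v
    using fun_cong[OF assms(3), of "map (map v) b"] by (simp add: comp_ar_def)
  ultimately show ?thesis using tact_outside[OF assms(3) _ assms(1)] by (simp add: symmetrize_def)
qed

lemma symmetrize_comp_ar:
  assumes "b \<in> basis P"
  shows "symmetrize j (comp_ar P (length (hd b)) f) b = symmetrize j f b"
  unfolding symmetrize_def
  by (rule sum.cong) (use assms basis_map_map[of _ b] in_basis_ne[OF assms]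
    in \<open>auto simp: comp_ar_def bas_def ar_eq hd_map\<close>)

text \<open>As the action is free, this holds in any characteristic: \<open>f\<close> is the sum of the translates of the
  functions \<open>h w\<close>, supported on the simplices starting at the identity, whose own sum is a
  restriction of the symmetrization of \<open>f\<close>.\<close>

lemma comp_ar_in_span:
  assumes f: "f \<in> series P" and zero: "\<And>b. b \<in> basis P \<Longrightarrow> symmetrize j f b = 0"
  shows "comp_ar P r f \<in> module.span scale
     {tact P k w g - g | w g. w permutes {1..r} \<and> g \<in> series P \<and> comp_ar P r g = g}"
proof -
  interpret m: module "scale :: 'f \<Rightarrow> (simplex \<Rightarrow> 'f) \<Rightarrow> simplex \<Rightarrow> 'f" by (rule module_scale)
  define h where "h w = (\<lambda>b. if b \<in> bas P r \<and> hd b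
      = [1..<r + 1] then sgnpow j w * f (map (map w) b) else 0)"
    for w
  have h: "h w \<in> series P" "comp_ar P r (h w) = h w" for w
    by (auto simp: h_def series_def bas_def comp_ar_def fun_eq_iff)
  \<comment> \<open>At a simplex \<open>b\<close> only the translate with
    \<open>w = perm_of (hd b)\<close> contributes, and it contributes \<open>f b\<close>. The
    subtracted terms live on the simplices starting at the identity, where they add up to the norm
    of \<open>f\<close>, which vanishes.\<close>
  have "comp_ar P r f = (\<Sum>w | w permutes {1..r}. tact P k w (h w) - h w)"
  proof
    fix b
    have sum: "(\<Sum>w | w permutes {1..r}. tact P k w (h w) - h w) b
        = (\<Sum>w | w permutes {1..r}. tact P k w (h w) b) - (\<Sum>w | w permutes {1..r}. h w b)"
      by (simp add: sum_fun_apply sum_subtractf)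
    show "comp_ar P r f b = (\<Sum>w | w permutes {1..r}. tact P k w (h w) - h w) b"
    proof (cases "b \<in> bas P r")
      case False
      then have "h w b = 0" for w by (simp add: h_def)
      moreover have "tact P k w (h w) b = 0" if "w permutes {1..r}" for w
        using tact_outside[OF h(2) False that] .
      ultimately show ?thesis unfolding sum using False by (simp add: comp_ar_def)
    next
      case True
      then have b: "b \<in> basis P" "length (hd b) = r" "b \<noteq> []" "b \<in> be_simplices n r"
        using in_basis_ne by (auto simp: bas_def ar_eq in_basis)
      have hdb: "hd b \<in> permutations_of_set {1..r}" using b(3,4) by (auto simp: be_simplices_alt)
      have "(\<Sum>w | w permutes {1..r}. h w b) = 0"
      proof (cases "hd b = [1..<r + 1]")
        case nf: True
        then show ?thesis using zero[OF b(1)] True by (simp add: h_def symmetrize_def b(2) del: upt_Suc)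
      qed (simp add: h_def)
      moreover have "(\<Sum>w | w permutes {1..r}. tact P k w (h w) b)
          = (\<Sum>w | w permutes {1..r}. if w = perm_of (hd b) then f b else 0)"
      proof (rule sum.cong[OF refl])
        fix w assume "w \<in> {w. w permutes {1..r}}"
        then have w: "w permutes {1..r}" by simp
        have "map (map (inv w)) b \<in> bas P r"
          using b basis_map_map[of "inv w" b] permutes_inv[OF w] by (simp add: bas_def ar_eq hd_map)
        moreover have "hd (map (map (inv w)) b) = [1..<r + 1] \<longleftrightarrow> w = perm_of (hd b)"
          using map_inv_eq_upt_iff[OF hdb w] b(3) by (simp add: hd_map)
        ultimately have "h w (map (map (inv w)) b) = (if w
            = perm_of (hd b) then sgnpow j w * f b else 0)"
          unfolding h_def by (simp only: map_map_inv[OF w] simp_thms)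
        then show "tact P k w (h w) b = (if w = perm_of (hd b) then f b else 0)"
          using tact_eq[OF _ b(1) h(1)] w b(2) by (simp add: sgnpow_square)
      qed
      moreover have "\<dots> = f b"
        using perm_of_permutes[OF hdb] by (simp add: finite_permutations)
      ultimately show ?thesis unfolding sum using True by (simp add: comp_ar_def)
    qed
  qed
  also have "\<dots> \<in> m.span {tact P k w g - g | w g. w permutes {1..r} \<and> g \<in> series P \<and> comp_ar P r g = g}"
    by (rule m.span_sum, rule m.span_base) (use h in blast)
  finally show ?thesis .
qed

text \<open>The functions of norm zero form a subspace containing all generators
  \<open>tact P k w g - g\<close>, hence their span; the converse is \<open>comp_ar_in_span\<close>.
  From here on, equality of classes is equality of norms.\<close>

lemma coinv_sub_iff:
  "f \<in> coinv_sub P k \<longleftrightarrow> f \<in> series P \<and> (\<forall>b\<in>basis P. symmetrize j f b = 0)"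
proof
  interpret m: module "scale :: 'f \<Rightarrow> (simplex \<Rightarrow> 'f) \<Rightarrow> simplex \<Rightarrow> 'f" by (rule module_scale)
  assume f: "f \<in> coinv_sub P k"
  let ?T = "{h. \<forall>b\<in>basis P. symmetrize j h b = 0}"
  have sub: "m.subspace ?T"
  proof (rule m.subspaceI)
    show "0 \<in> ?T" by (simp add: symmetrize_def)
  qed (auto simp: symmetrize_add symmetrize_scale, simp add: scale_def)
  have "symmetrize j f b = 0" if "b \<in> basis P" for b
  proof -
    let ?r = "length (hd b)"
    have "comp_ar P ?r f \<in> m.span
        {tact P k w g - g | w g. w permutes {1..?r} \<and> g \<in> series P \<and> comp_ar P ?r g = g}"
      using f by (simp add: coinv_sub_def)
    also have "\<dots> \<subseteq> ?T"
      by (rule m.span_minimal[OF _ sub]) (auto simp: symmetrize_diff symmetrize_tact)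
    finally have "symmetrize j (comp_ar P ?r f) b = 0" using that by blast
    then show ?thesis using symmetrize_comp_ar[OF that, of f] by simp
  qed
  then show "f \<in> series P \<and> (\<forall>b\<in>basis P. symmetrize j f b = 0)" using f by (simp add: coinv_sub_def)
next
  assume "f \<in> series P \<and> (\<forall>b\<in>basis P. symmetrize j f b = 0)"
  then show "f \<in> coinv_sub P k" unfolding coinv_sub_def using comp_ar_in_span by blast
qed

lemma series_diff: "f \<in> series P \<Longrightarrow> g \<in> series P \<Longrightarrow> f - g \<in> series P"
  by (simp add: series_def)

lemma ccls_eq: "f \<in> series P \<Longrightarrow> ccls P k f = {g \<in> series P. norm_equal n j f g}"
  by (auto simp: ccls_def coinv_rel_def coinv_sub_iff norm_equal_def basis_eq[symmetric]
      symmetrize_diff series_diff)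

lemma fcls_eq: "f \<in> fin_series P \<Longrightarrow> fcls P k f = {g \<in> fin_series P. norm_equal n j f g}"
  by (auto simp: fcls_def coinv_rel_def coinv_sub_iff norm_equal_def basis_eq[symmetric]
      symmetrize_diff series_diff
      fin_series_def)

lemma ccls_eq_iff: "f \<in> series P \<Longrightarrow> g \<in> series P \<Longrightarrow> ccls P k f = ccls P k g \<longleftrightarrow> norm_equal n j f g"
  by (auto simp: ccls_eq norm_equal_def basis_eq[symmetric] set_eq_iff)

lemma fcls_eq_iff:
  "f \<in> fin_series P \<Longrightarrow> g \<in> fin_series P \<Longrightarrow> fcls P k f = fcls P k g \<longleftrightarrow> norm_equal n j f g"
  by (auto simp: fcls_eq norm_equal_def basis_eq[symmetric] set_eq_iff)

lemma cfree_eq: "cfree P k = ccls P k ` series P"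
  by (auto simp: cfree_def quotient_def ccls_def)

lemma ffree_eq: "ffree P k = fcls P k ` fin_series P"
  by (auto simp: ffree_def quotient_def fcls_def)

lemma fin_series_upto:
  assumes "c \<in> fin_series P"
  obtains N where "{b. c b \<noteq> 0} \<subseteq> be_upto n N"
proof
  have fin: "finite {b. c b \<noteq> 0}" and s: "c \<in> series P" using assms by (auto simp: fin_series_def)
  let ?N = "\<Sum>b\<in>{b. c b \<noteq> 0}. length (hd b)"
  show "{b. c b \<noteq> 0} \<subseteq> be_upto n ?N"
  proof
    fix b assume b: "b \<in> {b. c b \<noteq> 0}"
    then have "b \<in> basis P" using s by (auto simp: series_def)
    moreover have "length (hd b) \<le> ?N" using member_le_sum[OF b, of "\<lambda>b. length (hd b)"] fin by simp
    ultimately show "b \<in> be_upto n ?N" by (auto simp: in_basis be_upto_def)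
  qed
qed

end

lemma signed_be_BE: "signed_be (BE n :: (simplex, 'f::field) dgop) n (- int m) (int m)"
  by unfold_locales (simp_all add: ar_BE, simp add: BE_def)

lemma signed_be_dual: "signed_be (dual (BE n :: (simplex, 'f::field) dgop)) n (int m) (int m)"
proof
  fix w :: "nat \<Rightarrow> nat" and b b' :: simplex
  assume w: "w permutes {1..length (hd b)}"
  have "b = map (map (inv w)) b' \<longleftrightarrow> b' = map (map w) b"
    using map_map_inv[OF w] by metis
  then show "sgnpow (int m) w * act (dual (BE n :: (simplex, 'f) dgop)) w b b'
      = sgnpow (int m) w * of_bool (b' = map (map w) b)"
    by (simp add: dual_def BE_def)
qed (simp_all add: dual_def ar_BE)

text \<open>The signature twist of the suspension has the parity of \<open>n\<close> and that of
  variables of degree \<open>m - n\<close> the parity of \<open>m - n\<close>; together they leave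
  the parity of \<open>m\<close>.\<close>

lemma signed_be_DE: "signed_be (DE n :: (simplex, 'f::field) dgop) n (int m - int n) (int m)"
proof -
  \<comment> \<open>In degree 0 all signature factors are 1, so that \<open>dual.act_eq\<close>
    describes the untwisted action.\<close>
  interpret dual: signed_be "dual (BE n :: (simplex, 'f) dgop)" n "int 0" "int 0"
    by (rule signed_be_dual)
  show ?thesis
  proof
    fix w :: "nat \<Rightarrow> nat" and b b' :: simplex
    assume w: "w permutes {1..length (hd b)}" and b: "b \<in> basis (DE n :: (simplex, 'f) dgop)"
    have "act (dual (BE n :: (simplex, 'f) dgop)) w b b' = of_bool (b' = map (map w) b)"
      using dual.act_eq[OF w, of b'] b by (simp add: DE_def susp_def sgnpow_def)
    moreover have "sgnpow (int m - int n) w * sgnpow (- int n) w = (sgnpow (int m) w :: 'f)"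
      using sgnpow_add[of "int m - int n" "int n" w, where ?'f = 'f] by simp
    ultimately show "sgnpow (int m - int n) w * act (DE n :: (simplex, 'f) dgop) w b b'
        = sgnpow (int m) w * of_bool (b' = map (map w) b)"
      by (simp add: DE_def susp_def mult.assoc[symmetric])
  qed (simp_all add: DE_def susp_def dual_def ar_BE)
qed

lemma series_dual [simp]: "series (dual P) = series P"
  and fin_series_dual [simp]: "fin_series (dual P) = fin_series P"
  by (simp_all add: series_def fin_series_def dual_def)

lemma series_DE [simp]: "series (DE n) = series (BE n :: (simplex, 'f::field) dgop)"
  and fin_series_DE [simp]: "fin_series (DE n) = fin_series (BE n :: (simplex, 'f) dgop)"
  by (simp_all add: series_def fin_series_def DE_def susp_def dual_def)

lemma fin_seriesD: "c \<in> fin_series P \<Longrightarrow> c \<in> series P"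
  by (simp add: fin_series_def)

section \<open>The suspension isomorphism\<close>

text \<open>The sign of \<open>susp_iso\<close>, where \<open>1 - int (length b)\<close> is the
  degree of the dual of \<open>b\<close>. It depends only on dimension and arity, hence commutes
  with the norm, and it squares to 1; so the suspension isomorphism descends to classes and is
  inverted by the same sign.\<close>

definition susp_sgn :: "nat \<Rightarrow> nat \<Rightarrow> simplex \<Rightarrow> 'f::field" where
  "susp_sgn n m b =
     ksgn ((1 - int (length b)) * (int n * int (length (hd b)))
           + int n * int m * int (length (hd b) choose 2)) * end_sgn (- int n) (length (hd b))"

lemma susp_sgn_square: "susp_sgn n m b * (susp_sgn n m b * x) = (x :: 'f::field)"
  by (auto simp: susp_sgn_def ksgn_def end_sgn_def)

lemma susp_sgn_map_map: "b \<noteq> [] \<Longrightarrow> susp_sgn n m (map (map w) b) = susp_sgn n m b"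
  by (simp add: susp_sgn_def hd_map)

lemma symmetrize_susp_sgn:
  "b \<noteq> [] \<Longrightarrow> symmetrize j (\<lambda>b. susp_sgn n m b * f b) b = susp_sgn n m b * symmetrize j f b"
  by (simp add: symmetrize_def susp_sgn_map_map sum_distrib_left mult_ac)

lemma ne_basis_BE: "b \<in> basis (BE n :: (simplex, 'f::field) dgop) \<Longrightarrow> b \<noteq> []"
  by (auto simp: basis_BE be_simplices_alt)

lemma norm_equal_susp_sgn:
  "norm_equal n j (\<lambda>b. susp_sgn n m b * f b) (\<lambda>b. susp_sgn n m b * g b)
     \<longleftrightarrow> norm_equal n j f (g :: simplex \<Rightarrow> 'f::field)"
proof -
  have "susp_sgn n m b * x = susp_sgn n m b * y \<longleftrightarrow> x = (y :: 'f)" for b x y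
    by (metis susp_sgn_square)
  then show ?thesis by (auto simp: norm_equal_def symmetrize_susp_sgn ne_basis_BE)
qed

lemma fin_series_susp_sgn:
  "c \<in> fin_series P \<Longrightarrow> (\<lambda>b. susp_sgn n m b * c b) \<in> fin_series P"
  by (auto simp: fin_series_def series_def elim!: rev_finite_subset)

lemma susp_iso_fcls:
  fixes c :: "simplex \<Rightarrow> 'f::field"
  assumes "c \<in> fin_series (BE n)"
  shows "susp_iso n m (BE n) (fcls (DE n) (int m - int n) c)
           = fcls (dual (BE n)) (int m) (\<lambda>b. susp_sgn n m b * c b)"
proof -
  interpret d: signed_be "dual (BE n :: (simplex, 'f) dgop)" n "int m" "int m" by (rule signed_be_dual)
  interpret D: signed_be "DE n :: (simplex, 'f) dgop" n "int m - int n" "int m" by (rule signed_be_DE)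
  have "fcls (dual (BE n)) (int m) (\<lambda>b. susp_sgn n m b * f b)
      = fcls (dual (BE n)) (int m) (\<lambda>b. susp_sgn n m b * c b)"
    if "f \<in> fcls (DE n) (int m - int n) c" for f
    using that assms
    by (subst d.fcls_eq_iff) (auto simp: D.fcls_eq fin_series_susp_sgn norm_equal_susp_sgn
        norm_equal_def)
  moreover have "c \<in> fcls (DE n) (int m - int n) c"
    using assms by (simp add: D.fcls_eq norm_equal_def)
  moreover have "susp_iso n m (BE n) Y = (\<Union>f\<in>Y. fcls (dual (BE n)) (int m) (\<lambda>b. susp_sgn n m b * f b))"
    for Y :: "(simplex \<Rightarrow> 'f) set"
    by (simp add: susp_iso_def susp_sgn_def dual_def BE_def)
  ultimately show ?thesis by blast
qed

lemma bij_betw_susp_iso: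
  "bij_betw (susp_iso n m (BE n :: (simplex, 'f::field) dgop))
     (ffree (DE n) (int m - int n)) (ffree (dual (BE n)) (int m))"
proof -
  interpret d: signed_be "dual (BE n :: (simplex, 'f) dgop)" n "int m" "int m" by (rule signed_be_dual)
  interpret D: signed_be "DE n :: (simplex, 'f) dgop" n "int m - int n" "int m" by (rule signed_be_DE)
  have "inj_on (susp_iso n m (BE n :: (simplex, 'f) dgop)) (ffree (DE n) (int m - int n))"
  proof (rule inj_onI)
    fix Y Y' :: "(simplex \<Rightarrow> 'f) set"
    assume "Y \<in> ffree (DE n) (int m - int n)" "Y' \<in> ffree (DE n) (int m - int n)"
      and eq: "susp_iso n m (BE n) Y = susp_iso n m (BE n) Y'"
    then obtain c c' where c: "c \<in> fin_series (BE n)" "c' \<in> fin_series (BE n)"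
      "Y = fcls (DE n) (int m - int n) c" "Y' = fcls (DE n) (int m - int n) c'"
      by (auto simp: D.ffree_eq)
    then show "Y = Y'"
      using eq by (simp add: susp_iso_fcls D.fcls_eq_iff d.fcls_eq_iff fin_series_susp_sgn
          norm_equal_susp_sgn)
  qed
  moreover have "susp_iso n m (BE n :: (simplex, 'f) dgop) ` ffree (DE n) (int m - int n)
      = ffree (dual (BE n)) (int m)"
  proof
    show "ffree (dual (BE n :: (simplex, 'f) dgop)) (int m)
        \<subseteq> susp_iso n m (BE n) ` ffree (DE n) (int m - int n)"
    proof
      fix Y assume "Y \<in> ffree (dual (BE n :: (simplex, 'f) dgop)) (int m)"
      then obtain c where c: "c \<in> fin_series (BE n)" "Y = fcls (dual (BE n)) (int m) c"
        by (auto simp: d.ffree_eq)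
      let ?c = "\<lambda>b. susp_sgn n m b * c b"
      have "susp_iso n m (BE n) (fcls (DE n) (int m - int n) ?c) = Y"
        using c by (simp add: susp_iso_fcls fin_series_susp_sgn susp_sgn_square)
      then show "Y \<in> susp_iso n m (BE n) ` ffree (DE n) (int m - int n)"
        using c fin_series_susp_sgn by (force simp: D.ffree_eq)
    qed
  qed (auto simp: D.ffree_eq d.ffree_eq susp_iso_fcls fin_series_susp_sgn)
  ultimately show ?thesis by (simp add: bij_betw_def)
qed

section \<open>The norm isomorphism\<close>

definition pairing :: "int \<Rightarrow> (simplex \<Rightarrow> 'f::field) \<Rightarrow> (simplex \<Rightarrow> 'f) \<Rightarrow> 'f" where
  "pairing j c p = (\<Sum>b | c b \<noteq> 0. c b * symmetrize j p b)"

lemma pairing_add_right: "pairing j c (f + g) = pairing j c f + pairing j c g"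
  by (simp add: pairing_def symmetrize_add distrib_left sum.distrib)

lemma pairing_scale_right: "pairing j c (scale a f) = a * pairing j c f"
  unfolding pairing_def symmetrize_scale by (simp add: sum_distrib_left scale_def mult_ac)

lemma pairing_upto:
  assumes "{b. c b \<noteq> 0} \<subseteq> be_upto n N"
  shows "pairing j c p = (\<Sum>b\<in>be_upto n N. c b * symmetrize j p b)"
  unfolding pairing_def using assms by (intro sum.mono_neutral_left) auto

lemma pairing_upto':
  assumes "{b. c b \<noteq> 0} \<subseteq> be_upto n N"
  shows "pairing j c p = (\<Sum>b\<in>be_upto n N. symmetrize j c b * p b)"
  using pairing_upto[OF assms] sum_symmetrize_swap by simp

lemma be_upto_basis: "b \<in> be_upto n N \<Longrightarrow> b \<in> basis (BE n :: (simplex, 'f::field) dgop)"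
  by (auto simp: be_upto_def basis_BE)

lemma be_upto_mono: "N \<le> N' \<Longrightarrow> be_upto n N \<subseteq> be_upto n N'"
  unfolding be_upto_def by (intro UN_mono) auto

lemma in_be_upto:
  "b \<in> basis (BE n :: (simplex, 'f::field) dgop) \<Longrightarrow> b \<in> be_upto n (length (hd b))"
  by (auto simp: in_basis_BE be_upto_def)

lemma fin_series_upto:
  fixes c :: "simplex \<Rightarrow> 'f::field"
  assumes "c \<in> fin_series (BE n)"
  obtains N where "{b. c b \<noteq> 0} \<subseteq> be_upto n N"
  using signed_be.fin_series_upto[OF signed_be_BE[of n 0] assms] .

lemma pairing_cong_left:
  fixes c c' :: "simplex \<Rightarrow> 'f::field"
  assumes "c \<in> fin_series (BE n)" "c' \<in> fin_series (BE n)" "norm_equal n j c c'"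
  shows "pairing j c p = pairing j c' p"
proof -
  obtain N N' where N: "{b. c b \<noteq> 0} \<subseteq> be_upto n N" "{b. c' b \<noteq> 0} \<subseteq> be_upto n N'"
    using fin_series_upto[OF assms(1)] fin_series_upto[OF assms(2)] by metis
  have N': "{b. c b \<noteq> 0} \<subseteq> be_upto n (max N N')" "{b. c' b \<noteq> 0} \<subseteq> be_upto n (max N N')"
    using N be_upto_mono[of N "max N N'" n] be_upto_mono[of N' "max N N'" n] by auto
  show ?thesis unfolding pairing_upto'[OF N'(1)] pairing_upto'[OF N'(2)]
    using assms(3) by (intro sum.cong) (auto simp: norm_equal_def dest: be_upto_basis)
qed

lemma pairing_cong_right:
  fixes c p p' :: "simplex \<Rightarrow> 'f::field"
  assumes "c \<in> series (BE n)" "norm_equal n j p p'"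
  shows "pairing j c p = pairing j c p'"
  unfolding pairing_def using assms by (intro sum.cong) (auto simp: norm_equal_def series_def)

text \<open>Self-adjointness moves the norm to \<open>c\<close>, so testing on single simplices
  recovers the norm of \<open>c\<close>. This is the nondegeneracy of the pairing on classes of
  finite series.\<close>

lemma pairing_indicator:
  fixes c :: "simplex \<Rightarrow> 'f::field"
  assumes "c \<in> fin_series (BE n)" "b \<in> basis (BE n :: (simplex, 'f) dgop)"
  shows "pairing j c (\<lambda>b'. of_bool (b' = b)) = symmetrize j c b"
proof -
  obtain N where N: "{b. c b \<noteq> 0} \<subseteq> be_upto n N" using fin_series_upto[OF assms(1)] .
  have N': "{b. c b \<noteq> 0} \<subseteq> be_upto n (max N (length (hd b)))" "b \<in> be_upto n (max N (length (hd b)))"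
    using N in_be_upto[OF assms(2)] be_upto_mono[of N "max N (length (hd b))" n]
      be_upto_mono[of "length (hd b)" "max N (length (hd b))" n] by auto
  show ?thesis unfolding pairing_upto'[OF N'(1)] using N'(2) by simp
qed

lemma norm_equalI_pairing:
  fixes c c' :: "simplex \<Rightarrow> 'f::field"
  assumes "c \<in> fin_series (BE n)" "c' \<in> fin_series (BE n)"
    and "\<And>p. p \<in> series (BE n) \<Longrightarrow> pairing j c p = pairing j c' p"
  shows "norm_equal n j c c'"
  unfolding norm_equal_def
proof
  fix b assume b: "b \<in> basis (BE n :: (simplex, 'f) dgop)"
  then have "(\<lambda>b'. of_bool (b' = b) :: 'f) \<in> series (BE n)" by (auto simp: series_def)
  then show "symmetrize j c b = symmetrize j c' b"
    using assms(3) pairing_indicator[OF assms(1) b] pairing_indicator[OF assms(2) b] by metis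
qed

lemma norm_equalI_pairing_right:
  fixes p p' :: "simplex \<Rightarrow> 'f::field"
  assumes "\<And>c. c \<in> fin_series (BE n) \<Longrightarrow> pairing j c p = pairing j c p'"
  shows "norm_equal n j p p'"
  unfolding norm_equal_def
proof
  fix b assume b: "b \<in> basis (BE n :: (simplex, 'f) dgop)"
  let ?c = "\<lambda>b'. of_bool (b' = b) :: 'f"
  have "?c \<in> fin_series (BE n)" using b by (auto simp: series_def fin_series_def)
  then have "pairing j ?c p = pairing j ?c p'" by (rule assms)
  then show "symmetrize j p b = symmetrize j p' b" by (simp add: pairing_def)
qed

lemma norm_pairing_eq:
  fixes c p :: "simplex \<Rightarrow> 'f::field"
  assumes "c \<in> series (BE n)" "p \<in> series (BE n)"
  shows "norm_pairing (BE n) (- int m) c p = pairing (int m) c p"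
proof -
  interpret E: signed_be "BE n :: (simplex, 'f) dgop" n "- int m" "int m" by (rule signed_be_BE)
  show ?thesis
    unfolding norm_pairing_def pairing_def
    by (rule sum.cong) (use assms E.sum_tact in \<open>auto simp: series_def ar_BE\<close>)
qed

text \<open>\<open>norm_iso\<close> extracts the element of the set of values over all
  representatives; the set is a singleton because the pairing depends on each argument only through
  its norm.\<close>

lemma norm_iso_eq:
  fixes c p :: "simplex \<Rightarrow> 'f::field"
  assumes "c \<in> fin_series (BE n)" "p \<in> series (BE n)"
  shows "norm_iso (BE n) (- int m) (fcls (dual (BE n)) (int m) c) (ccls (BE n) (- int m) p)
           = pairing (int m) c p"
proof -
  interpret E: signed_be "BE n :: (simplex, 'f) dgop" n "- int m" "int m" by (rule signed_be_BE)
  interpret d: signed_be "dual (BE n :: (simplex, 'f) dgop)" n "int m" "int m" by (rule signed_be_dual)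
  have "norm_pairing (BE n) (- int m) c' p' = pairing (int m) c p"
    if "c' \<in> fcls (dual (BE n)) (int m) c" "p' \<in> ccls (BE n) (- int m) p" for c' p'
  proof -
    have h: "c' \<in> fin_series (BE n)" "norm_equal n (int m) c c'"
      "p' \<in> series (BE n)" "norm_equal n (int m) p p'"
      using that assms by (auto simp: d.fcls_eq E.ccls_eq)
    then have "norm_pairing (BE n) (- int m) c' p' = pairing (int m) c' p'"
      by (intro norm_pairing_eq) (auto intro: fin_seriesD)
    also have "\<dots> = pairing (int m) c p'" using pairing_cong_left[OF assms(1) h(1,2)] by simp
    also have "\<dots> = pairing (int m) c p"
      using pairing_cong_right[OF fin_seriesD[OF assms(1)] h(4)] by simp
    finally show ?thesis .
  qed
  moreover have "c \<in> fcls (dual (BE n)) (int m) c" "p \<in> ccls (BE n) (- int m) p"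
    using assms by (auto simp: d.fcls_eq E.ccls_eq norm_equal_def)
  ultimately have "(\<Union>c'\<in>fcls (dual (BE n)) (int m) c. norm_pairing (BE n) (- int m) c' ` ccls (BE n)
      (- int m) p)
      = {pairing (int m) c p}" by (auto simp: image_iff)
  then show ?thesis using assms(2) by (simp add: norm_iso_def E.cfree_eq)
qed

lemma ext_norm_isoI:
  fixes u :: "(simplex \<Rightarrow> 'f::field) set \<Rightarrow> 'f"
  assumes "u \<in> extensional (cfree (BE n) (- int m))" "c \<in> fin_series (BE n)"
    and "\<And>p. p \<in> series (BE n) \<Longrightarrow> u (ccls (BE n) (- int m) p) = pairing (int m) c p"
  shows "norm_iso (BE n) (- int m) (fcls (dual (BE n)) (int m) c) = u"
proof (rule extensionalityI[of _ "cfree (BE n) (- int m)"])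
  interpret E: signed_be "BE n :: (simplex, 'f) dgop" n "- int m" "int m" by (rule signed_be_BE)
  fix X :: "(simplex \<Rightarrow> 'f) set" assume "X \<in> cfree (BE n) (- int m)"
  then obtain p where "p \<in> series (BE n)" "X = ccls (BE n) (- int m) p" by (auto simp: E.cfree_eq)
  then show "norm_iso (BE n) (- int m) (fcls (dual (BE n)) (int m) c) X = u X"
    using norm_iso_eq[OF assms(2)] assms(3) by simp
qed (use assms(1) in \<open>auto simp: norm_iso_def\<close>)

lemma series_add: "f \<in> series P \<Longrightarrow> g \<in> series P \<Longrightarrow> f + g \<in> series P"
  and series_scale: "f \<in> series P \<Longrightarrow> scale a f \<in> series P"
  by (simp_all add: series_def scale_def)

lemma norm_iso_in_cdual:
  fixes c :: "simplex \<Rightarrow> 'f::field"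
  assumes c: "c \<in> fin_series (BE n)"
  shows "norm_iso (BE n) (- int m) (fcls (dual (BE n)) (int m) c) \<in> cdual (BE n) (- int m)"
proof -
  obtain N where N: "{b. c b \<noteq> 0} \<subseteq> be_upto n N" using fin_series_upto[OF c] .
  have "pairing (int m) c f = 0"
    if f: "\<And>b. length (hd b) \<le> N \<Longrightarrow> f b = 0" for f :: "simplex \<Rightarrow> 'f"
  proof -
    have "symmetrize (int m) f b = 0" if "b \<in> be_upto n N" for b
    proof -
      have "length (hd b) \<le> N" "b \<noteq> []"
        using that by (auto simp: be_upto_def length_hd_be_simplices be_simplices_alt)
      then show ?thesis using f by (simp add: symmetrize_def hd_map)
    qed
    then show ?thesis by (simp add: pairing_upto[OF N])
  qed
  then have "\<forall>f\<in>series (BE n). (\<forall>b. ar (BE n :: (simplex, 'f) dgop) b \<le> N \<longrightarrow> f b = 0) \<longrightarrow>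
      norm_iso (BE n) (- int m) (fcls (dual (BE n)) (int m) c) (ccls (BE n) (- int m) f) = 0"
    by (simp add: norm_iso_eq[OF c] ar_BE)
  moreover have "norm_iso (BE n) (- int m) (fcls (dual (BE n)) (int m) c)
      \<in> extensional (cfree (BE n) (- int m))" by (simp add: norm_iso_def)
  ultimately show ?thesis
    unfolding cdual_def mem_Collect_eq
    by (intro conjI ballI allI exI[of _ N])
      (simp_all add: norm_iso_eq[OF c] series_add series_scale pairing_add_right pairing_scale_right)
qed

text \<open>A preimage is found without division: the values of \<open>u\<close> are placed on the
  representatives of the orbits that start at the identity, and the norm spreads them over the
  orbits. The bound on arities in \<open>cdual\<close> makes this function finitely
  supported.\<close>

lemma cdual_in_norm_iso:
  fixes u :: "(simplex \<Rightarrow> 'f::field) set \<Rightarrow> 'f"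
  assumes u: "u \<in> cdual (BE n) (- int m)"
  shows "\<exists>c\<in>fin_series (BE n). norm_iso (BE n) (- int m) (fcls (dual (BE n)) (int m) c) = u"
proof -
  interpret E: signed_be "BE n :: (simplex, 'f) dgop" n "- int m" "int m" by (rule signed_be_BE)
  let ?cls = "ccls (BE n :: (simplex, 'f) dgop) (- int m)"
  obtain N where N: "\<And>f. f \<in> series (BE n) \<Longrightarrow> (\<And>b. length (hd b) \<le> N \<Longrightarrow> f b = 0) \<Longrightarrow> u (?cls f) = 0"
    using u unfolding cdual_def ar_BE mem_Collect_eq by meson
  have add: "u (?cls (f + g)) = u (?cls f) + u (?cls g)" if "f \<in> series (BE n)" "g \<in> series (BE n)"
      for f g
    using u that by (simp add: cdual_def)
  have scale: "u (?cls (scale a f)) = a * u (?cls f)" if "f \<in> series (BE n)" for a f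
    using u that by (simp add: cdual_def)
  have zero: "u (?cls (\<lambda>b. 0)) = 0" by (rule N) (simp_all add: series_def)
  define e :: "simplex \<Rightarrow> simplex \<Rightarrow> 'f" where "e b = (\<lambda>b'. of_bool (b' = b))" for b
  have e: "e b \<in> series (BE n)" if "b \<in> basis (BE n :: (simplex, 'f) dgop)" for b
    using that by (auto simp: e_def series_def)
  define c where "c b = (if b \<in> be_upto n N \<and> hd b
      = [1..<length (hd b) + 1] then u (?cls (e b)) else 0)" for b
  have supp: "{b. c b \<noteq> 0} \<subseteq> be_upto n N" by (auto simp: c_def)
  have c: "c \<in> fin_series (BE n)"
    using finite_subset[OF supp] supp be_upto_basis by (fastforce simp: fin_series_def series_def)
  have norm: "symmetrize (int m) c b = u (?cls (e b))" if b: "b \<in> be_upto n N" for b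
  proof -
    let ?r = "length (hd b)"
    have b': "b \<in> be_simplices n ?r" "1 \<le> ?r" "?r \<le> N" "b \<noteq> []"
      using b by (auto simp: be_upto_def length_hd_be_simplices be_simplices_alt)
    have hdb: "hd b \<in> permutations_of_set {1..?r}" using b' by (auto simp: be_simplices_alt)
    define w where "w = perm_of (hd b)"
    have w: "w permutes {1..?r}" unfolding w_def by (rule perm_of_permutes[OF hdb])
    let ?b0 = "map (map (inv w)) b"
    have b0: "?b0 \<in> be_upto n N" "?b0 \<in> basis (BE n :: (simplex, 'f) dgop)"
      using permutes_map_map[OF permutes_inv[OF w] b'(1)] b' by (auto simp: be_upto_def basis_BE)
    have "map (map v) b \<in> be_upto n N" if "v permutes {1..?r}" for v
      using permutes_map_map[OF that b'(1)] b' by (auto simp: be_upto_def)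
    moreover have "map v (hd b) = [1..<?r + 1] \<longleftrightarrow> v = inv w" if v: "v permutes {1..?r}" for v
      using map_inv_eq_upt_iff[OF hdb permutes_inv[OF v]] permutes_inv_inv[OF v] permutes_inv_inv[OF w]
      by (metis w_def)
    ultimately have "symmetrize (int m) c b
        = (\<Sum>v | v permutes {1..?r}. if v = inv w then sgnpow (int m) v * u (?cls (e ?b0)) else 0)"
      unfolding symmetrize_def using b'(4)
      by (intro sum.cong) (auto simp: c_def hd_map simp del: upt_Suc)
    also have "\<dots> = sgnpow (int m) w * u (?cls (e ?b0))"
      using permutes_inv[OF w] by (simp add: finite_permutations sgnpow_inv[OF w])
    also have "\<dots> = u (?cls (scale (sgnpow (int m) w) (e ?b0)))" by (simp add: scale e b0)
    \<comment> \<open>Basis elements of one orbit agree up to sign in the coinvariants; this is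
      verified by pairing both sides with all finite series.\<close>
    also have "?cls (scale (sgnpow (int m) w) (e ?b0)) = ?cls (e b)"
    proof (subst E.ccls_eq_iff)
      have "pairing (int m) c' (scale (sgnpow (int m) w) (e ?b0)) = pairing (int m) c' (e b)"
        if c': "c' \<in> fin_series (BE n)" for c'
      proof -
        have "pairing (int m) c' (scale (sgnpow (int m) w) (e ?b0))
            = sgnpow (int m) w * pairing (int m) c' (e ?b0)"
          by (rule pairing_scale_right)
        also have "\<dots> = sgnpow (int m) w * symmetrize (int m) c' ?b0"
          unfolding e_def by (simp only: pairing_indicator[OF c' b0(2)])
        also have "\<dots> = symmetrize (int m) c' b"
          by (simp only: symmetrize_map_map[OF permutes_inv[OF w] b'(4)] sgnpow_inv[OF w
              finite_atLeastAtMost]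
              sgnpow_square)
        also have "\<dots> = pairing (int m) c' (e b)"
          unfolding e_def by (simp only: pairing_indicator[OF c' be_upto_basis[OF b]])
        finally show ?thesis .
      qed
      then show "norm_equal n (int m) (scale (sgnpow (int m) w) (e ?b0)) (e b)"
        by (rule norm_equalI_pairing_right)
    qed (use e b0 be_upto_basis[OF b] in \<open>auto intro: series_scale\<close>)
    finally show ?thesis .
  qed
  have "u (?cls p) = pairing (int m) c p" if p: "p \<in> series (BE n)" for p
  proof -
    \<comment> \<open>The form \<open>u\<close> respects finite sums only. The part of
      \<open>p\<close> in arities beyond \<open>N\<close> may be infinite, but \<open>u\<close>
      kills it, and what remains is a finite combination of basis elements.\<close>
    define q where "q = (\<lambda>b. if length (hd b) \<le> N then 0 else p b)"
    have q: "q \<in> series (BE n)" "u (?cls q) = 0"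
      using p by (auto simp: q_def series_def intro!: N)
    have sum: "(\<Sum>b\<in>B. scale (p b) (e b)) \<in> series (BE n) \<and>
        u (?cls (\<Sum>b\<in>B. scale (p b) (e b))) = (\<Sum>b\<in>B. p b * u (?cls (e b)))"
      if "B \<subseteq> be_upto n N" for B
      using finite_subset[OF that finite_be_upto] that
    proof (induction B rule: finite_induct)
      case empty
      then show ?case using zero by (simp add: series_def zero_fun_def)
    next
      case (insert b B)
      then have b: "e b \<in> series (BE n)" using e[OF be_upto_basis, of b N] by simp
      note S = insert.IH[OF subset_trans[OF subset_insertI insert.prems]]
      have "u (?cls (scale (p b) (e b) + (\<Sum>b\<in>B. scale (p b) (e b))))
          = p b * u (?cls (e b)) + (\<Sum>b\<in>B. p b * u (?cls (e b)))"
        using add[OF series_scale[OF b] conjunct1[OF S]] scale[OF b] conjunct2[OF S] by metis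
      then show ?case
        unfolding sum.insert[OF insert.hyps] using series_add[OF series_scale[OF b] conjunct1[OF S]]
        by blast
    qed
    have "p = q + (\<Sum>b\<in>be_upto n N. scale (p b) (e b))"
    proof
      fix b
      have "(\<Sum>b'\<in>be_upto n N. scale (p b') (e b')) b = (if b \<in> be_upto n N then p b else 0)"
        by (simp add: sum_fun_apply scale_def e_def)
      moreover have "p b = 0" if "b \<notin> be_upto n N" "length (hd b) \<le> N"
        using that p by (auto simp: series_def in_basis_BE be_upto_def)
      moreover have "length (hd b) \<le> N" if "b \<in> be_upto n N"
        using that by (auto simp: be_upto_def length_hd_be_simplices)
      ultimately show "p b = (q + (\<Sum>b\<in>be_upto n N. scale (p b) (e b))) b"
        by (auto simp: q_def)
    qed
    then have "u (?cls p) = u (?cls (q + (\<Sum>b\<in>be_upto n N. scale (p b) (e b))))"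
      by (rule arg_cong)
    also have "\<dots> = (\<Sum>b\<in>be_upto n N. p b * u (?cls (e b)))"
      using add[OF q(1) conjunct1[OF sum[OF order.refl]]] conjunct2[OF sum[OF order.refl]] q(2)
      by (simp only: add_0_left)
    also have "\<dots> = (\<Sum>b\<in>be_upto n N. symmetrize (int m) c b * p b)"
      by (rule sum.cong) (simp_all add: norm)
    also have "\<dots> = pairing (int m) c p" by (rule pairing_upto'[OF supp, symmetric])
    finally show ?thesis .
  qed
  moreover have "u \<in> extensional (cfree (BE n) (- int m))" using u by (simp add: cdual_def)
  ultimately show ?thesis using c ext_norm_isoI by blast
qed

lemma bij_betw_norm_iso:
  "bij_betw (norm_iso (BE n :: (simplex, 'f::field) dgop) (- int m))
     (ffree (dual (BE n)) (int m)) (cdual (BE n) (- int m))"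
proof -
  interpret d: signed_be "dual (BE n :: (simplex, 'f) dgop)" n "int m" "int m" by (rule signed_be_dual)
  have "inj_on (norm_iso (BE n :: (simplex, 'f) dgop) (- int m)) (ffree (dual (BE n)) (int m))"
  proof (rule inj_onI)
    fix Y Y' :: "(simplex \<Rightarrow> 'f) set"
    assume "Y \<in> ffree (dual (BE n)) (int m)" "Y' \<in> ffree (dual (BE n)) (int m)"
      and eq: "norm_iso (BE n) (- int m) Y = norm_iso (BE n) (- int m) Y'"
    then obtain c c' where c: "c \<in> fin_series (BE n)" "c' \<in> fin_series (BE n)"
      "Y = fcls (dual (BE n)) (int m) c" "Y' = fcls (dual (BE n)) (int m) c'"
      by (auto simp: d.ffree_eq)
    have "norm_equal n (int m) c c'"
    proof (rule norm_equalI_pairing[OF c(1,2)])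
      fix p :: "simplex \<Rightarrow> 'f" assume "p \<in> series (BE n)"
      then show "pairing (int m) c p = pairing (int m) c' p"
        using norm_iso_eq[OF c(1)] norm_iso_eq[OF c(2)] eq c(3,4) by metis
    qed
    then show "Y = Y'" using c by (simp add: d.fcls_eq_iff)
  qed
  moreover have "norm_iso (BE n :: (simplex, 'f) dgop) (- int m) ` ffree (dual (BE n)) (int m)
      = cdual (BE n) (- int m)"
  proof
    show "cdual (BE n :: (simplex, 'f) dgop) (- int m)
        \<subseteq> norm_iso (BE n) (- int m) ` ffree (dual (BE n)) (int m)"
      using cdual_in_norm_iso by (fastforce simp: d.ffree_eq)
  qed (auto simp: d.ffree_eq intro: norm_iso_in_cdual)
  ultimately show ?thesis by (simp add: bij_betw_def)
qed

section \<open>Composition of series\<close>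

text \<open>A nonzero coefficient makes \<open>c\<close> a shuffle path, which has as many steps as
  both factors together. The sign comparison needs this, since the dimension of \<open>c\<close>
  enters the sign of the suspension isomorphism.\<close>

lemma pcm_BE_nonzero:
  assumes "pcm (BE n :: (simplex, 'f::field) dgop) i a b c \<noteq> 0"
    and "a \<in> be_simplices n r" "b \<in> be_simplices n s" "1 \<le> s"
  shows "c \<in> be_simplices n (r + s - 1) \<and> int (length c) = int (length a) + int (length b) - 1"
proof -
  have r: "length (hd a) = r" using assms(2) by (rule length_hd_be_simplices)
  have i: "1 \<le> i" "i \<le> r" using assms(1) r by (auto simp: BE_def split: if_splits)
  have "\<exists>\<sigma>\<in>shuffles (replicate (length a - 1) True) (replicate (length b - 1) False).
      c = ez_path i a b \<sigma>"
  proof (rule ccontr)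
    assume "\<not> ?thesis"
    then have "pcm (BE n :: (simplex, 'f) dgop) i a b c = 0"
      by (auto simp: BE_def intro!: sum.neutral)
    then show False using assms(1) by simp
  qed
  then obtain \<sigma> where \<sigma>: "\<sigma> \<in> shuffles (replicate (length a - 1) True) (replicate (length b - 1) False)"
    "c = ez_path i a b \<sigma>" by blast
  have "0 < length a" "0 < length b" using assms(2,3) by (auto simp: be_simplices_alt)
  then have "int (length a - 1 + (length b - 1) + 1) = int (length a) + int (length b) - 1" by linarith
  then show ?thesis
    using ez_path_in_be_simplices[OF assms(2-4) i \<sigma>(1)] \<sigma>(2) count_list_shuffles(3)[OF \<sigma>(1)]
    by (simp only: length_ez_path simp_thms)
qed

lemma series_comp_in_series:
  "series_comp (BE n) k f g \<in> series (BE n :: (simplex, 'f::field) dgop)"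
proof -
  have "series_comp (BE n) k f g c = 0" if c: "c \<notin> basis (BE n :: (simplex, 'f) dgop)" for c
  proof -
    have "pcm (BE n :: (simplex, 'f) dgop) i a b c = 0"
      if "a \<in> basis (BE n :: (simplex, 'f) dgop)" "b \<in> basis (BE n :: (simplex, 'f) dgop)" for a b i
    proof (rule ccontr)
      assume h: "pcm (BE n :: (simplex, 'f) dgop) i a b c \<noteq> 0"
      have "c \<in> be_simplices n (length (hd a) + length (hd b) - 1)"
        using pcm_BE_nonzero[OF h] that by (simp add: in_basis_BE)
      moreover have "1 \<le> length (hd a)" "1 \<le> length (hd b)" using that by (simp_all add: in_basis_BE)
      then have "1 \<le> length (hd a) + length (hd b) - 1" by linarith
      ultimately show False using c unfolding basis_BE by blast
    qed
    then show ?thesis unfolding series_comp_def by (auto intro!: sum.neutral)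
  qed
  then show ?thesis by (simp add: series_def)
qed

lemma disjoint_be_simplices: "r \<noteq> r' \<Longrightarrow> be_simplices n r \<inter> be_simplices n r' = {}"
  using length_hd_be_simplices by blast

lemma sum_be_upto:
  "(\<Sum>a\<in>be_upto n t. F a) = (\<Sum>r=1..t. \<Sum>a\<in>be_simplices n r. F a :: 'f::field)"
  unfolding be_upto_def
  by (rule sum.UNION_disjoint) (use disjoint_be_simplices in \<open>auto simp: finite_be_simplices\<close>)

definition comp_exp :: "nat \<Rightarrow> simplex \<Rightarrow> simplex \<Rightarrow> nat \<Rightarrow> int" where
  "comp_exp m a b i = (int (length b) - 1 + int (length (hd b)) * (- int m) + int m)
       * (int (length a) - 1 + (int i - 1) * (- int m))
     + (int (length b) - 1) * ((int i - 1) * (- int m))"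

lemma series_comp_eq:
  fixes f g :: "simplex \<Rightarrow> 'f::field"
  assumes "length (hd c) = t"
  shows "series_comp (BE n) (- int m) f g c
    = (\<Sum>r=1..t. \<Sum>a\<in>be_simplices n r. \<Sum>b\<in>be_simplices n (t + 1 - r). \<Sum>i=1..r.
         ksgn (comp_exp m a b i) * f a * g b * pcm (BE n) i a b c)"
proof -
  let ?F = "\<lambda>a b. \<Sum>i=1..length (hd a). ksgn (comp_exp m a b i) * f a * g b * pcm (BE n) i a b c"
  let ?X = "\<Union>r\<in>{1..t}. be_simplices n r \<times> be_simplices n (t + 1 - r)"
  have X: "{(a, b). a \<in> basis (BE n :: (simplex, 'f) dgop) \<and> b \<in> basis (BE n :: (simplex, 'f) dgop) \<and>
      ar (BE n :: (simplex, 'f) dgop) a + ar (BE n :: (simplex, 'f) dgop) b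
        = ar (BE n :: (simplex, 'f) dgop) c + 1} = ?X" (is "?Y = _")
  proof
    show "?Y \<subseteq> ?X"
    proof (clarsimp simp: ar_BE assms in_basis_BE)
      fix a b assume h: "a \<in> be_simplices n (length (hd a))" "b \<in> be_simplices n (length (hd b))"
        "Suc 0 \<le> length (hd a)" "Suc 0 \<le> length (hd b)" "length (hd a) + length (hd b) = Suc t"
      then have "Suc t - length (hd a) = length (hd b)" by simp
      then show "\<exists>x\<in>{Suc 0..t}. a \<in> be_simplices n x \<and> b \<in> be_simplices n (Suc t - x)"
        using h by (intro bexI[of _ "length (hd a)"]) auto
    qed
    show "?X \<subseteq> ?Y" by (auto simp: ar_BE assms in_basis_BE length_hd_be_simplices)
  qed
  have "series_comp (BE n) (- int m) f g c = (\<Sum>(a, b)\<in>?X. ?F a b)"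
    unfolding series_comp_def X by (simp add: comp_exp_def BE_def)
  also have "\<dots> = (\<Sum>r=1..t. \<Sum>(a, b)\<in>be_simplices n r \<times> be_simplices n (t + 1 - r). ?F a b)"
    by (rule sum.UNION_disjoint)
      (use disjoint_be_simplices[of _ _ n] in \<open>auto simp: finite_be_simplices\<close>)
  also have "\<dots> = (\<Sum>r=1..t. \<Sum>a\<in>be_simplices n r. \<Sum>b\<in>be_simplices n (t + 1 - r). ?F a b)"
    by (intro sum.cong refl, rule sum.cartesian_product[symmetric])
  also have "\<dots> = (\<Sum>r=1..t. \<Sum>a\<in>be_simplices n r. \<Sum>b\<in>be_simplices n (t + 1 - r). \<Sum>i=1..r.
         ksgn (comp_exp m a b i) * f a * g b * pcm (BE n) i a b c)"
    by (intro sum.cong refl) (simp_all add: length_hd_be_simplices)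
  finally show ?thesis .
qed

text \<open>Modulo 2 the exponent in \<open>sign_block_perm\<close> is
  \<open>(s - 1) * (i + u i)\<close>. It is split between the two sides so that one side involves
  only the total permutation and the place \<open>u i\<close>, the other only \<open>u\<close>,
  \<open>v\<close> and \<open>i\<close>.\<close>

lemma sgnpow_block_perm:
  assumes "1 \<le> s" "1 \<le> i" "i \<le> r" "u permutes {1..r}" "v permutes {1..s}"
  shows "sgnpow k (block_perm r s i u v) * ksgn (k * (int s - 1) * int (u i))
           = (sgnpow k u * sgnpow k v * ksgn (k * (int s - 1) * int i) :: 'f::field)"
proof (cases "even k")
  case True
  then show ?thesis by (simp add: sgnpow_def ksgn_def)
next
  case False
  have ui: "u i \<le> r" using permutes_in_image[OF assms(4), of i] assms by simp
  have "even (s - 1) \<longleftrightarrow> odd s" using assms(1) by (cases s) auto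
  moreover have "even (r - i) \<longleftrightarrow> (even r \<longleftrightarrow> even i)" "even (r - u i) \<longleftrightarrow> (even r \<longleftrightarrow> even (u i))"
    using assms(3) ui by auto
  ultimately have "((- 1) ^ ((s - 1) * (r - i) + (s - 1) * (r - u i)) :: 'f)
      * ksgn (k * (int s - 1) * int (u i)) = ksgn (k * (int s - 1) * int i)"
    using False by (auto simp: ksgn_def uminus_power_if)
  then show ?thesis using False sign_block_perm[OF assms] by (simp add: sgnpow_def mult.assoc)
qed

lemma sum_be_simplices_permutes:
  assumes "u permutes {1..r}"
  shows "(\<Sum>a\<in>be_simplices n r. F (map (map u) a)) = (\<Sum>a\<in>be_simplices n r. F a)"
  by (rule sum.reindex_bij_witness[of _ "map (map (inv u))" "map (map u)"])
    (use assms map_map_inv[OF assms] permutes_map_map[OF assms] permutes_map_map[OF permutes_inv[OF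
        assms]]
     in \<open>auto simp del: map_map\<close>)

lemma sum_triple:
  "(\<Sum>(x, y, z)\<in>A \<times> B \<times> C. F x y z) = (\<Sum>x\<in>A. \<Sum>y\<in>B. \<Sum>z\<in>C. F x y z)"
  by (simp add: sum.cartesian_product)

text \<open>The factors \<open>ksgn (k * (s - 1) * j)\<close> occur because moving a block of \<open>s\<close> inputs from the
  place \<open>i\<close> to the place \<open>j\<close> of the other factor contributes \<open>(s - 1)(i - j)\<close> to the signature.\<close>

lemma symmetrize_comp:
  fixes H :: "simplex \<Rightarrow> simplex \<Rightarrow> 'f::field"
  assumes rs: "1 \<le> r" "1 \<le> s" and t: "t = r + s - 1" and c: "c \<in> be_simplices n t"
  shows "(\<Sum>w | w permutes {1..t}. \<Sum>j=1..r. sgnpow k w * ksgn (k * (int s - 1) * int j) *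
            (\<Sum>a\<in>be_simplices n r. \<Sum>b\<in>be_simplices n s. H a b * pcm (BE n) j a b (map (map w) c)))
    = (\<Sum>S | S \<subseteq> {1..t} \<and> card S = s.
         sgnpow k (perm_of (block_word t S)) * ksgn (k * (int s - 1) * int (Min S)) *
         (\<Sum>a\<in>be_simplices n r. \<Sum>b\<in>be_simplices n s.
            (\<Sum>u | u permutes {1..r}. \<Sum>v | v permutes {1..s}.
               sgnpow k u * sgnpow k v * H (map (map u) a) (map (map v) b))
            * pcm (BE n) (Min S) a b (map (map (inv (perm_of (block_word t S)))) c)))"
    (is "?L = ?R")
proof -
  define F where "F w j = sgnpow k w * ksgn (k * (int s - 1) * int j) *
            (\<Sum>a\<in>be_simplices n r. \<Sum>b\<in>be_simplices n s. H a b * pcm (BE n) j a b (map (map w) c))"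
    for w j
  let ?P = "\<lambda>S. perm_of (block_word t S)"
  let ?A = "{S. S \<subseteq> {1..t} \<and> card S = s} \<times> {u. u permutes {1..r}} \<times> {v. v permutes {1..s}}"
  have summand: "F (block_perm r s (Min S) u v \<circ> inv (?P S)) (u (Min S))
      = sgnpow k (?P S) * ksgn (k * (int s - 1) * int (Min S)) *
         (\<Sum>a\<in>be_simplices n r. \<Sum>b\<in>be_simplices n s.
             sgnpow k u * sgnpow k v * H (map (map u) a) (map (map v) b)
            * pcm (BE n) (Min S) a b (map (map (inv (?P S))) c))"
    if h: "S \<subseteq> {1..t}" "card S = s" "u permutes {1..r}" "v permutes {1..s}" for S u v
  proof -
    have ne: "S \<noteq> {}" using h rs by auto
    have i: "1 \<le> Min S" "Min S \<le> r" using Min_add_card_le[OF h(1) ne] h(2) t rs by auto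
    have P: "?P S permutes {1..t}" by (intro perm_of_permutes block_word_in_permutations h ne)
    let ?B = "block_perm r s (Min S) u v"
    have B: "?B permutes {1..t}" unfolding t by (rule block_perm_permutes[OF rs(2) i h(3,4)])
    \<comment> \<open>Replacing \<open>a\<close> and \<open>b\<close> by their translates under
      \<open>u\<close> and \<open>v\<close> allows equivariance to remove the block permutation from
      the structure constant.\<close>
    have "(\<Sum>a\<in>be_simplices n r. \<Sum>b\<in>be_simplices n s.
          H a b * pcm (BE n) (u (Min S)) a b (map (map (?B \<circ> inv (?P S))) c))
      = (\<Sum>a\<in>be_simplices n r. \<Sum>b\<in>be_simplices n s. H (map (map u) a) (map (map v) b) *
          pcm (BE n) (u (Min S)) (map (map u) a) (map (map v) b) (map (map (?B \<circ> inv (?P S))) c))"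
      by (simp only: sum_be_simplices_permutes[OF h(4), where F = "\<lambda>b. H _ b * pcm (BE n) _ _ b _"]
        sum_be_simplices_permutes[OF h(3), where F
            = "\<lambda>a. \<Sum>b\<in>be_simplices n s. H a b * pcm (BE n) _ a b _"])
    also have "\<dots> = (\<Sum>a\<in>be_simplices n r. \<Sum>b\<in>be_simplices n s. H (map (map u) a) (map (map v) b) *
          pcm (BE n) (Min S) a b (map (map (inv (?P S))) c))"
    proof (intro sum.cong refl arg_cong2[where f = times])
      fix a b assume "a \<in> be_simplices n r" "b \<in> be_simplices n s"
      from pcm_block_perm[OF rs(2) i h(3,4) this, of "map (map (inv (?P S))) c", where ?'f = 'f]
      show "pcm (BE n :: (simplex, 'f) dgop) (u (Min S)) (map (map u) a) (map (map v) b) (map (map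
          (?B \<circ> inv (?P S))) c)
          = pcm (BE n) (Min S) a b (map (map (inv (?P S))) c)" by simp
    qed
    finally have sum: "(\<Sum>a\<in>be_simplices n r. \<Sum>b\<in>be_simplices n s.
          H a b * pcm (BE n) (u (Min S)) a b (map (map (?B \<circ> inv (?P S))) c))
      = (\<Sum>a\<in>be_simplices n r. \<Sum>b\<in>be_simplices n s. H (map (map u) a) (map (map v) b) *
          pcm (BE n) (Min S) a b (map (map (inv (?P S))) c))" .
    have "sgnpow k (?B \<circ> inv (?P S)) * ksgn (k * (int s - 1) * int (u (Min S)))
        = sgnpow k (?P S) * (sgnpow k ?B * ksgn (k * (int s - 1) * int (u (Min S))) :: 'f)"
      by (simp add: sgnpow_compose[OF B permutes_inv[OF P]] sgnpow_inv[OF P] mult_ac)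
    also have "\<dots> = sgnpow k (?P S) * ksgn (k * (int s - 1) * int (Min S)) * (sgnpow k u * sgnpow k v)"
      unfolding sgnpow_block_perm[OF rs(2) i h(3,4)] by (simp add: mult_ac)
    finally have "sgnpow k (?B \<circ> inv (?P S)) * ksgn (k * (int s - 1) * int (u (Min S)))
        = sgnpow k (?P S) * ksgn (k * (int s - 1) * int (Min S)) * (sgnpow k u * sgnpow k v :: 'f)" .
    then show ?thesis unfolding F_def sum by (simp add: sum_distrib_left mult.assoc)
  qed
  have "?L = (\<Sum>w | w permutes {1..t}. \<Sum>j=1..r. F w j)" by (simp only: F_def)
  also have "\<dots> = (\<Sum>(w, j)\<in>{w. w permutes {1..t}} \<times> {1..r}. F w j)"
    by (rule sum.cartesian_product)
  also have "\<dots> = (\<Sum>z\<in>?A. (\<lambda>(w, j). F w j)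
      ((\<lambda>(S, u, v). (block_perm r s (Min S) u v \<circ> inv (?P S), u (Min S))) z))"
    using bij_betw_block_perm[OF rs] unfolding t by (rule sum.reindex_bij_betw[symmetric])
  also have "\<dots> = (\<Sum>(S, u, v)\<in>?A. sgnpow k (?P S) * ksgn (k * (int s - 1) * int (Min S)) *
         (\<Sum>a\<in>be_simplices n r. \<Sum>b\<in>be_simplices n s.
             sgnpow k u * sgnpow k v * H (map (map u) a) (map (map v) b)
            * pcm (BE n) (Min S) a b (map (map (inv (?P S))) c)))"
    by (rule sum.cong) (use summand in auto)
  also have "\<dots> = (\<Sum>S | S \<subseteq> {1..t} \<and> card S = s. \<Sum>u | u permutes {1..r}. \<Sum>v | v permutes {1..s}.
         sgnpow k (?P S) * ksgn (k * (int s - 1) * int (Min S)) *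
         (\<Sum>a\<in>be_simplices n r. \<Sum>b\<in>be_simplices n s.
             sgnpow k u * sgnpow k v * H (map (map u) a) (map (map v) b)
            * pcm (BE n) (Min S) a b (map (map (inv (?P S))) c)))"
    by (rule sum_triple)
  also have "\<dots> = ?R"
  proof (rule sum.cong[OF refl])
    fix S
    let ?K = "sgnpow k (?P S) * ksgn (k * (int s - 1) * int (Min S)) :: 'f"
    let ?G = "\<lambda>a b u v. sgnpow k u * sgnpow k v * H (map (map u) a) (map (map v) b)
            * pcm (BE n) (Min S) a b (map (map (inv (?P S))) c)"
    have "(\<Sum>u | u permutes {1..r}. \<Sum>v | v permutes {1..s}. ?K *
         (\<Sum>a\<in>be_simplices n r. \<Sum>b\<in>be_simplices n s. ?G a b u v))
      = ?K * (\<Sum>u | u permutes {1..r}. \<Sum>v | v permutes {1..s}.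
         \<Sum>a\<in>be_simplices n r. \<Sum>b\<in>be_simplices n s. ?G a b u v)"
      by (simp only: sum_distrib_left)
    also have "(\<Sum>u | u permutes {1..r}. \<Sum>v | v permutes {1..s}.
         \<Sum>a\<in>be_simplices n r. \<Sum>b\<in>be_simplices n s. ?G a b u v)
      = (\<Sum>a\<in>be_simplices n r. \<Sum>b\<in>be_simplices n s.
          \<Sum>u | u permutes {1..r}. \<Sum>v | v permutes {1..s}. ?G a b u v)"
    proof -
      have "(\<Sum>u | u permutes {1..r}. \<Sum>v | v permutes {1..s}.
         \<Sum>a\<in>be_simplices n r. \<Sum>b\<in>be_simplices n s. ?G a b u v)
        = (\<Sum>u | u permutes {1..r}. \<Sum>a\<in>be_simplices n r. \<Sum>b\<in>be_simplices n s.
            \<Sum>v | v permutes {1..s}. ?G a b u v)"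
        by (intro sum.cong refl, subst sum.swap, intro sum.cong refl, rule sum.swap)
      also have "\<dots> = (\<Sum>a\<in>be_simplices n r. \<Sum>b\<in>be_simplices n s.
          \<Sum>u | u permutes {1..r}. \<Sum>v | v permutes {1..s}. ?G a b u v)"
        by (subst sum.swap, intro sum.cong refl, rule sum.swap)
      finally show ?thesis .
    qed
    finally show "(\<Sum>u | u permutes {1..r}. \<Sum>v | v permutes {1..s}. ?K *
         (\<Sum>a\<in>be_simplices n r. \<Sum>b\<in>be_simplices n s. ?G a b u v))
      = ?K * (\<Sum>a\<in>be_simplices n r. \<Sum>b\<in>be_simplices n s.
            (\<Sum>u | u permutes {1..r}. \<Sum>v | v permutes {1..s}.
               sgnpow k u * sgnpow k v * H (map (map u) a) (map (map v) b))
            * pcm (BE n) (Min S) a b (map (map (inv (?P S))) c))"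
      by (simp only: sum_distrib_right)
  qed
  finally show ?thesis .
qed

section \<open>Comparison of the signs\<close>

lemma choose_two_add: "(x + y) choose 2 = (x choose 2) + (y choose 2) + x * y"
proof (induction y)
  case (Suc y)
  have *: "Suc z choose 2 = z + (z choose 2)" for z
    by (simp add: numeral_2_eq_2)
  show ?case using Suc *[of "x + y"] *[of y] by simp
qed simp

text \<open>The comparison of signs for terms \<open>a \<circ>\<^sub>i b\<close>, with \<open>A\<close> and \<open>B\<close> the degrees of \<open>a\<close> and
  \<open>b\<close>, with \<open>X + 1\<close> and \<open>Y + 1\<close> their arities, and with \<open>dr\<close> and \<open>ds\<close> the binomial
  coefficients of \<open>X\<close> and \<open>Y\<close> over \<open>2\<close>. The parity of \<open>B\<close> is imposed by the degree of \<open>\<omega>\<close>.\<close>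

lemma sign_parity:
  fixes A B i X Y dr ds m n :: int
  assumes "even (B + m * Y + 1)"
  shows "even ((n + ((1 - (A + B + 1)) * (n * (X + Y + 1)) + n * m * (dr + ds + X * Y + X + Y))
      + (- n) * (dr + ds + X * Y) + m * Y * i + ((B + m * Y) * A + m * Y))
    - ((1 - (A + 1)) * (n * (X + 1)) + n * m * (dr + X) + (- n) * dr
      + (- B + n * Y) * ((i - 1) * (m - n)) + (- A + n * X + (i - 1) * (m - n))
      + ((- n) * (X + 1 - i) * Y + (- A) * (n * Y))
      + ((m - n) * (- Y) + (m - n) * (- m) * (ds + Y) + (m - n) * ds)))"
  using assms
  by (cases "even m"; cases "even n"; cases "even Y"; cases "even X"; cases "even i"; simp; argo)

text \<open>The first two terms are \<open>cobar_susp_exp\<close> on a corolla of arity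
  \<open>s\<close>, for the suspensions \<open>m - n\<close> and \<open>- m\<close>; the last one is
  the exponent of \<open>end_sgn\<close>.\<close>

definition alpha_exp :: "nat \<Rightarrow> nat \<Rightarrow> nat \<Rightarrow> int" where
  "alpha_exp n m s = (int m - int n) * (1 - int s) + (int m - int n) * (- int m) * int (s choose 2)
     + (int m - int n) * int ((s - 1) choose 2)"

lemma dg_DE: "dg (DE n :: (simplex, 'f::field) dgop) b
    = - (int (length b) - 1) + - int n * (1 - int (length (hd b)))"
  by (simp add: DE_def susp_def dual_def BE_def)

lemma ar_DE: "ar (DE n :: (simplex, 'f::field) dgop) b = length (hd b)"
  by (simp add: DE_def susp_def dual_def BE_def)

lemma bas_DE: "1 \<le> r \<Longrightarrow> bas (DE n :: (simplex, 'f::field) dgop) r = be_simplices n r"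
  by (simp add: signed_be.bas_eq[OF signed_be_DE[of n 0]])

lemma pcm_DE:
  "pcm (DE n) i a b c = ksgn (- int n * (int (length (hd a)) - int i) * (int (length (hd b)) - 1)
      + - (int (length a) - 1) * (- int n * (1 - int (length (hd b)))))
    * pcm (BE n :: (simplex, 'f::field) dgop) i a b c"
  by (simp add: DE_def susp_def dual_def BE_def)

text \<open>The action permutes the simplices up to sign, so a single term of the sum over
  \<open>c'\<close> survives.\<close>

lemma cop_DE:
  assumes "1 \<le> t" "c \<in> be_simplices n t" "S \<subseteq> {1..t}" "S \<noteq> {}"
  shows "cop (DE n) S c a b = sgnpow (- int n) (perm_of (block_word t S))
    * (pcm (DE n) (Min S) a b (map (map (inv (perm_of (block_word t S)))) c) :: 'f::field)"
proof -
  let ?w = "perm_of (block_word t S)"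
  have w: "?w permutes {1..t}" by (intro perm_of_permutes block_word_in_permutations assms)
  have t: "ar (DE n :: (simplex, 'f) dgop) c = t" using assms(2)
      by (simp add: ar_DE length_hd_be_simplices)
  have act: "act (DE n :: (simplex, 'f) dgop) (inv ?w) c c'
      = (if c' = map (map (inv ?w)) c then sgnpow (- int n) ?w else 0)" for c'
  proof -
    have "c = map (map ?w) c' \<longleftrightarrow> c' = map (map (inv ?w)) c" using map_map_inv[OF w] by metis
    then show ?thesis
      by (simp add: DE_def susp_def dual_def BE_def inv_inv_eq[OF permutes_bij[OF w]] sgnpow_inv[OF w])
  qed
  have "cop (DE n) S c a b = (\<Sum>c'\<in>be_simplices n t. if c' = map (map (inv ?w)) c
      then sgnpow (- int n) ?w * (pcm (DE n) (Min S) a b c' :: 'f) else 0)"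
    unfolding cop_def t bas_DE[OF assms(1)] act by (intro sum.cong) auto
  also have "\<dots> = sgnpow (- int n) ?w * pcm (DE n) (Min S) a b (map (map (inv ?w)) c)"
    using permutes_map_map[OF permutes_inv[OF w] assms(2)] by (simp add: finite_be_simplices)
  finally show ?thesis .
qed

text \<open>The part of the composition sign that does not involve the place of composition. It is
  constant on the orbits of both factors and therefore passes through the norms.\<close>

definition pair_sgn :: "nat \<Rightarrow> simplex \<Rightarrow> simplex \<Rightarrow> 'f::field" where
  "pair_sgn m a b = ksgn ((int (length b) - 1 + int m * (int (length (hd b)) - 1)) * (int (length a) - 1)
     + int m * (int (length (hd b)) - 1))"

lemma ksgn_comp_exp:
  "ksgn (comp_exp m a b j) = ksgn (int m * (int (length (hd b)) - 1) * int j) * (pair_sgn m a b ::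
      'f::field)"
  unfolding pair_sgn_def ksgn_add[symmetric] comp_exp_def by (rule ksgn_cong) auto

text \<open>The left side collects the signs of the desuspended map, of the suspension isomorphism
  and of the composition of series; the right side those of the suspension isomorphism, of the
  coderivation, of the suspended structure constant and of \<alpha>. Signatures of permutations are
  absent, and the rest is \<open>sign_parity\<close>.\<close>

lemma coefficient_sign:
  assumes a: "length (hd a) = r" "1 \<le> r" and b: "length (hd b) = s" "1 \<le> s"
    and c: "length (hd c) = r + s - 1" "int (length c) = int (length a) + int (length b) - 1"
    and deg: "even (int (length b) - 1 + int m * (int s - 1) + 1)"
  shows "ksgn (int n) * susp_sgn n m c * (ksgn (int m * (int s - 1) * int i) * pair_sgn m a b)
    = susp_sgn n m a * (ksgn (dg (DE n :: (simplex, 'f) dgop) b * ((int i - 1) * (int m - int n)))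
      * ksgn (dg (DE n :: (simplex, 'f) dgop) a + (int i - 1) * (int m - int n))
      * ksgn (- int n * (int (length (hd a)) - int i) * (int (length (hd b)) - 1)
          + - (int (length a) - 1) * (- int n * (1 - int (length (hd b)))))
      * ksgn (alpha_exp n m s) :: 'f::field)"
proof -
  \<comment> \<open>Shifting the arities by one removes truncated subtraction and lets
    \<open>choose_two_add\<close> expand the binomial coefficients.\<close>
  define x y where "x = r - 1" and "y = s - 1"
  have rs: "r = x + 1" "s = y + 1" using a(2) b(2) by (simp_all add: x_def y_def)
  have ch: "(x + 1) choose 2 = (x choose 2) + x" "(y + 1) choose 2 = (y choose 2) + y"
    "(x + 1 + (y + 1) - 1) choose 2 = (x choose 2) + (y choose 2) + x * y + x + y"
    "(x + 1 + (y + 1) - 1 - 1) choose 2 = (x choose 2) + (y choose 2) + x * y"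
    using choose_two_add[of x 1] choose_two_add[of y 1] choose_two_add[of "x + 1" y]
        choose_two_add[of x y]
    by simp_all
  define A B where "A = int (length a) - 1" and "B = int (length b) - 1"
  have deg': "even (B + int m * int y + 1)" using deg by (simp add: B_def rs)
  have ABl: "int (length a) = A + 1" "int (length b) = B + 1" "int (length c) = A + B + 1"
    using c(2) by (simp_all add: A_def B_def)
  have len: "int (length (hd a)) = int x + 1" "int (length (hd b)) = int y + 1" "int (length (hd c))
      = int x + int y + 1"
    using a b c rs by simp_all
  show ?thesis
    unfolding susp_sgn_def end_sgn_def pair_sgn_def dg_DE alpha_exp_def ksgn_add[symmetric]
      len ABl unfolding a(1) b(1) c(1) rs ch
    by (rule ksgn_cong, rule back_subst[of even, OF sign_parity[OF deg', of "int n" A "int x" "int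
        (x choose 2)" "int (y choose 2)" "int i"]])
      (simp add: algebra_simps)
qed

lemma symmetrize_symmetrize:
  assumes "a \<in> be_simplices n r" "b \<in> be_simplices n s"
  shows "(\<Sum>u | u permutes {1..r}. \<Sum>v | v permutes {1..s}. sgnpow k u * sgnpow k v *
      (pair_sgn m (map (map u) a) (map (map v) b) * p (map (map u) a) * g (map (map v) b)))
    = pair_sgn m a b * symmetrize k p a * (symmetrize k g b :: 'f::field)"
proof -
  have ne: "a \<noteq> []" "b \<noteq> []" using assms by (auto simp: be_simplices_alt)
  have "(\<Sum>u | u permutes {1..r}. \<Sum>v | v permutes {1..s}. sgnpow k u * sgnpow k v *
      (pair_sgn m (map (map u) a) (map (map v) b) * p (map (map u) a) * g (map (map v) b)))
    = (\<Sum>u | u permutes {1..r}. \<Sum>v | v permutes {1..s}.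
        pair_sgn m a b * ((sgnpow k u * p (map (map u) a)) * (sgnpow k v * g (map (map v) b))))"
    using ne by (intro sum.cong refl) (simp add: pair_sgn_def hd_map mult_ac)
  also have "\<dots> = pair_sgn m a b * (symmetrize k p a * symmetrize k g b)"
    using assms
    by (simp add: symmetrize_def length_hd_be_simplices sum_product sum_distrib_left[symmetric])
  finally show ?thesis by (simp add: mult_ac)
qed

text \<open>By \<open>ksgn_comp_exp\<close> the sign depends on the place \<open>j\<close> exactly
  through the factor for which \<open>symmetrize_comp\<close> is stated. What remains is constant on
  orbits, so the norms of the two factors separate.\<close>

lemma symmetrize_series_comp:
  fixes p g :: "simplex \<Rightarrow> 'f::field"
  assumes c: "c \<in> be_simplices n t" "1 \<le> t"
  shows "symmetrize (int m) (series_comp (BE n) (- int m) p g) c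
    = (\<Sum>r=1..t. \<Sum>S | S \<subseteq> {1..t} \<and> card S = t + 1 - r.
        \<Sum>a\<in>be_simplices n r. \<Sum>b\<in>be_simplices n (t + 1 - r).
          sgnpow (int m) (perm_of (block_word t S)) * ksgn (int m * (int (t + 1 - r) - 1) * int (Min
              S)) *
          (pair_sgn m a b * symmetrize (int m) p a * symmetrize (int m) g b *
            pcm (BE n) (Min S) a b (map (map (inv (perm_of (block_word t S)))) c)))"
proof -
  have len: "length (hd (map (map w) c)) = t" for w
    using c by (auto simp: length_hd_be_simplices be_simplices_alt hd_map)
  have "symmetrize (int m) (series_comp (BE n) (- int m) p g) c
    = (\<Sum>w | w permutes {1..t}. sgnpow (int m) w *
       (\<Sum>r=1..t. \<Sum>a\<in>be_simplices n r. \<Sum>b\<in>be_simplices n (t + 1 - r). \<Sum>j=1..r.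
         ksgn (comp_exp m a b j) * p a * g b * pcm (BE n) j a b (map (map w) c)))"
    unfolding symmetrize_def length_hd_be_simplices[OF c(1)] by (simp only: series_comp_eq[OF len])
  also have "\<dots> = (\<Sum>w | w permutes {1..t}. \<Sum>r=1..t. \<Sum>j=1..r.
      sgnpow (int m) w * ksgn (int m * (int (t + 1 - r) - 1) * int j) *
       (\<Sum>a\<in>be_simplices n r. \<Sum>b\<in>be_simplices n (t + 1 - r).
         pair_sgn m a b * p a * g b * pcm (BE n) j a b (map (map w) c)))"
  proof (rule sum.cong[OF refl])
    fix w
    have "(\<Sum>a\<in>be_simplices n r. \<Sum>b\<in>be_simplices n (t + 1 - r). \<Sum>j=1..r.
         ksgn (comp_exp m a b j) * p a * g b * pcm (BE n) j a b (map (map w) c))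
      = (\<Sum>j=1..r. ksgn (int m * (int (t + 1 - r) - 1) * int j) *
       (\<Sum>a\<in>be_simplices n r. \<Sum>b\<in>be_simplices n (t + 1 - r).
         pair_sgn m a b * p a * g b * pcm (BE n) j a b (map (map w) c)))" for r
    proof -
      have "(\<Sum>a\<in>be_simplices n r. \<Sum>b\<in>be_simplices n (t + 1 - r). \<Sum>j=1..r.
         ksgn (comp_exp m a b j) * p a * g b * pcm (BE n) j a b (map (map w) c))
        = (\<Sum>a\<in>be_simplices n r. \<Sum>b\<in>be_simplices n (t + 1 - r). \<Sum>j=1..r.
         ksgn (int m * (int (t + 1 - r) - 1) * int j) *
         (pair_sgn m a b * p a * g b * pcm (BE n) j a b (map (map w) c)))"
        by (intro sum.cong refl) (simp only: ksgn_comp_exp length_hd_be_simplices mult.assoc)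
      also have "\<dots> = (\<Sum>a\<in>be_simplices n r. \<Sum>j=1..r. \<Sum>b\<in>be_simplices n (t + 1 - r).
         ksgn (int m * (int (t + 1 - r) - 1) * int j) *
         (pair_sgn m a b * p a * g b * pcm (BE n) j a b (map (map w) c)))"
        by (intro sum.cong refl, rule sum.swap)
      also have "\<dots> = (\<Sum>j=1..r. \<Sum>a\<in>be_simplices n r. \<Sum>b\<in>be_simplices n (t + 1 - r).
         ksgn (int m * (int (t + 1 - r) - 1) * int j) *
         (pair_sgn m a b * p a * g b * pcm (BE n) j a b (map (map w) c)))"
        by (rule sum.swap)
      finally show ?thesis by (simp only: sum_distrib_left)
    qed
    then show "sgnpow (int m) w *
       (\<Sum>r=1..t. \<Sum>a\<in>be_simplices n r. \<Sum>b\<in>be_simplices n (t + 1 - r). \<Sum>j=1..r.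
         ksgn (comp_exp m a b j) * p a * g b * pcm (BE n) j a b (map (map w) c))
      = (\<Sum>r=1..t. \<Sum>j=1..r. sgnpow (int m) w * ksgn (int m * (int (t + 1 - r) - 1) * int j) *
       (\<Sum>a\<in>be_simplices n r. \<Sum>b\<in>be_simplices n (t + 1 - r).
         pair_sgn m a b * p a * g b * pcm (BE n) j a b (map (map w) c)))"
      by (simp only: sum_distrib_left mult.assoc)
  qed
  also have "\<dots> = (\<Sum>r=1..t. \<Sum>w | w permutes {1..t}. \<Sum>j=1..r.
      sgnpow (int m) w * ksgn (int m * (int (t + 1 - r) - 1) * int j) *
       (\<Sum>a\<in>be_simplices n r. \<Sum>b\<in>be_simplices n (t + 1 - r).
         pair_sgn m a b * p a * g b * pcm (BE n) j a b (map (map w) c)))"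
    by (rule sum.swap)
  also have "\<dots> = (\<Sum>r=1..t. \<Sum>S | S \<subseteq> {1..t} \<and> card S = t + 1 - r.
        sgnpow (int m) (perm_of (block_word t S)) * ksgn (int m * (int (t + 1 - r) - 1) * int (Min S)) *
        (\<Sum>a\<in>be_simplices n r. \<Sum>b\<in>be_simplices n (t + 1 - r).
          pair_sgn m a b * symmetrize (int m) p a * symmetrize (int m) g b *
            pcm (BE n) (Min S) a b (map (map (inv (perm_of (block_word t S)))) c)))"
  proof (rule sum.cong[OF refl])
    fix r assume "r \<in> {1..t}"
    then have r: "1 \<le> r" "1 \<le> t + 1 - r" "t = r + (t + 1 - r) - 1" by auto
    show "(\<Sum>w | w permutes {1..t}. \<Sum>j=1..r.
      sgnpow (int m) w * ksgn (int m * (int (t + 1 - r) - 1) * int j) *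
       (\<Sum>a\<in>be_simplices n r. \<Sum>b\<in>be_simplices n (t + 1 - r).
         pair_sgn m a b * p a * g b * pcm (BE n) j a b (map (map w) c)))
      = (\<Sum>S | S \<subseteq> {1..t} \<and> card S = t + 1 - r.
        sgnpow (int m) (perm_of (block_word t S)) * ksgn (int m * (int (t + 1 - r) - 1) * int (Min S)) *
        (\<Sum>a\<in>be_simplices n r. \<Sum>b\<in>be_simplices n (t + 1 - r).
          pair_sgn m a b * symmetrize (int m) p a * symmetrize (int m) g b *
            pcm (BE n) (Min S) a b (map (map (inv (perm_of (block_word t S)))) c)))"
      unfolding symmetrize_comp[OF r c(1), where k = "int m" and H = "\<lambda>a b. pair_sgn m a b * p a * g b"]
      by (intro sum.cong refl arg_cong2[where f = times] symmetrize_symmetrize)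
  qed
  finally show ?thesis by (simp only: sum_distrib_left)
qed

lemma coderivation_coeff_eq:
  assumes a: "a \<in> be_simplices n r" and c: "c \<in> be_simplices n t" and r: "1 \<le> r" "r \<le> t"
  shows "coderivation_coeff (DE n) k \<alpha> c a
    = (\<Sum>S | S \<subseteq> {1..t} \<and> card S = t + 1 - r. \<Sum>b\<in>be_simplices n (t + 1 - r).
       sgnpow k (perm_of (block_word t S))
       * ksgn (dg (DE n :: (simplex, 'f) dgop) b * ((int (Min S) - 1) * k))
       * ksgn (dg (DE n :: (simplex, 'f) dgop) a + (int (Min S) - 1) * k)
       * cop (DE n) S c a b * (\<alpha> b :: 'f::field))"
proof -
  have ab: "a \<in> basis (DE n :: (simplex, 'f) dgop)"
    using a r by (simp add: DE_def susp_def dual_def in_basis_BE length_hd_be_simplices)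
  have ar: "ar (DE n :: (simplex, 'f) dgop) a = r" "ar (DE n :: (simplex, 'f) dgop) c = t"
    using a c by (simp_all add: ar_DE length_hd_be_simplices)
  have S: "{S. S \<subseteq> {1..t} \<and> S \<noteq> {} \<and> r + card S = t + 1} = {S. S \<subseteq> {1..t} \<and> card S = t + 1 - r}"
    using r by (auto simp: finite_subset)
  show ?thesis
    unfolding coderivation_coeff_def ar S using ab r
    by (auto intro!: sum.cong simp: bas_DE)
qed

text \<open>The adjunction for one basis element \<open>c\<close>, term by term in \<open>S\<close>,
  \<open>a\<close> and \<open>b\<close>. The signature powers \<open>m - n\<close> from the
  variables and \<open>- n\<close> from the coproduct combine to the power \<open>m\<close> produced
  by the norm.\<close>

lemma susp_sgn_symmetrize_series_comp:
  fixes p g \<alpha> :: "simplex \<Rightarrow> 'f::field"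
  assumes c: "c \<in> be_simplices n t" "1 \<le> t"
    and \<alpha>: "\<And>b. b \<in> basis (BE n :: (simplex, 'f) dgop) \<Longrightarrow>
      \<alpha> b = ksgn (alpha_exp n m (length (hd b))) * symmetrize (int m) g b"
    and deg: "\<And>b. b \<in> basis (BE n :: (simplex, 'f) dgop) \<Longrightarrow> symmetrize (int m) g b \<noteq> 0 \<Longrightarrow>
      even (int (length b) - 1 + int m * (int (length (hd b)) - 1) + 1)"
  shows "ksgn (int n) * susp_sgn n m c * symmetrize (int m) (series_comp (BE n) (- int m) p g) c
    = (\<Sum>a\<in>be_upto n t. susp_sgn n m a * coderivation_coeff (DE n) (int m - int n) \<alpha> c a
        * symmetrize (int m) p a)"
proof -
  let ?w = "\<lambda>S. perm_of (block_word t S)" and ?k = "int m - int n"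
  have eq: "ksgn (int n) * susp_sgn n m c *
          (sgnpow (int m) (?w S) * ksgn (int m * (int (t + 1 - r) - 1) * int (Min S)) *
          (pair_sgn m a b * symmetrize (int m) p a * symmetrize (int m) g b *
            pcm (BE n) (Min S) a b (map (map (inv (?w S))) c)))
      = susp_sgn n m a * (sgnpow ?k (?w S)
       * ksgn (dg (DE n :: (simplex, 'f) dgop) b * ((int (Min S) - 1) * ?k))
       * ksgn (dg (DE n :: (simplex, 'f) dgop) a + (int (Min S) - 1) * ?k)
       * cop (DE n) S c a b * \<alpha> b) * symmetrize (int m) p a"
    if r: "1 \<le> r" "r \<le> t" and S: "S \<subseteq> {1..t}" "card S = t + 1 - r"
      and a: "a \<in> be_simplices n r" and b: "b \<in> be_simplices n (t + 1 - r)" for r S a b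
  proof -
    let ?s = "t + 1 - r"
    let ?Q = "pcm (BE n) (Min S) a b (map (map (inv (?w S))) c) :: 'f"
    have s: "1 \<le> ?s" "r + ?s - 1 = t" using r by auto
    have ne: "S \<noteq> {}" using S s by auto
    have w: "?w S permutes {1..t}" by (intro perm_of_permutes block_word_in_permutations S ne)
    have hd: "length (hd a) = r" "length (hd b) = ?s" "length (hd c) = r + ?s - 1"
      using a b c s by (simp_all add: length_hd_be_simplices)
    have bb: "b \<in> basis (BE n :: (simplex, 'f) dgop)" using b s hd by (simp add: in_basis_BE)
    have cop: "cop (DE n) S c a b = sgnpow (- int n) (?w S) *
        (ksgn (- int n * (int (length (hd a)) - int (Min S)) * (int (length (hd b)) - 1)
          + - (int (length a) - 1) * (- int n * (1 - int (length (hd b))))) * ?Q)"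
      by (simp only: cop_DE[OF c(2,1) S(1) ne] pcm_DE)
    have sgn: "sgnpow ?k (?w S) * sgnpow (- int n) (?w S) = (sgnpow (int m) (?w S) :: 'f)"
      using sgnpow_add[of ?k "int n" "?w S", where ?'f = 'f] by simp
    show ?thesis
    \<comment> \<open>The remaining signs are compared only on nonzero terms: a nonzero structure
      constant fixes the dimension of \<open>c\<close>, and a nonzero norm of \<open>g\<close>
      supplies the parity for \<open>sign_parity\<close>.\<close>
    proof (cases "?Q = 0 \<or> symmetrize (int m) g b = 0")
      case True
      then show ?thesis using \<alpha>[OF bb] by (auto simp: cop)
    next
      case False
      have len: "int (length c) = int (length a) + int (length b) - 1"
      proof -
        have "?Q \<noteq> 0" using False by simp
        from pcm_BE_nonzero[OF this a b s(1)] show ?thesis by simp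
      qed
      have d: "even (int (length b) - 1 + int m * (int ?s - 1) + 1)"
        using deg[OF bb] False hd by simp
      note sign = coefficient_sign[OF hd(1) r(1) hd(2) s(1) hd(3) len d, where ?'f = 'f and n = n
          and i = "Min S"]
      have "ksgn (int n) * susp_sgn n m c *
          (sgnpow (int m) (?w S) * ksgn (int m * (int ?s - 1) * int (Min S)) *
          (pair_sgn m a b * symmetrize (int m) p a * symmetrize (int m) g b * ?Q))
        = (ksgn (int n) * susp_sgn n m c * (ksgn (int m * (int ?s - 1) * int (Min S)) * pair_sgn m a b))
          * (sgnpow (int m) (?w S) * symmetrize (int m) p a * symmetrize (int m) g b * ?Q)"
        by (simp only: mult_ac)
      also have "\<dots> = susp_sgn n m a * ((sgnpow ?k (?w S) * sgnpow (- int n) (?w S))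
         * ksgn (dg (DE n :: (simplex, 'f) dgop) b * ((int (Min S) - 1) * ?k))
         * ksgn (dg (DE n :: (simplex, 'f) dgop) a + (int (Min S) - 1) * ?k)
         * (ksgn (- int n * (int (length (hd a)) - int (Min S)) * (int (length (hd b)) - 1)
          + - (int (length a) - 1) * (- int n * (1 - int (length (hd b))))) * ?Q) *
          (ksgn (alpha_exp n m ?s) * symmetrize (int m) g b)) * symmetrize (int m) p a"
        unfolding sign sgn by (simp only: mult_ac)
      finally show ?thesis unfolding cop \<alpha>[OF bb] hd(2) by (simp only: mult_ac)
    qed
  qed
  have "ksgn (int n) * susp_sgn n m c * symmetrize (int m) (series_comp (BE n) (- int m) p g) c
    = (\<Sum>r=1..t. \<Sum>S | S \<subseteq> {1..t} \<and> card S = t + 1 - r.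
        \<Sum>a\<in>be_simplices n r. \<Sum>b\<in>be_simplices n (t + 1 - r).
          ksgn (int n) * susp_sgn n m c *
          (sgnpow (int m) (?w S) * ksgn (int m * (int (t + 1 - r) - 1) * int (Min S)) *
          (pair_sgn m a b * symmetrize (int m) p a * symmetrize (int m) g b *
            pcm (BE n) (Min S) a b (map (map (inv (?w S))) c))))"
    unfolding symmetrize_series_comp[OF c] by (simp only: sum_distrib_left)
  also have "\<dots> = (\<Sum>r=1..t. \<Sum>S | S \<subseteq> {1..t} \<and> card S = t + 1 - r.
        \<Sum>a\<in>be_simplices n r. \<Sum>b\<in>be_simplices n (t + 1 - r).
          susp_sgn n m a * (sgnpow ?k (?w S)
       * ksgn (dg (DE n :: (simplex, 'f) dgop) b * ((int (Min S) - 1) * ?k))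
       * ksgn (dg (DE n :: (simplex, 'f) dgop) a + (int (Min S) - 1) * ?k)
       * cop (DE n) S c a b * \<alpha> b) * symmetrize (int m) p a)"
    by (intro sum.cong refl eq) auto
  also have "\<dots> = (\<Sum>r=1..t. \<Sum>a\<in>be_simplices n r. \<Sum>S | S \<subseteq> {1..t} \<and> card S = t + 1 - r.
        \<Sum>b\<in>be_simplices n (t + 1 - r).
          susp_sgn n m a * (sgnpow ?k (?w S)
       * ksgn (dg (DE n :: (simplex, 'f) dgop) b * ((int (Min S) - 1) * ?k))
       * ksgn (dg (DE n :: (simplex, 'f) dgop) a + (int (Min S) - 1) * ?k)
       * cop (DE n) S c a b * \<alpha> b) * symmetrize (int m) p a)"
    by (intro sum.cong refl, rule sum.swap)
  also have "\<dots> = (\<Sum>r=1..t. \<Sum>a\<in>be_simplices n r.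
      susp_sgn n m a * coderivation_coeff (DE n) ?k \<alpha> c a * symmetrize (int m) p a)"
    by (intro sum.cong refl) (simp only: coderivation_coeff_eq[OF _ c(1)] atLeastAtMost_iff
        sum_distrib_left sum_distrib_right)
  also have "\<dots> = (\<Sum>a\<in>be_upto n t. susp_sgn n m a * coderivation_coeff (DE n) ?k \<alpha> c a
        * symmetrize (int m) p a)"
    by (rule sum_be_upto[symmetric])
  finally show ?thesis .
qed

section \<open>The twisting cochain\<close>

lemma leaves_corolla: "concat (map leaves (map Leaf xs)) = xs"
  by (induction xs) auto

lemma corolla_in_cobar:
  assumes "2 \<le> r"
  shows "Vertex b (map Leaf [1..<r + 1]) \<in> basis (cobar D) \<longleftrightarrow> b \<in> basis D \<and> ar D b = r"
proof -
  have "sorted_wrt (\<lambda>s t. min_leaf s < min_leaf t) (map Leaf [1..<r + 1] :: 'a dtree list)"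
    by (simp add: sorted_wrt_map min_leaf_def del: upt_Suc)
  then show ?thesis
    using assms by (auto simp: cobar_def leaves_corolla list_all_iff simp del: upt_Suc map_map)
qed

text \<open>Leaves have arity 1 and come in their natural order, so the composition signs and the
  relabelling sign are trivial; only the vertex contributes.\<close>

lemma cobar_susp_sgn_corolla:
  "cobar_susp_sgn k l P (Vertex b (map Leaf [1..<r + 1]))
     = ksgn (k * (1 - int r) + k * l * int (r choose 2))"
proof -
  have "perm_of [1..<r + 1] = id"
    by (auto simp: perm_of_def fun_eq_iff nth_append simp del: upt_Suc)
  moreover have "sum_list (map (cobar_susp_exp k l P) (map Leaf xs)) = 0" for xs
    by (induction xs) auto
  moreover have "k * (int r - 1 - int j) * (int (length (leaves (map Leaf [1..<r + 1] ! j))) - 1)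
      + k * (1 - int (length (leaves (map Leaf [1..<r + 1] ! j)))) * z = 0" if "j < r" for j z
    using that by (simp del: upt_Suc)
  ultimately show ?thesis
    by (simp add: cobar_susp_sgn_def leaves_corolla sgnpow_def del: upt_Suc map_map)
qed

definition theta :: "nat \<Rightarrow> (simplex dtree \<Rightarrow> nat \<Rightarrow> 'f::field) \<Rightarrow> simplex \<Rightarrow> 'f" where
  "theta m \<phi> b = (if b \<in> basis (BE m :: (simplex, 'f) dgop)
     then twisting_cochain (DE m) \<phi> b (length (hd b)) else 0)"

lemma basis_DE:
  "basis (DE n :: (simplex, 'f::field) dgop) = basis (BE n :: (simplex, 'f) dgop)"
  by (simp add: DE_def susp_def dual_def)

lemma corolla_DE: "corolla (DE n :: (simplex, 'f::field) dgop) b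
    = Vertex b (map Leaf [1..<length (hd b) + 1])"
  by (simp add: corolla_def ar_DE)

text \<open>On corollas, the projection onto trees decorated by the smaller Barratt-Eccles operad
  becomes the extension by zero in \<open>theta\<close>. Below arity 2 both cochains vanish.\<close>

lemma sphere_alpha_eq:
  "sphere_alpha n m \<phi> b = ksgn (alpha_exp n m (length (hd b))) * theta m \<phi> b"
proof (cases "2 \<le> length (hd b)")
  case True
  let ?t = "Vertex b (map Leaf [1..<length (hd b) + 1])"
  have t: "?t \<in> basis (cobar (susp (- int n) (dual (BE m)) :: (simplex, 'a) dgop))
      \<longleftrightarrow> b \<in> basis (BE m :: (simplex, 'a) dgop)"
    unfolding corolla_in_cobar[OF True] by (simp add: susp_def dual_def ar_BE)
  have s: "end_sgn (int m - int n) (length (hd b)) * cobar_susp_sgn (int m - int n) (- int m)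
      (dual (BE m) :: (simplex, 'a) dgop) ?t = (ksgn (alpha_exp n m (length (hd b))) :: 'a)"
    unfolding cobar_susp_sgn_corolla end_sgn_def alpha_exp_def
    by (simp add: ksgn_add mult_ac)
  show ?thesis
    using True t unfolding s[symmetric]
    by (simp add: sphere_alpha_def twisting_cochain_def theta_def corolla_DE ar_DE
        sphere_morphism_def Let_def mult_ac del: upt_Suc)
qed (simp add: sphere_alpha_def theta_def twisting_cochain_def ar_DE)

text \<open>\<open>Com\<close> is concentrated in degree 0, so a morphism is nonzero only on
  corollas of degree 0. In arity r their simplices have dimension m(r - 1) - 1, whose parity is all
  that the signs require.\<close>

lemma theta_degree:
  assumes "operad_morphism (cobar (DE m)) Com \<phi>" "theta m \<phi> b \<noteq> (0 :: 'f::field)"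
  shows "even (int (length b) - 1 + int m * (int (length (hd b)) - 1) + 1)"
proof -
  let ?t = "Vertex b (map Leaf [1..<length (hd b) + 1])"
  have b: "b \<in> basis (BE m :: (simplex, 'f) dgop)" "2 \<le> length (hd b)" "\<phi> ?t (length (hd b)) \<noteq> 0"
    using assms(2) by (auto simp: theta_def twisting_cochain_def ar_DE corolla_DE split: if_splits)
  have "?t \<in> basis (cobar (DE m :: (simplex, 'f) dgop))"
    unfolding corolla_in_cobar[OF b(2)] using b(1) by (simp add: basis_DE ar_DE)
  then have "dg (Com :: (nat, 'f) dgop) (length (hd b)) = dg (cobar (DE m :: (simplex, 'f) dgop)) ?t"
    using assms(1) b(3) unfolding operad_morphism_def by blast
  moreover have "sum_list (map (tree_dg (DE m :: (simplex, 'f) dgop)) (map Leaf xs)) = 0" for xs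
    by (induction xs) auto
  ultimately have "int (length b) - 1 = int m * (int (length (hd b)) - 1) - 1"
    by (simp add: Com_def cobar_def dg_DE algebra_simps del: upt_Suc map_map)
  then show ?thesis by simp
qed

text \<open>The equation defining \<omega> says that its norm is the twisting cochain. Since
  \<open>BE m\<close> is stable under the symmetric groups, a series supported there has norm zero
  at the other simplices of \<open>BE n\<close>, and a change of representative in
  \<open>BE n\<close> preserves the norm.\<close>

lemma associated_element_symmetrize:
  fixes \<omega> :: "(simplex \<Rightarrow> 'f::field) set"
  assumes mn: "m \<le> n" and \<omega>: "associated_element m \<phi> \<omega>"
    and g: "g \<in> (\<Union>f\<in>\<omega>. ccls (BE n) (- int m) f)"
  shows "g \<in> series (BE n) \<and> (\<forall>b\<in>basis (BE n :: (simplex, 'f) dgop). symmetrize (int m) g b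
      = theta m \<phi> b)"
proof -
  interpret En: signed_be "BE n :: (simplex, 'f) dgop" n "- int m" "int m" by (rule signed_be_BE)
  interpret Em: signed_be "BE m :: (simplex, 'f) dgop" m "- int m" "int m" by (rule signed_be_BE)
  have sub: "basis (BE m :: (simplex, 'f) dgop) \<subseteq> basis (BE n :: (simplex, 'f) dgop)"
    unfolding basis_BE using be_simplices_mono[OF mn] by blast
  obtain f where f: "f \<in> \<omega>" "g \<in> ccls (BE n) (- int m) f" using g by blast
  have "\<omega> \<in> cfree (BE m) (- int m)" using \<omega> by (simp add: associated_element_def)
  then have fm: "f \<in> series (BE m)" using f(1) by (auto simp: Em.cfree_eq Em.ccls_eq)
  then have fn: "f \<in> series (BE n)" using sub by (auto simp: series_def)
  have "symmetrize (int m) f b = theta m \<phi> b" if b: "b \<in> basis (BE n :: (simplex, 'f) dgop)" for b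
  proof (cases "b \<in> basis (BE m :: (simplex, 'f) dgop)")
    case True
    then have "b \<in> bas (DE m :: (simplex, 'f) dgop) (length (hd b))"
      by (simp add: bas_def basis_DE ar_DE)
    then have "twisting_cochain (DE m) \<phi> b (length (hd b))
        = (\<Sum>w | w permutes {1..length (hd b)}. tact (BE m) (- int m) w f b)"
      using \<omega> f(1) unfolding associated_element_def by blast
    then show ?thesis using Em.sum_tact[OF True fm] True by (simp add: theta_def)
  next
    case False
    then show ?thesis using Em.symmetrize_outside[OF fm False ne_basis_BE[OF b]] by (simp add: theta_def)
  qed
  then show ?thesis using f(2) by (auto simp: En.ccls_eq[OF fn] norm_equal_def)
qed

section \<open>The twisting coderivation\<close>

definition coder :: "nat \<Rightarrow> int \<Rightarrow> (simplex \<Rightarrow> 'f::field) \<Rightarrow> (simplex \<Rightarrow> 'f) \<Rightarrow> simplex \<Rightarrow> 'f" where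
  "coder n k \<alpha> f a = (\<Sum>c | f c \<noteq> 0. f c * coderivation_coeff (DE n) k \<alpha> c a)"

text \<open>The set \<open>S\<close> is nonempty, so the arity cannot grow. The truncations
  \<open>be_upto n N\<close> are therefore preserved, and a finite series stays finite.\<close>

lemma coderivation_coeff_outside:
  assumes "coderivation_coeff (DE n) k \<alpha> c a \<noteq> (0 :: 'f::field)"
  shows "a \<in> be_upto n (length (hd c))"
proof -
  have a: "a \<in> basis (BE n :: (simplex, 'f) dgop)"
    using assms by (auto simp: coderivation_coeff_def basis_DE split: if_splits)
  have "\<exists>S. S \<subseteq> {1..length (hd c)} \<and> S \<noteq> {} \<and> length (hd a) + card S = length (hd c) + 1"
  proof (rule ccontr)
    assume "\<not> ?thesis"
    then have "coderivation_coeff (DE n) k \<alpha> c a = 0"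
      unfolding coderivation_coeff_def ar_DE by (auto intro!: sum.neutral)
    then show False using assms by simp
  qed
  then obtain S where S: "S \<subseteq> {1..length (hd c)}" "S \<noteq> {}"
    "length (hd a) + card S = length (hd c) + 1" by blast
  then have "1 \<le> card S" using finite_subset[OF S(1)] by (simp add: Suc_leI card_gt_0_iff)
  then have "length (hd a) \<le> length (hd c)" using S(3) by linarith
  then show ?thesis using in_be_upto[OF a] be_upto_mono[of _ _ n] by blast
qed

lemma coder_supp:
  assumes "{c. f c \<noteq> 0} \<subseteq> be_upto n N"
  shows "{a. coder n k \<alpha> f a \<noteq> 0} \<subseteq> be_upto n N"
proof
  fix a assume "a \<in> {a. coder n k \<alpha> f a \<noteq> 0}"
  then have "coder n k \<alpha> f a \<noteq> 0" by simp
  then obtain c where "f c \<noteq> 0" "coderivation_coeff (DE n) k \<alpha> c a \<noteq> 0"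
    unfolding coder_def by (rule sum.not_neutral_contains_not_neutral) auto
  then have "c \<in> be_upto n N" "a \<in> be_upto n (length (hd c))"
    using assms coderivation_coeff_outside by blast+
  moreover from this have "length (hd c) \<le> N" by (auto simp: be_upto_def length_hd_be_simplices)
  ultimately show "a \<in> be_upto n N" using be_upto_mono[of "length (hd c)" N n] by blast
qed

lemma coder_fin_series:
  assumes "f \<in> fin_series (BE n)"
  shows "coder n k \<alpha> f \<in> fin_series (BE n :: (simplex, 'f::field) dgop)"
proof -
  obtain N where "{c. f c \<noteq> 0} \<subseteq> be_upto n N" using fin_series_upto[OF assms] .
  then have N: "{a. coder n k \<alpha> f a \<noteq> 0} \<subseteq> be_upto n N" by (rule coder_supp)
  then have "coder n k \<alpha> f b = 0" if "b \<notin> basis (BE n :: (simplex, 'f) dgop)" for b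
    using that be_upto_basis[of b n N] by blast
  then show ?thesis using finite_subset[OF N] by (simp add: fin_series_def series_def)
qed

locale twisting =
  fixes n m :: nat and \<phi> :: "simplex dtree \<Rightarrow> nat \<Rightarrow> 'f::field" and \<omega> :: "(simplex \<Rightarrow> 'f) set"
  assumes mn: "m \<le> n"
    and morph: "operad_morphism (cobar (DE m)) Com \<phi>"
    and assoc: "associated_element m \<phi> \<omega>"
begin

abbreviation cod :: "(simplex \<Rightarrow> 'f) \<Rightarrow> simplex \<Rightarrow> 'f" where
  "cod \<equiv> coder n (int m - int n) (sphere_alpha n m \<phi>)"

abbreviation sus :: "(simplex \<Rightarrow> 'f) \<Rightarrow> simplex \<Rightarrow> 'f" where
  "sus f \<equiv> (\<lambda>b. susp_sgn n m b * f b)"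

abbreviation cl :: "(simplex \<Rightarrow> 'f) \<Rightarrow> (simplex \<Rightarrow> 'f) set" where
  "cl \<equiv> ccls (BE n) (- int m)"

definition omegas :: "(simplex \<Rightarrow> 'f) set" where
  "omegas = (\<Union>f\<in>\<omega>. cl f)"

interpretation E: signed_be "BE n :: (simplex, 'f) dgop" n "- int m" "int m" by (rule signed_be_BE)
interpretation d: signed_be "dual (BE n :: (simplex, 'f) dgop)" n "int m" "int m"
    by (rule signed_be_dual)
interpretation D: signed_be "DE n :: (simplex, 'f) dgop" n "int m - int n" "int m" by (rule signed_be_DE)

lemma omegas: "g \<in> omegas \<Longrightarrow> g \<in> series (BE n)"
  "g \<in> omegas \<Longrightarrow> b \<in> basis (BE n :: (simplex, 'f) dgop) \<Longrightarrow> symmetrize (int m) g b = theta m \<phi> b"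
  using associated_element_symmetrize[OF mn assoc] unfolding omegas_def by blast+

lemma omegas_ne: "\<exists>g. g \<in> omegas"
proof -
  have "\<omega> \<in> cfree (BE m) (- int m)" "\<exists>f. f \<in> \<omega>" using assoc by (auto simp: associated_element_def)
  interpret Em: signed_be "BE m :: (simplex, 'f) dgop" m "- int m" "int m" by (rule signed_be_BE)
  have sub: "basis (BE m :: (simplex, 'f) dgop) \<subseteq> basis (BE n :: (simplex, 'f) dgop)"
    unfolding basis_BE using be_simplices_mono[OF mn] by blast
  obtain f where f: "f \<in> \<omega>" using \<open>\<exists>f. f \<in> \<omega>\<close> by blast
  then have "f \<in> series (BE m)" using \<open>\<omega> \<in> _\<close> by (auto simp: Em.cfree_eq Em.ccls_eq)
  then have "f \<in> series (BE n)" using sub by (auto simp: series_def)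
  then have "f \<in> cl f" by (simp add: E.ccls_eq norm_equal_def)
  then show ?thesis using f by (auto simp: omegas_def)
qed

text \<open>This is the adjunction on representatives. All sums are enlarged to one finite
  truncation, so that they can be exchanged; the identity for single basis elements then
  applies.\<close>

lemma pairing_cod:
  assumes c: "c \<in> fin_series (BE n)" and g: "g \<in> omegas"
  shows "pairing (int m) (sus (cod c)) p
    = ksgn (int n) * pairing (int m) (sus c) (series_comp (BE n) (- int m) p g)"
proof -
  let ?k = "int m - int n" and ?\<alpha> = "sphere_alpha n m \<phi>"
  obtain N where N: "{b. c b \<noteq> 0} \<subseteq> be_upto n N" using fin_series_upto[OF c] .
  have sN: "{b. sus c b \<noteq> 0} \<subseteq> be_upto n N" "{b. sus (cod c) b \<noteq> 0} \<subseteq> be_upto n N"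
    using N coder_supp[OF N] by auto
  have key: "ksgn (int n) * susp_sgn n m x * symmetrize (int m) (series_comp (BE n) (- int m) p g) x
      = (\<Sum>a\<in>be_upto n N. susp_sgn n m a * coderivation_coeff (DE n) ?k ?\<alpha> x a * symmetrize (int m) p a)"
    if x: "x \<in> be_upto n N" for x
  proof -
    let ?t = "length (hd x)"
    have t: "x \<in> be_simplices n ?t" "1 \<le> ?t" "?t \<le> N"
      using x by (auto simp: be_upto_def length_hd_be_simplices)
    have "ksgn (int n) * susp_sgn n m x * symmetrize (int m) (series_comp (BE n) (- int m) p g) x
      = (\<Sum>a\<in>be_upto n ?t. susp_sgn n m a * coderivation_coeff (DE n) ?k ?\<alpha> x a * symmetrize (int m) p a)"
    proof (rule susp_sgn_symmetrize_series_comp[OF t(1,2)])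
      fix b assume b: "b \<in> basis (BE n :: (simplex, 'f) dgop)"
      show "?\<alpha> b = ksgn (alpha_exp n m (length (hd b))) * symmetrize (int m) g b"
        by (simp only: omegas(2)[OF g b] sphere_alpha_eq)
      show "even (int (length b) - 1 + int m * (int (length (hd b)) - 1) + 1)"
        if "symmetrize (int m) g b \<noteq> 0"
        using theta_degree[OF morph] that unfolding omegas(2)[OF g b] .
    qed
    also have "\<dots> = (\<Sum>a\<in>be_upto n N. susp_sgn n m a * coderivation_coeff (DE n) ?k ?\<alpha> x a *
        symmetrize (int m) p a)"
    proof (rule sum.mono_neutral_left)
      show "\<forall>a\<in>be_upto n N - be_upto n ?t.
          susp_sgn n m a * coderivation_coeff (DE n) ?k ?\<alpha> x a * symmetrize (int m) p a = 0"
        using coderivation_coeff_outside[of n ?k ?\<alpha> x] by auto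
    qed (use be_upto_mono[OF t(3)] in auto)
    finally show ?thesis .
  qed
  have cod: "cod c a = (\<Sum>x\<in>be_upto n N. c x * coderivation_coeff (DE n) ?k ?\<alpha> x a)" for a
    unfolding coder_def using N by (intro sum.mono_neutral_left) auto
  have "pairing (int m) (sus (cod c)) p = (\<Sum>a\<in>be_upto n N. susp_sgn n m a * cod c a * symmetrize
      (int m) p a)"
    by (rule pairing_upto[OF sN(2)])
  also have "\<dots> = (\<Sum>a\<in>be_upto n N. \<Sum>x\<in>be_upto n N.
      c x * (susp_sgn n m a * coderivation_coeff (DE n) ?k ?\<alpha> x a * symmetrize (int m) p a))"
    unfolding cod by (simp add: sum_distrib_left sum_distrib_right mult_ac)
  also have "\<dots> = (\<Sum>x\<in>be_upto n N. \<Sum>a\<in>be_upto n N.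
      c x * (susp_sgn n m a * coderivation_coeff (DE n) ?k ?\<alpha> x a * symmetrize (int m) p a))"
    by (rule sum.swap)
  also have "\<dots> = (\<Sum>x\<in>be_upto n N. c x *
      (ksgn (int n) * susp_sgn n m x * symmetrize (int m) (series_comp (BE n) (- int m) p g) x))"
    by (intro sum.cong refl) (simp only: key sum_distrib_left)
  also have "\<dots> = ksgn (int n) * (\<Sum>x\<in>be_upto n N. susp_sgn n m x * c x *
      symmetrize (int m) (series_comp (BE n) (- int m) p g) x)"
    by (simp add: sum_distrib_left mult_ac)
  also have "\<dots> = ksgn (int n) * pairing (int m) (sus c) (series_comp (BE n) (- int m) p g)"
    by (simp only: pairing_upto[OF sN(1)])
  finally show ?thesis .
qed

text \<open>Pairing with \<open>p\<close> moves the coderivation to the other side as a composition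
  of series, and the resulting value depends only on the class of \<open>c\<close>.\<close>

lemma norm_equal_cod:
  assumes c: "c \<in> fin_series (BE n)" "c' \<in> fin_series (BE n)" "norm_equal n (int m) c c'"
  shows "norm_equal n (int m) (cod c) (cod c')"
proof -
  obtain g where g: "g \<in> omegas" using omegas_ne by blast
  have "norm_equal n (int m) (sus (cod c)) (sus (cod c'))"
  proof (rule norm_equalI_pairing)
    fix p :: "simplex \<Rightarrow> 'f"
    have "pairing (int m) (sus c) q = pairing (int m) (sus c') q" for q
      using c by (intro pairing_cong_left[of _ n]) (simp_all add: fin_series_susp_sgn
          norm_equal_susp_sgn)
    then show "pairing (int m) (sus (cod c)) p = pairing (int m) (sus (cod c')) p"
      using pairing_cod[OF c(1) g] pairing_cod[OF c(2) g] by simp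
  qed (use c in \<open>auto intro: fin_series_susp_sgn coder_fin_series\<close>)
  then show ?thesis by (simp only: norm_equal_susp_sgn)
qed

lemma twisting_coderivation_eq:
  assumes c: "c \<in> fin_series (BE n)"
  shows "twisting_coderivation (DE n) (int m - int n) (sphere_alpha n m \<phi>) (fcls (DE n) (int m - int
      n) c)
    = fcls (DE n) (int m - int n) (cod c)"
proof -
  have "fcls (DE n) (int m - int n) (cod f) = fcls (DE n) (int m - int n) (cod c)"
    if "f \<in> fcls (DE n) (int m - int n) c" for f
  proof -
    have f: "f \<in> fin_series (BE n)" "norm_equal n (int m) c f" using that c by (simp_all add: D.fcls_eq)
    have "norm_equal n (int m) (cod f) (cod c)"
      using norm_equal_cod[OF c f] by (simp add: norm_equal_def)
    then show ?thesis using c f by (subst D.fcls_eq_iff) (auto intro: coder_fin_series)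
  qed
  moreover have "c \<in> fcls (DE n) (int m - int n) c" using c by (simp add: D.fcls_eq norm_equal_def)
  moreover have "twisting_coderivation (DE n) (int m - int n) (sphere_alpha n m \<phi>) Y
      = (\<Union>f\<in>Y. fcls (DE n) (int m - int n) (cod f))" for Y
    by (simp add: twisting_coderivation_def coder_def[abs_def])
  ultimately show ?thesis by blast
qed

text \<open>In \<open>pairing_cod\<close> the side of the coderivation does not mention
  \<open>g\<close> and sees \<open>p\<close> only through its norm.\<close>

lemma norm_equal_series_comp:
  assumes p: "p \<in> series (BE n)" "p' \<in> series (BE n)" "norm_equal n (int m) p p'"
    and g: "g \<in> omegas" "g' \<in> omegas"
  shows "norm_equal n (int m) (series_comp (BE n) (- int m) p g) (series_comp (BE n) (- int m) p' g')"
proof (rule norm_equalI_pairing_right)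
  fix c :: "simplex \<Rightarrow> 'f" assume c: "c \<in> fin_series (BE n)"
  then have s: "sus c \<in> fin_series (BE n)" by (rule fin_series_susp_sgn)
  then have "sus (cod (sus c)) \<in> series (BE n)"
    by (rule fin_seriesD[OF fin_series_susp_sgn[OF coder_fin_series]])
  then have "pairing (int m) (sus (cod (sus c))) p = pairing (int m) (sus (cod (sus c))) p'"
    using p(3) by (rule pairing_cong_right)
  \<comment> \<open>The adjunction is applied to \<open>sus c\<close>, whose suspension sign cancels
    to give back \<open>c\<close>.\<close>
  then have "ksgn (int n) * pairing (int m) c (series_comp (BE n) (- int m) p g)
      = ksgn (int n) * pairing (int m) c (series_comp (BE n) (- int m) p' g')"
    unfolding pairing_cod[OF s g(1), of p] pairing_cod[OF s g(2), of p'] by (simp only: susp_sgn_square)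
  then show "pairing (int m) c (series_comp (BE n) (- int m) p g)
      = pairing (int m) c (series_comp (BE n) (- int m) p' g')"
    by (metis ksgn_square)
qed

lemma twisting_derivation_eq:
  assumes p: "p \<in> series (BE n)" and g: "g \<in> omegas"
  shows "twisting_derivation n m \<omega> (cl p) = cl (series_comp (BE n) (- int m) p g)"
proof -
  have "cl (series_comp (BE n) (- int m) p' g') = cl (series_comp (BE n) (- int m) p g)"
    if "p' \<in> cl p" "g' \<in> omegas" for p' g'
  proof -
    have p': "p' \<in> series (BE n)" "norm_equal n (int m) p p'" using that p by (simp_all add: E.ccls_eq)
    have "norm_equal n (int m) p' p" using p'(2) by (simp add: norm_equal_def)
    from norm_equal_series_comp[OF p'(1) p this that(2) g] show ?thesis
      by (simp add: E.ccls_eq_iff series_comp_in_series)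
  qed
  moreover have "p \<in> cl p" using p by (simp add: E.ccls_eq norm_equal_def)
  ultimately show ?thesis
    using g unfolding twisting_derivation_def cfree_comp_def omegas_def[symmetric] by blast
qed

lemma twisting_adjoint:
  assumes Y: "Y \<in> ffree (DE n) (int m - int n)"
  shows "twisting_coderivation (DE n) (int m - int n) (sphere_alpha n m \<phi>) Y
              \<in> ffree (DE n) (int m - int n) \<and>
            norm_iso (BE n) (- int m) (susp_iso n m (BE n)
                (twisting_coderivation (DE n) (int m - int n) (sphere_alpha n m \<phi>) Y))
              = desusp_map n (BE n) (- int m)
                  (adjoint (BE n) (- int m) (twisting_derivation n m \<omega>))
                  (norm_iso (BE n) (- int m) (susp_iso n m (BE n) Y))"
proof -
  obtain c where c: "c \<in> fin_series (BE n)" "Y = fcls (DE n) (int m - int n) c"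
    using Y by (auto simp: D.ffree_eq)
  obtain g where g: "g \<in> omegas" using omegas_ne by blast
  have cod: "cod c \<in> fin_series (BE n)" using c(1) by (rule coder_fin_series)
  have sc: "sus c \<in> fin_series (BE n)" using c(1) by (rule fin_series_susp_sgn)
  have "norm_iso (BE n) (- int m) (fcls (dual (BE n)) (int m) (sus (cod c)))
      = desusp_map n (BE n) (- int m) (adjoint (BE n) (- int m) (twisting_derivation n m \<omega>))
          (norm_iso (BE n) (- int m) (fcls (dual (BE n)) (int m) (sus c)))"
  proof (rule ext_norm_isoI)
    fix p :: "simplex \<Rightarrow> 'f" assume p: "p \<in> series (BE n)"
    then have "cl p \<in> cfree (BE n) (- int m)" by (simp add: E.cfree_eq)
    then show "desusp_map n (BE n) (- int m) (adjoint (BE n) (- int m) (twisting_derivation n m \<omega>))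
          (norm_iso (BE n) (- int m) (fcls (dual (BE n)) (int m) (sus c))) (cl p)
        = pairing (int m) (sus (cod c)) p"
      by (simp add: desusp_map_def adjoint_def twisting_derivation_eq[OF p g]
          norm_iso_eq[OF sc series_comp_in_series] pairing_cod[OF c(1) g])
  qed (use cod in \<open>auto simp: desusp_map_def intro: fin_series_susp_sgn\<close>)
  then show ?thesis
    using c cod by (simp add: twisting_coderivation_eq susp_iso_fcls D.ffree_eq)
qed

end

theorem lemma3p6:
  fixes n m :: nat
    and \<phi> :: "simplex dtree \<Rightarrow> nat \<Rightarrow> 'f::field"
    and \<omega> :: "(simplex \<Rightarrow> 'f) set"
  assumes "1 \<le> m" and "m \<le> n"
    and "augmentation_morphism m \<phi>"
    and "associated_element m \<phi> \<omega>"
  shows "bij_betw (susp_iso n m (BE n :: (simplex, 'f) dgop))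
           (ffree (DE n) (int m - int n)) (ffree (dual (BE n)) (int m)) \<and>
         bij_betw (norm_iso (BE n :: (simplex, 'f) dgop) (- int m))
           (ffree (dual (BE n)) (int m)) (cdual (BE n) (- int m)) \<and>
         (\<forall>Y\<in>ffree (DE n) (int m - int n).
            twisting_coderivation (DE n) (int m - int n) (sphere_alpha n m \<phi>) Y
              \<in> ffree (DE n) (int m - int n) \<and>
            norm_iso (BE n) (- int m) (susp_iso n m (BE n)
                (twisting_coderivation (DE n) (int m - int n) (sphere_alpha n m \<phi>) Y))
              = desusp_map n (BE n) (- int m)
                  (adjoint (BE n) (- int m) (twisting_derivation n m \<omega>))
                  (norm_iso (BE n) (- int m) (susp_iso n m (BE n) Y)))"
proof -
  have "twisting n m \<phi> \<omega>"
    using assms by unfold_locales (auto simp: augmentation_morphism_def)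
  then show ?thesis
    using bij_betw_susp_iso bij_betw_norm_iso twisting.twisting_adjoint by blast
qed

end
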